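(* Let $\lambda>0$, let $\Omega\subset\mathbb{R}^m$ be a measurable set of finite perimeter, let $n=m-1$, and let $\Sigma(\Omega,\lambda)$ be a minimizer of $$F_{CE}^{\lambda}(\Sigma)=\operatorname{Per}(\Sigma)+\lambda|\Sigma\vartriangle\Omega|$$ over all measurable sets $\Sigma\subset\mathbb{R}^m$. Then $$\mathbb{F}_\lambda(T_{\partial\Omega})=F_{CE}^{\lambda}(\Sigma(\Omega,\lambda)),$$ and $\{T_{\partial\Omega},\,S_{\Sigma(\Omega,\lambda)\vartriangle\Omega}\}$ is the optimal decomposition that the flat norm with scale requires; that is, $S=S_{\Sigma(\Omega,\lambda)\vartriangle\Omega}$ attains the minimum in the definition of $\mathbb{F}_\lambda(T_{\partial\Omega})$: $$\mathbb{F}_\lambda(T_{\partial\Omega})=\lambda\,\mathbf{M}\big(S_{\Sigma(\Omega,\lambda)\vartriangle\Omega}\big)+\mathbf{M}\big(T_{\partial\Omega}-\partial S_{\Sigma(\Omega,\lambda)\vartriangle\Omega}\big).$$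
   Context: $|\cdot|$ of a set is Lebesgue measure on $\mathbb{R}^m$, $\vartriangle$ is symmetric difference, and $\operatorname{Per}(\Sigma)\in[0,\infty]$ is the perimeter of $\Sigma$ (total variation of the distributional gradient of its characteristic function $\chi_\Sigma$). An $n$-current in $\mathbb{R}^m$ is a continuous linear functional on the space $\mathcal{D}^n$ of smooth compactly supported $n$-forms on $\mathbb{R}^m$. The boundary of a current is $\partial T(\phi)=T(d\phi)$. The mass is $\mathbf{M}(T)=\sup\{T(\phi):\phi\in\mathcal{D}^n,\ |\phi|\le 1\}\in[0,\infty]$, where $|\phi|$ is the pointwise comass norm. The flat norm with scale $\lambda$ of an $n$-current $T$ is $$\mathbb{F}_\lambda(T)=\min_{S}\{\lambda\,\mathbf{M}(S)+\mathbf{M}(T-\partial S)\},$$ where $S$ ranges over all $(n+1)$-currents in $\mathbb{R}^m$. If $S$ attains this minimum, the pair $\{T,S\}$ is called an optimal decomposition for the flat norm with scale $\lambda$. For a measurable set $E\subset\mathbb{R}^m$ let $[E]$ denote the $m$-current $[E](\phi)=\int_E\phi$ (standard orientation of $\mathbb{R}^m$). Then $T_{\partial\Omega}=\partial[\Omega]$ is the oriented boundary of $\Omega$ regarded as an $(m-1)$-current, and $S_{\Sigma\vartriangle\Omega}=[\Omega]-[\Sigma]=[\Omega\setminus\Sigma]-[\Sigma\setminus\Omega]$ is the $m$-current carried by $\Sigma\vartriangle\Omega$, oriented so that $T_{\partial\Omega}-\partial S_{\Sigma\vartriangle\Omega}=T_{\partial\Sigma}$. *)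

theory Defs
  imports "HOL-Analysis.Analysis"
begin

section \<open>Smooth functions\<close>

primrec iter_deriv ::
    "'a list \<Rightarrow> ('a::euclidean_space \<Rightarrow> 'b::real_normed_vector) \<Rightarrow> 'a \<Rightarrow> 'b" where
  "iter_deriv [] f = f"
| "iter_deriv (u # us) f = (\<lambda>x. frechet_derivative (iter_deriv us f) (at x) u)"

text \<open>
  \<open>C\<^sup>\<infinity>\<close>: all iterated directional derivatives are again (totally) differentiable everywhere; in
  particular all of them are continuous.
\<close>

definition smooth :: "('a::euclidean_space \<Rightarrow> 'b::real_normed_vector) \<Rightarrow> bool" where
  "smooth f \<longleftrightarrow> (\<forall>us x. iter_deriv us f differentiable (at x))"

section \<open>Differential forms\<close>

text \<open>
  A \<open>k\<close>-covector is an alternating \<open>k\<close>-linear function of vectors \<open>v 0, \<dots>, v (k - 1)\<close>. It is applied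
  to infinite sequences, but required to ignore all entries from \<open>v k\<close> on.
\<close>

definition covector :: "nat \<Rightarrow> ((nat \<Rightarrow> 'a::euclidean_space) \<Rightarrow> real) \<Rightarrow> bool" where
  "covector k \<omega> \<longleftrightarrow>
     (\<forall>v w. (\<forall>i<k. v i = w i) \<longrightarrow> \<omega> v = \<omega> w) \<and>
     (\<forall>i<k. \<forall>v. linear (\<lambda>u. \<omega> (v(i := u)))) \<and>
     (\<forall>i<k. \<forall>j<k. \<forall>v. i \<noteq> j \<longrightarrow> v i = v j \<longrightarrow> \<omega> v = 0)"

text \<open>
  The comass is the supremum over unit simple \<open>k\<close>-vectors, i.e. over \<open>\<plusminus> v 0 \<and> \<dots> \<and> v (k - 1)\<close> with
  \<open>v 0, \<dots>, v (k - 1)\<close> orthonormal; the sign (relevant for \<open>k = 0\<close>) is accounted for by the absolute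
  value. For \<open>k\<close> larger than the dimension there are no such vectors and the comass is \<open>0\<close>.
\<close>

definition comass :: "nat \<Rightarrow> ((nat \<Rightarrow> 'a::euclidean_space) \<Rightarrow> real) \<Rightarrow> real" where
  "comass k \<omega> =
     Sup (insert 0 {\<bar>\<omega> v\<bar> | v. \<forall>i<k. \<forall>j<k. v i \<bullet> v j = (if i = j then 1 else 0)})"

type_synonym 'a form = "'a \<Rightarrow> (nat \<Rightarrow> 'a) \<Rightarrow> real"

definition test_forms_in :: "'a::euclidean_space set \<Rightarrow> nat \<Rightarrow> 'a form set" where
  "test_forms_in K k =
     {\<phi>. (\<forall>x. covector k (\<phi> x)) \<and> (\<forall>v. smooth (\<lambda>x. \<phi> x v)) \<and> (\<forall>x v. x \<notin> K \<longrightarrow> \<phi> x v = 0)}"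

definition test_forms :: "nat \<Rightarrow> 'a::euclidean_space form set" where
  "test_forms k = (\<Union>K\<in>{K. compact K}. test_forms_in K k)"

text \<open>
  Exterior derivative of a \<open>k\<close>-form:
  \<open>d\<phi>(v\<^sub>0, \<dots>, v\<^sub>k) = \<Sum>\<^sub>i (-1)\<^sup>i (D\<^bsub>v\<^sub>i\<^esub> \<phi>)(v\<^sub>0, \<dots>, v\<^bsub>i-1\<^esub>, v\<^bsub>i+1\<^esub>, \<dots>, v\<^sub>k)\<close>.
\<close>

definition ext_deriv :: "nat \<Rightarrow> 'a::euclidean_space form \<Rightarrow> 'a form" where
  "ext_deriv k \<phi> = (\<lambda>x v. \<Sum>i\<le>k.
     (-1) ^ i * frechet_derivative (\<lambda>y. \<phi> y (\<lambda>j. if j < i then v j else v (Suc j))) (at x) (v i))"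

section \<open>Currents\<close>

text \<open>
  Each space of forms supported in a fixed compact \<open>K\<close> carries the topology of uniform convergence of
  all partial derivatives of all coefficients; the space of all test forms carries the largest topology
  making the inclusions of these spaces continuous (Federer, 4.1.1). The linear functionals
  continuous for it are the same as for the locally convex inductive limit topology: in both cases,
  those whose restrictions to all these subspaces are continuous.
\<close>

definition form_nbhd ::
    "'a::euclidean_space set \<Rightarrow> nat \<Rightarrow> 'a form \<Rightarrow> nat \<Rightarrow> real \<Rightarrow> 'a form set" where
  "form_nbhd K k \<phi> N \<epsilon> = {\<psi> \<in> test_forms_in K k.
     \<forall>us v x. length us \<le> N \<longrightarrow> set us \<subseteq> Basis \<longrightarrow> range v \<subseteq> Basis \<longrightarrow>
       \<bar>iter_deriv us (\<lambda>y. \<psi> y v - \<phi> y v) x\<bar> < \<epsilon>}"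

definition open_forms :: "nat \<Rightarrow> 'a::euclidean_space form set \<Rightarrow> bool" where
  "open_forms k U \<longleftrightarrow> U \<subseteq> test_forms k \<and>
     (\<forall>K. compact K \<longrightarrow> (\<forall>\<phi> \<in> U \<inter> test_forms_in K k. \<exists>N. \<exists>\<epsilon>>0. form_nbhd K k \<phi> N \<epsilon> \<subseteq> U))"

definition form_topology :: "nat \<Rightarrow> 'a::euclidean_space form topology" where
  "form_topology k = topology (open_forms k)"

lemma istopology_open_forms: "istopology (open_forms k)"
  unfolding istopology_def
proof (intro conjI allI impI)
  fix S T :: "'a form set"
  assume S: "open_forms k S" and T: "open_forms k T"
  show "open_forms k (S \<inter> T)"
    unfolding open_forms_def
  proof (intro conjI allI impI ballI)
    show "S \<inter> T \<subseteq> test_forms k" using S by (auto simp: open_forms_def)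
    fix K :: "'a set" and \<phi>
    assume K: "compact K" and \<phi>: "\<phi> \<in> S \<inter> T \<inter> test_forms_in K k"
    obtain N \<epsilon> where 1: "\<epsilon> > 0" "form_nbhd K k \<phi> N \<epsilon> \<subseteq> S"
      using S K \<phi> unfolding open_forms_def by blast
    obtain M \<delta> where 2: "\<delta> > 0" "form_nbhd K k \<phi> M \<delta> \<subseteq> T"
      using T K \<phi> unfolding open_forms_def by blast
    have "form_nbhd K k \<phi> (max N M) (min \<epsilon> \<delta>) \<subseteq> form_nbhd K k \<phi> N \<epsilon> \<inter> form_nbhd K k \<phi> M \<delta>"
      unfolding form_nbhd_def by auto
    then have "form_nbhd K k \<phi> (max N M) (min \<epsilon> \<delta>) \<subseteq> S \<inter> T"
      using 1 2 by blast
    moreover have "min \<epsilon> \<delta> > 0" using 1 2 by simp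
    ultimately show "\<exists>N. \<exists>\<epsilon>>0. form_nbhd K k \<phi> N \<epsilon> \<subseteq> S \<inter> T" by blast
  qed
next
  fix \<U> :: "'a form set set"
  assume U: "\<forall>S\<in>\<U>. open_forms k S"
  show "open_forms k (\<Union>\<U>)"
    unfolding open_forms_def
  proof (intro conjI allI impI ballI)
    show "\<Union>\<U> \<subseteq> test_forms k" using U by (auto simp: open_forms_def)
    fix K :: "'a set" and \<phi>
    assume K: "compact K" and \<phi>: "\<phi> \<in> \<Union>\<U> \<inter> test_forms_in K k"
    then obtain S where S: "S \<in> \<U>" "\<phi> \<in> S \<inter> test_forms_in K k" by blast
    then obtain N \<epsilon> where "\<epsilon> > 0" "form_nbhd K k \<phi> N \<epsilon> \<subseteq> S"
      using U K unfolding open_forms_def by meson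
    then show "\<exists>N. \<exists>\<epsilon>>0. form_nbhd K k \<phi> N \<epsilon> \<subseteq> \<Union>\<U>" using S by blast
  qed
qed

lemma openin_form_topology: "openin (form_topology k) = open_forms k"
  by (simp add: form_topology_def topology_inverse' istopology_open_forms)

definition current :: "nat \<Rightarrow> ('a::euclidean_space form \<Rightarrow> real) \<Rightarrow> bool" where
  "current k T \<longleftrightarrow>
     (\<forall>\<phi>\<in>test_forms k. \<forall>\<psi>\<in>test_forms k. T (\<lambda>x v. \<phi> x v + \<psi> x v) = T \<phi> + T \<psi>) \<and>
     (\<forall>c. \<forall>\<phi>\<in>test_forms k. T (\<lambda>x v. c * \<phi> x v) = c * T \<phi>) \<and>
     continuous_map (form_topology k) euclideanreal T"

text \<open>The boundary of a \<open>Suc k\<close>-current, as a \<open>k\<close>-current.\<close>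

definition boundary ::
    "nat \<Rightarrow> ('a::euclidean_space form \<Rightarrow> real) \<Rightarrow> ('a form \<Rightarrow> real)" where
  "boundary k T = (\<lambda>\<phi>. T (ext_deriv k \<phi>))"

text \<open>
  \<open>ennreal\<close> sends negative reals to \<open>0\<close>; this does not affect the suprema below, which also
  range over the zero form (resp. zero vector field).
\<close>

definition mass :: "nat \<Rightarrow> ('a::euclidean_space form \<Rightarrow> real) \<Rightarrow> ennreal" where
  "mass k T = (SUP \<phi>\<in>{\<phi> \<in> test_forms k. \<forall>x. comass k (\<phi> x) \<le> 1}. ennreal (T \<phi>))"

definition flat_norm :: "real \<Rightarrow> nat \<Rightarrow> ('a::euclidean_space form \<Rightarrow> real) \<Rightarrow> ennreal" where
  "flat_norm l k T =
     (INF S\<in>{S. current (Suc k) S}.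
        ennreal l * mass (Suc k) S + mass k (\<lambda>\<phi>. T \<phi> - boundary k S \<phi>))"

text \<open>\<open>S\<close> is admissible in \<open>flat_norm l k T\<close> and attains the infimum.\<close>

definition optimal_decomposition ::
    "real \<Rightarrow> nat \<Rightarrow> ('a::euclidean_space form \<Rightarrow> real) \<Rightarrow> ('a form \<Rightarrow> real) \<Rightarrow> bool" where
  "optimal_decomposition l k T S \<longleftrightarrow>
     current (Suc k) S \<and>
     flat_norm l k T =
       ennreal l * mass (Suc k) S + mass k (\<lambda>\<phi>. T \<phi> - boundary k S \<phi>)"

section \<open>Currents carried by sets\<close>

text \<open>
  The linear order of the index type \<open>'n\<close> fixes the enumeration \<open>e\<^sub>1, \<dots>, e\<^sub>m\<close> of the standard basis,
  hence the standard orientation. Entries from \<open>CARD('n)\<close> on are irrelevant.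
\<close>

definition std_frame :: "nat \<Rightarrow> real ^ 'n::{finite,linorder}" where
  "std_frame i = axis (sorted_list_of_set UNIV ! i) 1"

definition set_current ::
    "(real ^ 'n::{finite,linorder}) set \<Rightarrow> (real ^ 'n::{finite,linorder}) form \<Rightarrow> real" where
  "set_current E \<phi> = set_lebesgue_integral lebesgue E (\<lambda>x. \<phi> x std_frame)"

definition bdry_current ::
    "(real ^ 'n::{finite,linorder}) set \<Rightarrow> (real ^ 'n::{finite,linorder}) form \<Rightarrow> real" where
  "bdry_current \<Omega> = boundary (CARD('n) - 1) (set_current \<Omega>)"

definition symdiff_current ::
    "(real ^ 'n::{finite,linorder}) set \<Rightarrow> (real ^ 'n::{finite,linorder}) set \<Rightarrow> (real ^ 'n::{finite,linorder}) form \<Rightarrow> real" where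
  "symdiff_current \<Sigma> \<Omega> = (\<lambda>\<phi>. set_current \<Omega> \<phi> - set_current \<Sigma> \<phi>)"

section \<open>Perimeter and the functional\<close>

definition divergence :: "('a::euclidean_space \<Rightarrow> 'a) \<Rightarrow> 'a \<Rightarrow> real" where
  "divergence X x = (\<Sum>b\<in>Basis. frechet_derivative X (at x) b \<bullet> b)"

definition test_fields :: "('a::euclidean_space \<Rightarrow> 'a) set" where
  "test_fields = {X. smooth X \<and> (\<exists>K. compact K \<and> (\<forall>x. x \<notin> K \<longrightarrow> X x = 0))}"

definition grad_indicator :: "'a::euclidean_space set \<Rightarrow> ('a \<Rightarrow> 'a) \<Rightarrow> real" where
  "grad_indicator E X = - set_lebesgue_integral lebesgue E (divergence X)"

definition perimeter :: "'a::euclidean_space set \<Rightarrow> ennreal" where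
  "perimeter E = (SUP X\<in>{X \<in> test_fields. \<forall>x. norm (X x) \<le> 1}. ennreal (grad_indicator E X))"

definition F_CE :: "real \<Rightarrow> 'a::euclidean_space set \<Rightarrow> 'a set \<Rightarrow> ennreal" where
  "F_CE l \<Omega> \<Sigma> = perimeter \<Sigma> + ennreal l * emeasure lebesgue (sym_diff \<Sigma> \<Omega>)"

end

theory Submission
  imports Defs
begin

text \<open>
  Every measurable set \<open>\<Sigma>\<close> gives a competitor \<open>S = [\<Omega>] - [\<Sigma>]\<close> for the flat norm of \<open>\<partial>[\<Omega>]\<close>, with
  \<open>\<partial>[\<Omega>] - \<partial>S = \<partial>[\<Sigma>]\<close>. Its value is at most the energy \<open>F_CE l \<Omega> \<Sigma>\<close>: forms of top degree are functions, forms
  of codimension one are vector fields, the comass becomes the Euclidean norm and the exterior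
  derivative the divergence (\<open>comass_contract_vol\<close>, \<open>ext_deriv_eq_divergence\<close>), so the masses are bounded by
  the volume of the symmetric difference and by the perimeter (\<open>mass_symdiff_current_le\<close>,
  \<open>mass_boundary_set_current_le\<close>). The point is that no other current does better. If each competitor
  has value at least the energy of the minimizer \<open>\<Sigma>\<close>, then all these inequalities are equalities.

  Informally, a current \<open>S\<close> of finite value has the form \<open>[\<Omega>] - u\<close> with \<open>u\<close> a function of bounded
  variation. Its value is the total variation of \<open>u\<close> plus \<open>l\<close> times the \<open>L\<^sup>1\<close> distance from \<open>u\<close> to the indicator of
  \<open>\<Omega>\<close>. By the coarea formula this is at least the average over \<open>t \<in> [0,1]\<close> of the energies
  of the level sets \<open>{u > t}\<close>, hence at least the minimal energy.

  The proof below never constructs \<open>u\<close>. It works with the mollifications of \<open>[\<Omega>] - S\<close>, which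
  are smooth functions. The mollifier is chosen such that its translates over a grid add up to at most
  the reciprocal of the cell volume. Cutting the integrals of the mollified functional and of its
  gradient into sums over grids then bounds them by the masses of \<open>S\<close> and of \<open>\<partial>[\<Omega>] - \<partial>S\<close>
  (\<open>nn_integral_conv_mollifier_le\<close>, \<open>nn_integral_conv_grad_mollifier_le\<close>). For smooth functions,
  the required half of the coarea formula follows from integration by parts and Fatou's lemma
  (\<open>coarea_lower_bound\<close>). What remains is the error made by mollifying the indicator of \<open>\<Omega>\<close>. It tends
  to zero in \<open>L\<^sup>1\<close>, although \<open>\<Omega>\<close> and its complement may both have infinite measure, because \<open>\<Omega>\<close> has finite
  perimeter (\<open>emeasure_shift_diff_le\<close>). The pieces are put together in \<open>mollified_lower_bound\<close> and
  \<open>flat_norm_competitor_lower_bound\<close>.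
\<close>

section \<open>Smooth functions\<close>

text \<open>
  Smoothness quantifies over lists of directions, which is awkward for inductions: the derivative of a
  product or a composition is again such a term, but of one order less. Recursion on the order of
  differentiability makes each closure property a one-step induction.
\<close>

primrec times_differentiable ::
    "nat \<Rightarrow> ('a::euclidean_space \<Rightarrow> 'b::real_normed_vector) \<Rightarrow> bool" where
  "times_differentiable 0 f = True"
| "times_differentiable (Suc n) f \<longleftrightarrow> (\<forall>x. f differentiable (at x)) \<and>
     (\<forall>u. times_differentiable n (\<lambda>x. frechet_derivative f (at x) u))"

lemma iter_deriv_append:
  "iter_deriv (us @ [u]) f = iter_deriv us (\<lambda>x. frechet_derivative f (at x) u)"
  by (induction us) auto

lemma times_differentiable_iff:
  "times_differentiable n f \<longleftrightarrow>
    (\<forall>us x. length us < n \<longrightarrow> iter_deriv us f differentiable (at x))"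
proof (induction n arbitrary: f)
  case 0
  then show ?case by simp
next
  case (Suc n)
  have "(\<forall>us x. length us < Suc n \<longrightarrow> iter_deriv us f differentiable (at x)) \<longleftrightarrow>
    (\<forall>x. f differentiable (at x)) \<and>
    (\<forall>u us x. length us < n \<longrightarrow> iter_deriv (us @ [u]) f differentiable (at x))"
    (is "?L \<longleftrightarrow> ?R")
  proof
    assume ?L
    then show ?R by (metis Suc_less_eq iter_deriv.simps(1) length_append_singleton list.size(3) zero_less_Suc)
  next
    assume R: ?R
    show ?L
    proof (intro allI impI)
      fix us :: "'a list" and x
      assume "length us < Suc n"
      then show "iter_deriv us f differentiable (at x)"
        using R by (cases us rule: rev_cases) auto
    qed
  qed
  then show ?case
    using Suc by (simp add: iter_deriv_append del: iter_deriv.simps(2))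
qed

lemma smooth_iff_times_differentiable: "smooth f \<longleftrightarrow> (\<forall>n. times_differentiable n f)"
  unfolding smooth_def times_differentiable_iff by blast

lemma times_differentiable_SucD: "times_differentiable (Suc n) f \<Longrightarrow> times_differentiable n f"
  unfolding times_differentiable_iff by simp

lemma smooth_differentiable: "smooth f \<Longrightarrow> f differentiable (at x)"
  unfolding smooth_def by (metis iter_deriv.simps(1))

lemma smooth_has_derivative: "smooth f \<Longrightarrow> (f has_derivative frechet_derivative f (at x)) (at x)"
  by (simp add: smooth_differentiable frechet_derivative_works[THEN iffD1])

lemma smooth_frechet_derivative: "smooth f \<Longrightarrow> smooth (\<lambda>x. frechet_derivative f (at x) u)"
  unfolding smooth_def by (metis iter_deriv_append)

lemma smooth_continuous_on: "smooth f \<Longrightarrow> continuous_on S f"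
  by (meson continuous_at_imp_continuous_on differentiable_imp_continuous_within smooth_differentiable)

lemma times_differentiable_const: "times_differentiable n (\<lambda>x. c)"
  by (induction n arbitrary: c) (auto simp: frechet_derivative_const)

lemma times_differentiable_add:
  assumes "times_differentiable n f" "times_differentiable n g"
  shows "times_differentiable n (\<lambda>x. f x + g x)"
  using assms
proof (induction n arbitrary: f g)
  case (Suc n)
  then have d: "f differentiable (at x)" "g differentiable (at x)" for x by auto
  have D: "((\<lambda>x. f x + g x) has_derivative
      (\<lambda>u. frechet_derivative f (at x) u + frechet_derivative g (at x) u)) (at x)" for x
    using d by (intro has_derivative_add) (simp_all add: frechet_derivative_works)
  have "frechet_derivative (\<lambda>x. f x + g x) (at x) =
      (\<lambda>u. frechet_derivative f (at x) u + frechet_derivative g (at x) u)" for x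
    using frechet_derivative_at[OF D[of x]] by simp
  moreover have "times_differentiable n
      (\<lambda>x. frechet_derivative f (at x) u + frechet_derivative g (at x) u)" for u
    using Suc.prems by (intro Suc.IH) simp_all
  moreover have "(\<lambda>x. f x + g x) differentiable (at x)" for x
    using D differentiable_def by blast
  ultimately show ?case by simp
qed simp

text \<open>
  Multiplication, scalar multiplication and the composition with a linear map are all instances.
\<close>

lemma times_differentiable_bilinear:
  assumes "bounded_bilinear B" "times_differentiable n f" "times_differentiable n g"
  shows "times_differentiable n (\<lambda>x. B (f x) (g x))"
  using assms(2-)
proof (induction n arbitrary: f g)
  case (Suc n)
  then have d: "f differentiable (at x)" "g differentiable (at x)" for x by auto
  have D: "((\<lambda>x. B (f x) (g x)) has_derivative
      (\<lambda>u. B (f x) (frechet_derivative g (at x) u) + B (frechet_derivative f (at x) u) (g x))) (at x)" for x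
    by (rule bounded_bilinear.FDERIV[OF assms(1) frechet_derivative_works[THEN iffD1] frechet_derivative_works[THEN iffD1], OF d])
  have "frechet_derivative (\<lambda>x. B (f x) (g x)) (at x) =
      (\<lambda>u. B (f x) (frechet_derivative g (at x) u) + B (frechet_derivative f (at x) u) (g x))" for x
    using frechet_derivative_at[OF D[of x]] by simp
  moreover have "times_differentiable n
      (\<lambda>x. B (f x) (frechet_derivative g (at x) u) + B (frechet_derivative f (at x) u) (g x))" for u
    using Suc.prems times_differentiable_SucD[of n f] times_differentiable_SucD[of n g]
    by (intro times_differentiable_add Suc.IH) simp_all
  moreover have "(\<lambda>x. B (f x) (g x)) differentiable (at x)" for x
    using D differentiable_def by blast
  ultimately show ?case by simp
qed simp

lemma times_differentiable_compose_affine: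
  assumes "bounded_linear L" "times_differentiable n f"
  shows "times_differentiable n (\<lambda>x. f (a + L x))"
  using assms(2)
proof (induction n arbitrary: f)
  case (Suc n)
  have D: "((\<lambda>x. f (a + L x)) has_derivative (\<lambda>u. frechet_derivative f (at (a + L x)) (L u))) (at x)" for x
  proof -
    have "((\<lambda>x. a + L x) has_derivative L) (at x)"
      using bounded_linear_imp_has_derivative[OF assms(1), of "at x"] has_derivative_add[OF has_derivative_const, of L L "at x" a] by simp
    moreover have "(f has_derivative frechet_derivative f (at (a + L x))) (at (a + L x))"
      using Suc.prems by (simp add: frechet_derivative_works[THEN iffD1])
    ultimately show ?thesis by (rule has_derivative_compose)
  qed
  have "frechet_derivative (\<lambda>x. f (a + L x)) (at x) = (\<lambda>u. frechet_derivative f (at (a + L x)) (L u))" for x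
    using frechet_derivative_at[OF D[of x]] by simp
  moreover have "(\<lambda>x. f (a + L x)) differentiable (at x)" for x
    using D differentiable_def by blast
  moreover have "times_differentiable n (\<lambda>x. frechet_derivative f (at (a + L x)) (L u))" for u
    using Suc.prems Suc.IH[of "\<lambda>y. frechet_derivative f (at y) (L u)"] by simp
  ultimately show ?case by simp
qed simp

lemma smooth_const [simp]: "smooth (\<lambda>x. c)"
  by (simp add: smooth_iff_times_differentiable times_differentiable_const)

lemma smooth_add: "smooth f \<Longrightarrow> smooth g \<Longrightarrow> smooth (\<lambda>x. f x + g x)"
  by (simp add: smooth_iff_times_differentiable times_differentiable_add)

lemma smooth_bilinear:
  "bounded_bilinear B \<Longrightarrow> smooth f \<Longrightarrow> smooth g \<Longrightarrow> smooth (\<lambda>x. B (f x) (g x))"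
  by (simp add: smooth_iff_times_differentiable times_differentiable_bilinear)

lemmas smooth_mult = smooth_bilinear[OF bounded_bilinear_mult]
lemmas smooth_scaleR = smooth_bilinear[OF bounded_bilinear_scaleR]

lemma smooth_linear_compose:
  fixes L :: "'b::euclidean_space \<Rightarrow> 'c::real_normed_vector"
  assumes "linear L" "smooth f"
  shows "smooth (\<lambda>x. L (f x))"
proof -
  interpret L: bounded_linear L using assms(1) by (simp add: linear_conv_bounded_linear)
  have "bounded_bilinear (\<lambda>r y. r *\<^sub>R L y :: 'c)"
    by (rule bounded_bilinear.comp[OF bounded_bilinear_scaleR bounded_linear_ident L.bounded_linear_axioms])
  from smooth_bilinear[OF this smooth_const[of 1] assms(2)] show ?thesis by simp
qed

lemma smooth_compose_affine:
  "bounded_linear L \<Longrightarrow> smooth f \<Longrightarrow> smooth (\<lambda>x. f (a + L x))"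
  by (simp add: smooth_iff_times_differentiable times_differentiable_compose_affine)

lemma smooth_prod:
  fixes f :: "'i \<Rightarrow> 'a::euclidean_space \<Rightarrow> real"
  shows "(\<And>i. i \<in> I \<Longrightarrow> smooth (f i)) \<Longrightarrow> smooth (\<lambda>x. \<Prod>i\<in>I. f i x)"
  by (induction I rule: infinite_finite_induct) (auto intro: smooth_mult)

lemma smooth_minus: "smooth f \<Longrightarrow> smooth (\<lambda>x. - f x)"
  using smooth_scaleR[OF smooth_const[of "-1"]] by auto

lemma smooth_diff: "smooth f \<Longrightarrow> smooth g \<Longrightarrow> smooth (\<lambda>x. f x - g x)"
  using smooth_add[OF _ smooth_minus] by auto

text \<open>
  The derivative of \<open>1/f\<close> is \<open>- (1/f)\<^sup>2 Df\<close>, so one order of differentiability of \<open>1/f\<close> yields the next.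
\<close>

lemma smooth_inverse:
  fixes f :: "'a::euclidean_space \<Rightarrow> real"
  assumes "smooth f" "\<And>x. f x \<noteq> 0"
  shows "smooth (\<lambda>x. inverse (f x))"
proof -
  have "times_differentiable n (\<lambda>x. inverse (f x))" for n
  proof (induction n)
    case (Suc n)
    have D: "((\<lambda>x. inverse (f x)) has_derivative
        (\<lambda>u. - (inverse (f x) * frechet_derivative f (at x) u * inverse (f x)))) (at x)" for x
      by (rule Deriv.has_derivative_inverse[OF assms(2) smooth_has_derivative[OF assms(1)]])
    have "frechet_derivative (\<lambda>x. inverse (f x)) (at x) =
        (\<lambda>u. -1 * (inverse (f x) * (inverse (f x) * frechet_derivative f (at x) u)))" for x
      using frechet_derivative_at[OF D[of x]] by (simp add: mult_ac)
    moreover have "times_differentiable n (\<lambda>x. frechet_derivative f (at x) u)" for u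
      using smooth_frechet_derivative[OF assms(1)] by (simp add: smooth_iff_times_differentiable)
    then have "times_differentiable n
        (\<lambda>x. -1 * (inverse (f x) * (inverse (f x) * frechet_derivative f (at x) u)))" for u
      by (intro times_differentiable_bilinear[OF bounded_bilinear_mult] times_differentiable_const Suc.IH)
    moreover have "(\<lambda>x. inverse (f x)) differentiable (at x)" for x
      using D differentiable_def by blast
    ultimately show ?case by simp
  qed simp
  then show ?thesis by (simp add: smooth_iff_times_differentiable)
qed

section \<open>A smooth step\<close>

text \<open>
  The exponents \<open>k\<close> make the family closed under differentiation up to linear combinations, so that
  all members are smooth as soon as all are differentiable.
\<close>

definition flat_exp :: "nat \<Rightarrow> real \<Rightarrow> real" where
  "flat_exp k t = (if t > 0 then exp (- (1 / t)) / t ^ k else 0)"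

lemma flat_exp_tendsto_0: "(flat_exp k \<longlongrightarrow> 0) (at 0)"
proof -
  have "((\<lambda>s::real. s ^ k / exp s) \<longlongrightarrow> 0) at_top" by (rule tendsto_power_div_exp_0)
  then have "((\<lambda>t::real. inverse t ^ k / exp (inverse t)) \<longlongrightarrow> 0) (at_right 0)"
    by (rule filterlim_compose[OF _ filterlim_inverse_at_top_right])
  then have R: "(flat_exp k \<longlongrightarrow> 0) (at_right 0)"
    by (rule Lim_transform_eventually)
       (auto simp: eventually_at_filter flat_exp_def exp_minus field_simps power_inverse)
  have L: "(flat_exp k \<longlongrightarrow> 0) (at_left 0)"
    by (rule Lim_transform_eventually[OF tendsto_const])
       (auto simp: eventually_at_filter flat_exp_def)
  from L R show ?thesis by (simp add: filterlim_at_split)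
qed

lemma flat_exp_has_real_derivative:
  "(flat_exp k has_real_derivative (flat_exp (k + 2) t - real k * flat_exp (k + 1) t)) (at t)"
proof -
  consider "t > 0" | "t = 0" | "t < 0" by linarith
  then show ?thesis
  proof cases
    case 1
    have "((\<lambda>t. exp (- (1 / t)) / t ^ k) has_real_derivative
        (flat_exp (k + 2) t - real k * flat_exp (k + 1) t)) (at t)"
      using 1
      by (auto intro!: derivative_eq_intros simp: flat_exp_def field_simps power2_eq_square)
        (cases k; simp add: field_simps)+
    then show ?thesis
      by (rule has_field_derivative_transform_within[where d=t])
        (use 1 in \<open>auto simp: dist_real_def flat_exp_def\<close>)
  next
    case 2
    have "((\<lambda>h. (flat_exp k (0 + h) - flat_exp k 0) / h) \<longlongrightarrow> 0) (at 0)"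
    proof (rule Lim_transform_eventually[OF flat_exp_tendsto_0[of "k+1"]])
      show "\<forall>\<^sub>F x in at 0. flat_exp (k + 1) x = (flat_exp k (0 + x) - flat_exp k 0) / x"
        by (auto simp: eventually_at_filter flat_exp_def)
    qed
    then show ?thesis using 2 by (simp add: DERIV_def flat_exp_def)
  next
    case 3
    have "((\<lambda>t. 0) has_real_derivative 0) (at t)" by simp
    then have "(flat_exp k has_real_derivative 0) (at t)"
      by (rule has_field_derivative_transform_within[where d="-t"])
        (use 3 in \<open>auto simp: dist_real_def flat_exp_def\<close>)
    then show ?thesis using 3 by (simp add: flat_exp_def)
  qed
qed

lemma smooth_flat_exp: "smooth (flat_exp k)"
proof -
  have "times_differentiable n (flat_exp k)" for n
  proof (induction n arbitrary: k)
    case (Suc n)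
    have D: "(flat_exp k has_derivative (\<lambda>u. u * flat_exp (k + 2) t + u * (- real k * flat_exp (k + 1) t))) (at t)" for t
      using flat_exp_has_real_derivative[of k t] unfolding has_field_derivative_def
      by (rule has_derivative_eq_rhs) (auto simp: algebra_simps)
    have "frechet_derivative (flat_exp k) (at t) = (\<lambda>u. u * flat_exp (k + 2) t + u * (- real k * flat_exp (k + 1) t))" for t
      using frechet_derivative_at[OF D[of t]] by simp
    moreover have "times_differentiable n (\<lambda>t. u * flat_exp (k + 2) t + u * (- real k * flat_exp (k + 1) t))" for u
      by (intro times_differentiable_add times_differentiable_bilinear[OF bounded_bilinear_mult] 
          times_differentiable_const Suc.IH)
    moreover have "flat_exp k differentiable (at t)" for t using D by (auto simp: differentiable_def)
    ultimately show ?case by simp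
  qed simp
  then show ?thesis by (simp add: smooth_iff_times_differentiable)
qed

text \<open>
  One function serves twice: its differences are the profile of the mollifier, and its rescalings
  approximate the indicator of a half-line in the coarea inequality.
\<close>

definition smooth_step :: "real \<Rightarrow> real" where
  "smooth_step t = flat_exp 0 t / (flat_exp 0 t + flat_exp 0 (1 - t))"

lemma flat_exp_0_mono: "s \<le> t \<Longrightarrow> flat_exp 0 s \<le> flat_exp 0 t"
  by (auto simp: flat_exp_def field_simps)

lemma flat_exp_nonneg: "flat_exp 0 s \<ge> 0"
  by (auto simp: flat_exp_def)

lemma flat_exp_sum_pos: "flat_exp 0 t + flat_exp 0 (1 - t) > 0"
  by (cases "t > 0") (auto simp: flat_exp_def add_pos_nonneg)

lemma smooth_smooth_step: "smooth smooth_step"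
proof -
  have "smooth (\<lambda>t. flat_exp 0 (1 + - t))"
    by (rule smooth_compose_affine[OF _ smooth_flat_exp]) (simp add: bounded_linear_minus bounded_linear_ident)
  then have "smooth (\<lambda>t. flat_exp 0 t * inverse (flat_exp 0 t + flat_exp 0 (1 - t)))"
    using flat_exp_sum_pos
    by (intro smooth_mult smooth_inverse smooth_add smooth_flat_exp) (auto simp: less_imp_neq less_le)
  then show ?thesis unfolding smooth_step_def divide_inverse .
qed

lemma smooth_step_eq_0: "t \<le> 0 \<Longrightarrow> smooth_step t = 0"
  by (simp add: smooth_step_def flat_exp_def)

lemma smooth_step_eq_1: "t \<ge> 1 \<Longrightarrow> smooth_step t = 1"
  by (simp add: smooth_step_def flat_exp_def)

lemma smooth_step_mono: "s \<le> t \<Longrightarrow> smooth_step s \<le> smooth_step t"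
proof -
  assume st: "s \<le> t"
  have a: "flat_exp 0 s \<le> flat_exp 0 t" "flat_exp 0 (1 - t) \<le> flat_exp 0 (1 - s)"
    using st by (auto intro: flat_exp_0_mono)
  have "flat_exp 0 s * flat_exp 0 (1 - t) \<le> flat_exp 0 t * flat_exp 0 (1 - s)"
    by (intro mult_mono a flat_exp_nonneg)
  then show ?thesis
    unfolding smooth_step_def using flat_exp_sum_pos[of s] flat_exp_sum_pos[of t]
    by (simp add: divide_simps) (simp add: algebra_simps)
qed

lemma smooth_step_bounds: "0 \<le> smooth_step t" "smooth_step t \<le> 1"
  using smooth_step_mono[of "min t 0" t] smooth_step_mono[of t "max t 1"]
  by (simp_all add: smooth_step_eq_0 smooth_step_eq_1)

lemma smooth_step_real_derivative:
  "(smooth_step has_real_derivative deriv smooth_step t) (at t)"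
  using smooth_differentiable[OF smooth_smooth_step]
  by (metis DERIV_deriv_iff_real_differentiable)

lemma smooth_step_deriv_nonneg: "deriv smooth_step t \<ge> 0"
  using mono_on_imp_deriv_nonneg[of UNIV smooth_step "deriv smooth_step t" t]
    smooth_step_real_derivative smooth_step_mono by (auto intro: mono_onI)

lemma continuous_deriv_smooth_step: "continuous_on S (deriv smooth_step)"
proof -
  have "deriv smooth_step t = frechet_derivative smooth_step (at t) 1" for t
    using smooth_step_real_derivative[of t]
    by (metis frechet_derivative_at has_field_derivative_def mult.right_neutral)
  then show ?thesis
    using smooth_continuous_on[OF smooth_frechet_derivative[OF smooth_smooth_step]] by (metis (no_types, lifting) continuous_on_cong)
qed

section \<open>Test functions and integration by parts\<close>

definition test_function :: "('a::euclidean_space \<Rightarrow> 'b::real_normed_vector) \<Rightarrow> bool" where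
  "test_function f \<longleftrightarrow> smooth f \<and> (\<exists>K. compact K \<and> (\<forall>x. x \<notin> K \<longrightarrow> f x = 0))"

lemma test_fields_eq: "test_fields = Collect test_function"
  by (auto simp: test_fields_def test_function_def)

lemma integrable_continuous_compact_support:
  fixes f :: "'a::euclidean_space \<Rightarrow> 'b::{banach, second_countable_topology}"
  assumes "continuous_on UNIV f" "compact K" "\<And>x. x \<notin> K \<Longrightarrow> f x = 0"
  shows "integrable lborel f"
proof -
  have "integrable lborel (\<lambda>x. indicator K x *\<^sub>R f x)"
    using assms by (intro borel_integrable_compact) (auto intro: continuous_on_subset)
  moreover have "(\<lambda>x. indicator K x *\<^sub>R f x) = f"
    using assms(3) by (auto simp: indicator_def fun_eq_iff)
  ultimately show ?thesis by simp
qed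

lemma bounded_continuous_compact_support:
  fixes f :: "'a::euclidean_space \<Rightarrow> 'b::real_normed_vector"
  assumes "continuous_on UNIV f" "compact K" "\<And>x. x \<notin> K \<Longrightarrow> f x = 0"
  obtains C where "C > 0" "\<And>x. norm (f x) \<le> C"
proof -
  have "bounded (f ` K)"
    using assms by (meson compact_continuous_image compact_imp_bounded continuous_on_subset subset_UNIV)
  then obtain C where C: "C > 0" "\<forall>x\<in>K. norm (f x) \<le> C" unfolding bounded_pos by auto
  show thesis
  proof (rule that[of C])
    show "norm (f x) \<le> C" for x using C assms(3)[of x] by (cases "x \<in> K") auto
  qed (rule C)
qed

lemma integral_lborel_translation:
  fixes f :: "'a::euclidean_space \<Rightarrow> 'b::{banach, second_countable_topology}"
  assumes "f \<in> borel_measurable borel"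
  shows "integral\<^sup>L lborel (\<lambda>x. f (a + x)) = integral\<^sup>L lborel f"
proof -
  have "integral\<^sup>L (distr lborel borel ((+) a)) f = integral\<^sup>L lborel (\<lambda>x. f (a + x))"
    using assms by (intro integral_distr) auto
  then show ?thesis by (simp add: lborel_distr_plus)
qed

lemma nn_integral_lborel_translation:
  fixes f :: "'a::euclidean_space \<Rightarrow> ennreal"
  assumes "f \<in> borel_measurable borel"
  shows "(\<integral>\<^sup>+x. f (a + x) \<partial>lborel) = (\<integral>\<^sup>+x. f x \<partial>lborel)"
proof -
  have "nn_integral (distr lborel borel ((+) a)) f = (\<integral>\<^sup>+x. f (a + x) \<partial>lborel)"
    using assms by (intro nn_integral_distr) auto
  then show ?thesis by (simp add: lborel_distr_plus)
qed

text \<open>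
  The difference quotients of \<open>f\<close> have integral zero because Lebesgue measure is translation invariant;
  they are uniformly bounded with common compact support, so this passes to the limit.
\<close>

lemma integral_directional_derivative_eq_0:
  fixes f :: "'a::euclidean_space \<Rightarrow> real"
  assumes D: "\<And>x. (f has_derivative f' x) (at x)"
    and cont: "continuous_on UNIV (\<lambda>x. f' x b)"
    and K: "compact K" and supp: "\<And>x. x \<notin> K \<Longrightarrow> f x = 0"
  shows "integral\<^sup>L lborel (\<lambda>x. f' x b) = 0"
proof -
  have contf: "continuous_on UNIV f"
    using D by (meson continuous_at_imp_continuous_on has_derivative_continuous)
  have intf: "integrable lborel f"
    by (rule integrable_continuous_compact_support[OF contf K supp])
  have f'0: "f' x b = 0" if "x \<notin> K" for x
  proof -
    have "open (- K)" using K by (simp add: compact_imp_closed open_Compl)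
    then have "((\<lambda>x. 0) has_derivative f' x) (at x)"
      using has_derivative_transform_within_open[OF D[of x], of "- K" "\<lambda>x. 0"] that supp by auto
    then have "f' x = (\<lambda>h. 0)"
      using has_derivative_unique has_derivative_const by blast
    then show ?thesis by simp
  qed
  obtain C where C: "C > 0" "\<And>x. norm (f' x b) \<le> C"
    using bounded_continuous_compact_support[OF cont K f'0] by blast
  define K' where "K' = (\<lambda>(x, t). x - t *\<^sub>R b) ` (K \<times> {0..1::real})"
  have K': "compact K'"
    unfolding K'_def by (intro compact_continuous_image compact_Times K compact_Icc)
      (auto intro!: continuous_intros simp: case_prod_beta)
  have K'I: "x \<in> K'" if "x + t *\<^sub>R b \<in> K" "0 \<le> t" "t \<le> 1" for x t
    unfolding K'_def using that by (intro image_eqI[of _ _ "(x + t *\<^sub>R b, t)"]) auto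
  \<comment> \<open>The difference quotients live on the segments that end in \<open>K\<close>, all contained in \<open>K'\<close>.\<close>
  define F where "F = (\<lambda>k x. real (Suc k) * (f ((1 / real (Suc k)) *\<^sub>R b + x) - f x))"
  have line: "((\<lambda>t. f (x + t *\<^sub>R b)) has_real_derivative f' (x + t *\<^sub>R b) b) (at t)" for x t
  proof -
    have "((\<lambda>t. x + t *\<^sub>R b) has_derivative (\<lambda>s. s *\<^sub>R b)) (at t)"
      by (auto intro!: derivative_eq_intros)
    then have "((\<lambda>t. f (x + t *\<^sub>R b)) has_derivative (\<lambda>s. f' (x + t *\<^sub>R b) (s *\<^sub>R b))) (at t)"
      by (rule has_derivative_compose[OF _ D])
    moreover have "linear (f' (x + t *\<^sub>R b))" using D has_derivative_linear by blast
    ultimately show ?thesis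
      unfolding has_field_derivative_def
      by (auto simp: linear_cmul mult.commute elim!: has_derivative_eq_rhs)
  qed
  have int0: "integral\<^sup>L lborel (F k) = 0" for k
  proof -
    have "integrable lborel (\<lambda>x. f ((1 / real (Suc k)) *\<^sub>R b + x))"
    proof (rule integrable_continuous_compact_support[OF _ K'])
      show "continuous_on UNIV (\<lambda>x. f ((1 / real (Suc k)) *\<^sub>R b + x))"
        by (rule continuous_on_compose2[OF contf]) (auto intro!: continuous_intros)
      show "f ((1 / real (Suc k)) *\<^sub>R b + x) = 0" if "x \<notin> K'" for x
        using K'I[of x "1 / real (Suc k)"] that by (intro supp) (auto simp: add.commute)
    qed
    moreover have "integral\<^sup>L lborel (\<lambda>x. f ((1 / real (Suc k)) *\<^sub>R b + x)) = integral\<^sup>L lborel f"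
      using intf by (intro integral_lborel_translation) (simp add: integrable_iff_bounded)
    ultimately show ?thesis unfolding F_def using intf by simp
  qed
  have "(\<lambda>k. integral\<^sup>L lborel (F k)) \<longlonglongrightarrow> integral\<^sup>L lborel (\<lambda>x. f' x b)"
  proof (rule integral_dominated_convergence)
    show "(\<lambda>x. f' x b) \<in> borel_measurable lborel"
      using cont by (simp add: borel_measurable_continuous_onI)
    have "continuous_on UNIV (F k)" for k unfolding F_def
      by (intro continuous_intros continuous_on_compose2[OF contf]) auto
    then show "F k \<in> borel_measurable lborel" for k by (simp add: borel_measurable_continuous_onI)
    show "integrable lborel (\<lambda>x. C * indicator K' x)"
      using K' emeasure_bounded_finite[OF compact_imp_bounded[OF K']]
      by (intro integrable_mult_right integrable_real_indicator) (auto simp: compact_imp_closed)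
    show "AE x in lborel. (\<lambda>k. F k x) \<longlonglongrightarrow> f' x b"
    proof (rule AE_I2)
      fix x
      have "((\<lambda>h. (f (x + h *\<^sub>R b) - f x) / h) \<longlongrightarrow> f' x b) (at 0)"
        using line[of x 0] by (simp add: DERIV_def)
      moreover have "filterlim (\<lambda>k. 1 / real (Suc k)) (at 0) sequentially"
        using LIMSEQ_Suc[OF lim_1_over_n] by (auto simp: filterlim_at)
      ultimately have "(\<lambda>k. (f (x + (1 / real (Suc k)) *\<^sub>R b) - f x) / (1 / real (Suc k))) \<longlonglongrightarrow> f' x b"
        by (rule filterlim_compose)
      then show "(\<lambda>k. F k x) \<longlonglongrightarrow> f' x b"
        by (simp add: F_def add.commute mult.commute del: of_nat_Suc)
    qed
    show "AE x in lborel. norm (F k x) \<le> C * indicator K' x" for k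
    proof (rule AE_I2)
      fix x
      let ?h = "1 / real (Suc k)"
      show "norm (F k x) \<le> C * indicator K' x"
      proof (cases "x \<in> K'")
        case True
        obtain z where z: "0 < z" "z < ?h" "f (x + ?h *\<^sub>R b) - f (x + 0 *\<^sub>R b) = (?h - 0) * f' (x + z *\<^sub>R b) b"
          using MVT2[of 0 ?h "\<lambda>t. f (x + t *\<^sub>R b)" "\<lambda>t. f' (x + t *\<^sub>R b) b"] line by auto
        then have "F k x = f' (x + z *\<^sub>R b) b"
          unfolding F_def by (simp add: add.commute del: of_nat_Suc)
        then show ?thesis using C True by simp
      next
        case False
        then have "f (x + t *\<^sub>R b) = 0" if "0 \<le> t" "t \<le> 1" for t
          using K'I that supp by blast
        from this[of 0] this[of ?h] show ?thesis using False by (simp add: F_def add.commute del: of_nat_Suc)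
      qed
    qed
  qed
  then show ?thesis using int0 LIMSEQ_unique[OF _ tendsto_const] by (simp add: int0 LIMSEQ_const_iff)
qed

lemma divergence_continuous:
  assumes "smooth X"
  shows "continuous_on S (divergence X)"
  unfolding divergence_def
  by (intro continuous_intros smooth_continuous_on smooth_frechet_derivative assms)

lemma frechet_derivative_zero_outside:
  assumes "\<And>x. x \<notin> K \<Longrightarrow> f x = 0" "closed K" "x \<notin> K"
  shows "frechet_derivative f (at x) = (\<lambda>u. 0)"
proof -
  have "((\<lambda>x. 0) has_derivative (\<lambda>u. 0)) (at x)" by simp
  then have "(f has_derivative (\<lambda>u. 0)) (at x)"
    by (rule has_derivative_transform_within_open[where s="- K"]) (use assms in auto)
  then show ?thesis using frechet_derivative_at by metis
qed

lemma divergence_zero_outside: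
  assumes "\<And>x. x \<notin> K \<Longrightarrow> X x = 0" "closed K" "x \<notin> K"
  shows "divergence X x = 0"
  by (simp add: divergence_def frechet_derivative_zero_outside[OF assms])

lemma integral_mult_divergence:
  fixes X :: "'a::euclidean_space \<Rightarrow> 'a" and v :: "'a \<Rightarrow> real"
  assumes X: "test_function X"
    and D: "\<And>x. (v has_derivative (\<lambda>h. g x \<bullet> h)) (at x)" and cont: "continuous_on UNIV g"
  shows "(LINT x|lborel. v x * divergence X x) = - (LINT x|lborel. g x \<bullet> X x)"
proof -
  obtain K where K: "compact K" "\<And>x. x \<notin> K \<Longrightarrow> X x = 0" and sm: "smooth X"
    using X by (auto simp: test_function_def)
  have contX: "continuous_on UNIV X" using sm by (rule smooth_continuous_on)
  have contv: "continuous_on UNIV v"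
    using D by (meson continuous_at_imp_continuous_on has_derivative_continuous)
  have contDX: "continuous_on UNIV (\<lambda>x. frechet_derivative X (at x) b)" for b
    by (intro smooth_continuous_on smooth_frechet_derivative sm)
  have i1: "integrable lborel (\<lambda>x. (g x \<bullet> b) * (X x \<bullet> b))" for b
    by (rule integrable_continuous_compact_support[OF _ K(1)])
       (auto intro!: continuous_intros cont contX simp: K)
  have i2: "integrable lborel (\<lambda>x. v x * (frechet_derivative X (at x) b \<bullet> b))" for b
    by (rule integrable_continuous_compact_support[OF _ K(1)])
       (auto intro!: continuous_intros contv contDX simp: frechet_derivative_zero_outside[OF K(2) compact_imp_closed[OF K(1)]])
  have *: "(LINT x|lborel. (g x \<bullet> b) * (X x \<bullet> b) + v x * (frechet_derivative X (at x) b \<bullet> b)) = 0" for b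
  proof (rule integral_directional_derivative_eq_0[where f="\<lambda>x. v x * (X x \<bullet> b)" and
        f'="\<lambda>x h. (g x \<bullet> h) * (X x \<bullet> b) + v x * (frechet_derivative X (at x) h \<bullet> b)", OF _ _ K(1)])
    show "((\<lambda>x. v x * (X x \<bullet> b)) has_derivative (\<lambda>h. (g x \<bullet> h) * (X x \<bullet> b) + v x * (frechet_derivative X (at x) h \<bullet> b))) (at x)" for x
      by (rule has_derivative_eq_rhs, rule has_derivative_mult[OF D has_derivative_inner_left[OF smooth_has_derivative[OF sm]]])
        (auto simp: algebra_simps)
    show "continuous_on UNIV (\<lambda>x. (g x \<bullet> b) * (X x \<bullet> b) + v x * (frechet_derivative X (at x) b \<bullet> b))"
      by (intro continuous_intros cont contX contv contDX)
  qed (simp add: K)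
  have i3: "integrable lborel (\<lambda>x. g x \<bullet> X x)"
    by (rule integrable_continuous_compact_support[OF _ K(1)])
       (auto intro!: continuous_intros cont contX simp: K)
  have i4: "integrable lborel (\<lambda>x. v x * divergence X x)"
    by (rule integrable_continuous_compact_support[OF _ K(1)])
       (auto intro!: continuous_intros contv divergence_continuous sm
         simp: divergence_zero_outside[OF K(2) compact_imp_closed[OF K(1)]])
  have "(LINT x|lborel. g x \<bullet> X x) + (LINT x|lborel. v x * divergence X x)
    = (LINT x|lborel. g x \<bullet> X x + v x * divergence X x)"
    using i3 i4 by simp
  also have "\<dots> = (LINT x|lborel. (\<Sum>b\<in>Basis. (g x \<bullet> b) * (X x \<bullet> b) + v x * (frechet_derivative X (at x) b \<bullet> b)))"
    unfolding divergence_def sum_distrib_left sum.distrib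
    by (subst euclidean_inner) (rule refl)
  also have "\<dots> = (\<Sum>b\<in>Basis. (LINT x|lborel. (g x \<bullet> b) * (X x \<bullet> b) + v x * (frechet_derivative X (at x) b \<bullet> b)))"
    by (rule Bochner_Integration.integral_sum) (intro Bochner_Integration.integrable_add i1 i2)
  finally show ?thesis using * by simp
qed

lemma set_integral_lebesgue_eq:
  fixes f :: "'a::euclidean_space \<Rightarrow> real"
  assumes "E \<in> sets borel" "f \<in> borel_measurable borel"
  shows "set_lebesgue_integral lebesgue E f = (LINT x|lborel. indicator E x * f x)"
  unfolding set_lebesgue_integral_def using assms by (simp add: integral_completion)

lemma ennreal_integral_le_nn_integral:
  assumes "integrable M f" "\<And>x. x \<in> space M \<Longrightarrow> \<bar>f x\<bar> \<le> h x"
  shows "ennreal (integral\<^sup>L M f) \<le> (\<integral>\<^sup>+x. ennreal (h x) \<partial>M)"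
proof -
  have "ennreal (integral\<^sup>L M f) \<le> ennreal (integral\<^sup>L M (\<lambda>x. \<bar>f x\<bar>))"
    using assms(1) by (intro ennreal_leI integral_mono) auto
  also have "\<dots> = (\<integral>\<^sup>+x. ennreal \<bar>f x\<bar> \<partial>M)"
    using assms(1) by (intro nn_integral_eq_integral[symmetric]) auto
  also have "\<dots> \<le> (\<integral>\<^sup>+x. ennreal (h x) \<partial>M)"
    using assms(2) by (intro nn_integral_mono ennreal_leI)
  finally show ?thesis .
qed

lemma smooth_step_scaled_tendsto:
  "(\<lambda>k. smooth_step (real (Suc k) * s)) \<longlonglongrightarrow> (if s > 0 then 1 else 0)"
proof (cases "s > 0")
  case True
  then obtain n where n: "1 < real n * s" using reals_Archimedean3 by blast
  have "\<forall>\<^sub>F k in sequentially. smooth_step (real (Suc k) * s) = 1"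
    using eventually_ge_at_top[of n]
  proof eventually_elim
    case (elim k)
    then have "real n * s \<le> real (Suc k) * s" using True by (intro mult_right_mono) auto
    then show ?case using n by (intro smooth_step_eq_1) linarith
  qed
  then show ?thesis using True by (simp add: tendsto_eventually)
next
  case False
  then have "smooth_step (real (Suc k) * s) = 0" for k
    by (intro smooth_step_eq_0 mult_nonneg_nonpos) auto
  then show ?thesis using False by simp
qed

section \<open>The coarea inequality\<close>

text \<open>
  Composing \<open>u\<close> with a step of width \<open>1/(k+1)\<close> at height \<open>t\<close> gives functions that converge pointwise to
  the indicator of \<open>{u > t}\<close>; integrating by parts moves the divergence onto their gradients.
\<close>

lemma perimeter_superlevel_le:
  fixes u :: "'a::euclidean_space \<Rightarrow> real"
  assumes D: "\<And>x. (u has_derivative (\<lambda>h. g x \<bullet> h)) (at x)" and cont: "continuous_on UNIV g"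
  shows "perimeter {x. t < u x} \<le> liminf (\<lambda>k.
    \<integral>\<^sup>+x. ennreal (real (Suc k) * deriv smooth_step (real (Suc k) * (u x - t)) * norm (g x)) \<partial>lborel)"
  (is "_ \<le> liminf ?I")
  unfolding perimeter_def
proof (rule SUP_least)
  fix X :: "'a \<Rightarrow> 'a" assume "X \<in> {X \<in> test_fields. \<forall>x. norm (X x) \<le> 1}"
  then have X: "X \<in> test_fields" and X1: "\<forall>x. norm (X x) \<le> 1" by auto
  have contu: "continuous_on UNIV u"
    using D by (meson continuous_at_imp_continuous_on has_derivative_continuous)
  have tX: "test_function X" using X by (simp add: test_fields_eq)
  then obtain K where K: "compact K" "\<And>x. x \<notin> K \<Longrightarrow> X x = 0" and sm: "smooth X"
    by (auto simp: test_function_def)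
  have contX: "continuous_on UNIV X" using sm by (rule smooth_continuous_on)
  note contdiv = divergence_continuous[OF sm, of UNIV]
  have meas[measurable]: "divergence X \<in> borel_measurable borel" "u \<in> borel_measurable borel"
    using contdiv contu by (auto simp: borel_measurable_continuous_onI)
  define v where "v = (\<lambda>k x. smooth_step (real (Suc k) * (u x - t)))"
  define g' where "g' = (\<lambda>k x. (real (Suc k) * deriv smooth_step (real (Suc k) * (u x - t))) *\<^sub>R g x)"
  have Dv: "(v k has_derivative (\<lambda>h. g' k x \<bullet> h)) (at x)" for k x
  proof -
    have "((\<lambda>x. real (Suc k) * (u x - t)) has_derivative (\<lambda>h. real (Suc k) * (g x \<bullet> h))) (at x)"
      by (auto intro!: derivative_eq_intros D)
    from has_derivative_compose[OF this smooth_step_real_derivative[unfolded has_field_derivative_def]]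
    show ?thesis unfolding v_def g'_def by (rule has_derivative_eq_rhs) (auto simp: algebra_simps)
  qed
  have contg': "continuous_on UNIV (g' k)" for k
    unfolding g'_def
    by (intro continuous_intros cont continuous_on_compose2[OF continuous_deriv_smooth_step[of UNIV]] contu) auto
  have contv: "continuous_on UNIV (v k)" for k
    using Dv by (meson continuous_at_imp_continuous_on has_derivative_continuous)
  have le: "ennreal (- (LINT x|lborel. v k x * divergence X x)) \<le> ?I k" for k
  proof -
    have "- (LINT x|lborel. v k x * divergence X x) = (LINT x|lborel. g' k x \<bullet> X x)"
      using integral_mult_divergence[OF tX Dv contg'] by simp
    moreover have "ennreal (LINT x|lborel. g' k x \<bullet> X x) \<le> ?I k"
    proof (rule ennreal_integral_le_nn_integral)
      show "integrable lborel (\<lambda>x. g' k x \<bullet> X x)"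
        by (rule integrable_continuous_compact_support[OF _ K(1)])
           (auto intro!: continuous_intros contg' contX simp: K)
      fix x
      have "\<bar>g' k x \<bullet> X x\<bar> \<le> norm (g' k x) * norm (X x)" by (rule Cauchy_Schwarz_ineq2)
      also have "\<dots> \<le> norm (g' k x) * 1" using X1 by (intro mult_left_mono) auto
      also have "\<dots> = real (Suc k) * deriv smooth_step (real (Suc k) * (u x - t)) * norm (g x)"
        using smooth_step_deriv_nonneg unfolding g'_def by (simp add: abs_mult)
      finally show "\<bar>g' k x \<bullet> X x\<bar> \<le> real (Suc k) * deriv smooth_step (real (Suc k) * (u x - t)) * norm (g x)" .
    qed
    ultimately show ?thesis by simp
  qed
  have intdiv: "integrable lborel (divergence X)"
    by (rule integrable_continuous_compact_support[OF contdiv K(1)])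
       (simp add: divergence_zero_outside[OF K(2)] compact_imp_closed K(1))
  have "(\<lambda>k. LINT x|lborel. v k x * divergence X x) \<longlonglongrightarrow>
      (LINT x|lborel. indicator {x. t < u x} x * divergence X x)"
  proof (rule integral_dominated_convergence[OF _ _ integrable_abs[OF intdiv]])
    show "AE x in lborel. (\<lambda>k. v k x * divergence X x) \<longlonglongrightarrow> indicator {x. t < u x} x * divergence X x"
    proof (rule AE_I2)
      fix x
      have "(\<lambda>k. v k x) \<longlonglongrightarrow> indicator {x. t < u x} x"
        using smooth_step_scaled_tendsto[of "u x - t"] by (auto simp: v_def indicator_def split: if_splits)
      then show "(\<lambda>k. v k x * divergence X x) \<longlonglongrightarrow> indicator {x. t < u x} x * divergence X x"
        by (intro tendsto_intros)
    qed
    show "AE x in lborel. norm (v k x * divergence X x) \<le> \<bar>divergence X x\<bar>" for k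
      using smooth_step_bounds by (auto simp: v_def abs_mult intro!: mult_left_le_one_le)
    show "(\<lambda>x. v k x * divergence X x) \<in> borel_measurable lborel" for k
      using borel_measurable_continuous_onI[OF contv[of k]] by simp
  qed simp
  then have "(\<lambda>k. - (LINT x|lborel. v k x * divergence X x)) \<longlonglongrightarrow> grad_indicator {x. t < u x} X"
    unfolding grad_indicator_def by (subst set_integral_lebesgue_eq) (auto intro: tendsto_minus)
  then have "(\<lambda>k. ennreal (- (LINT x|lborel. v k x * divergence X x))) \<longlonglongrightarrow> ennreal (grad_indicator {x. t < u x} X)"
    by (rule tendsto_ennrealI)
  then have "ennreal (grad_indicator {x. t < u x} X) = liminf (\<lambda>k. ennreal (- (LINT x|lborel. v k x * divergence X x)))"
    by (simp add: lim_imp_Liminf)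
  also have "\<dots> \<le> liminf ?I"
    by (rule Liminf_mono) (use le in auto)
  finally show "ennreal (grad_indicator {x. t < u x} X) \<le> liminf ?I" .
qed

lemma nn_integral_smooth_step_deriv_le_1:
  assumes "k > 0"
  shows "(\<integral>\<^sup>+t. ennreal (k * deriv smooth_step (k * (s - t))) * indicator {0..1} t \<partial>lborel) \<le> 1"
proof -
  have "((\<lambda>t. - smooth_step (k * (s - t))) has_real_derivative k * deriv smooth_step (k * (s - t))) (at t)" for t
    by (auto intro!: derivative_eq_intros DERIV_chain2[OF smooth_step_real_derivative])
  moreover have "(\<lambda>t. k * deriv smooth_step (k * (s - t))) \<in> borel_measurable borel"
    by (intro borel_measurable_continuous_onI continuous_intros
        continuous_on_compose2[OF continuous_deriv_smooth_step[of UNIV]]) auto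
  ultimately have "(\<integral>\<^sup>+t. ennreal (k * deriv smooth_step (k * (s - t))) * indicator {0..1} t \<partial>lborel)
      = ennreal (- smooth_step (k * (s - 1)) - - smooth_step (k * (s - 0)))"
    using assms smooth_step_deriv_nonneg
    by (intro nn_integral_FTC_Icc) (auto intro: has_field_derivative_at_within)
  also have "\<dots> \<le> ennreal 1"
    using smooth_step_bounds(1)[of "k * (s - 1)"] smooth_step_bounds(2)[of "k * (s - 0)"]
    by (intro ennreal_leI) linarith
  finally show ?thesis by simp
qed

text \<open>
  A point belongs to the symmetric difference of \<open>{u > t}\<close> and \<open>\<Omega>\<close> only for \<open>t\<close> between \<open>u x\<close> and the value of
  the indicator of \<open>\<Omega>\<close>.
\<close>

lemma nn_integral_level_sym_diff_le:
  "(\<integral>\<^sup>+t. indicator (sym_diff {x. t < u x} \<Omega>) x * indicator {0..1} t \<partial>lborel)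
     \<le> ennreal \<bar>u x - indicator \<Omega> x\<bar>" for u :: "'a \<Rightarrow> real"
proof -
  have "(\<integral>\<^sup>+t. indicator (sym_diff {x. t < u x} \<Omega>) x * indicator {0..1} t \<partial>lborel)
     \<le> (\<integral>\<^sup>+t. indicator (if x \<in> \<Omega> then {u x..1} else {0..u x}) t \<partial>lborel)"
    by (intro nn_integral_mono) (auto simp: indicator_def)
  also have "\<dots> = emeasure lborel (if x \<in> \<Omega> then {u x..1} else {0..u x})" by simp
  also have "\<dots> \<le> ennreal \<bar>u x - indicator \<Omega> x\<bar>"
    by (auto simp: emeasure_lborel_Icc_eq intro!: ennreal_leI)
  finally show ?thesis .
qed

text \<open>
  Only the easy half of the coarea formula is used: every level set \<open>{u > t}\<close> with \<open>0 \<le> t \<le> 1\<close> is a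
  competitor, so \<open>c\<close> is at most the average of their energies. Averaging the bound of
  \<open>perimeter_superlevel_le\<close> with Fatou's lemma avoids any statement about the measurability of the
  perimeter as a function of the level.
\<close>

lemma coarea_lower_bound:
  fixes u :: "'a::euclidean_space \<Rightarrow> real"
  assumes D: "\<And>x. (u has_derivative (\<lambda>h. g x \<bullet> h)) (at x)" and cont: "continuous_on UNIV g"
    and \<Omega>[measurable]: "\<Omega> \<in> sets borel"
    and c: "\<And>E. E \<in> sets borel \<Longrightarrow> c \<le> F_CE l \<Omega> E"
  shows "c \<le> (\<integral>\<^sup>+x. ennreal (norm (g x)) \<partial>lborel) + ennreal l * (\<integral>\<^sup>+x. ennreal \<bar>u x - indicator \<Omega> x\<bar> \<partial>lborel)"
proof -
  have contu: "continuous_on UNIV u"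
    using D by (meson continuous_at_imp_continuous_on has_derivative_continuous)
  have [measurable]: "u \<in> borel_measurable borel" "g \<in> borel_measurable borel"
    "deriv smooth_step \<in> borel_measurable borel"
    using cont contu continuous_deriv_smooth_step[of UNIV] by (auto simp: borel_measurable_continuous_onI)
  define f where "f = (\<lambda>k x t. ennreal (real (Suc k) * deriv smooth_step (real (Suc k) * (u x - t)) * norm (g x)))"
  define I where "I = (\<lambda>k t. \<integral>\<^sup>+x. f k x t \<partial>lborel)"
  have fm[measurable]: "(\<lambda>(x, t). f k x t) \<in> borel_measurable (lborel \<Otimes>\<^sub>M lborel)" for k
    unfolding f_def by measurable
  have Im[measurable]: "I k \<in> borel_measurable lborel" for k
    unfolding I_def using fm[of k] by measurable
  define S where "S = (\<lambda>t. \<integral>\<^sup>+x. indicator (sym_diff {x. t < u x} \<Omega>) x \<partial>lborel)"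
  have sm[measurable]: "(\<lambda>(x, t). indicator (sym_diff {x. t < u x} \<Omega>) x :: ennreal) \<in> borel_measurable (lborel \<Otimes>\<^sub>M lborel)"
  proof -
    have "(\<lambda>(x, t). indicator (sym_diff {x. t < u x} \<Omega>) x :: ennreal)
      = (\<lambda>(x, t). if t < u x then 1 - indicator \<Omega> x else indicator \<Omega> x)"
      by (auto simp: fun_eq_iff indicator_def)
    also have "\<dots> \<in> borel_measurable (lborel \<Otimes>\<^sub>M lborel)" by measurable
    finally show ?thesis .
  qed
  have Sm[measurable]: "S \<in> borel_measurable lborel"
    unfolding S_def using sm by measurable
  have le: "c \<le> liminf (\<lambda>k. I k t) + ennreal l * S t" for t
  proof -
    have "c \<le> perimeter {x. t < u x} + ennreal l * emeasure lebesgue (sym_diff {x. t < u x} \<Omega>)"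
      using c[of "{x. t < u x}"] by (simp add: F_CE_def)
    also have "emeasure lebesgue (sym_diff {x. t < u x} \<Omega>) = S t"
      unfolding S_def by (subst nn_integral_indicator) auto
    also have "perimeter {x. t < u x} \<le> liminf (\<lambda>k. I k t)"
      unfolding I_def f_def by (rule perimeter_superlevel_le[OF D cont])
    finally show ?thesis by (simp add: add_right_mono)
  qed
  \<comment> \<open>\<open>I k t\<close> bounds the perimeter of the level set as \<open>k\<close> grows, and \<open>S t\<close> is the volume of its symmetric
    difference with \<open>\<Omega>\<close>. The weights of the step derivatives in \<open>I k\<close> integrate over \<open>t\<close> to at most one.\<close>
  have "c = (\<integral>\<^sup>+t. c * indicator {0..1::real} t \<partial>lborel)"
    by (simp add: nn_integral_cmult)
  also have "\<dots> \<le> (\<integral>\<^sup>+t. liminf (\<lambda>k. I k t * indicator {0..1} t) + ennreal l * (S t * indicator {0..1} t) \<partial>lborel)"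
    by (intro nn_integral_mono) (use le in \<open>auto simp: indicator_def\<close>)
  also have "\<dots> = (\<integral>\<^sup>+t. liminf (\<lambda>k. I k t * indicator {0..1} t) \<partial>lborel) +
      ennreal l * (\<integral>\<^sup>+t. S t * indicator {0..1} t \<partial>lborel)"
    by (subst nn_integral_add) (auto simp: nn_integral_cmult)
  also have "\<dots> \<le> liminf (\<lambda>k. \<integral>\<^sup>+t. I k t * indicator {0..1} t \<partial>lborel) +
      ennreal l * (\<integral>\<^sup>+t. S t * indicator {0..1} t \<partial>lborel)"
    by (intro add_right_mono nn_integral_liminf) auto
  also have "(\<integral>\<^sup>+t. S t * indicator {0..1} t \<partial>lborel) \<le> (\<integral>\<^sup>+x. ennreal \<bar>u x - indicator \<Omega> x\<bar> \<partial>lborel)"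
  proof -
    have "(\<integral>\<^sup>+t. S t * indicator {0..1} t \<partial>lborel)
      = (\<integral>\<^sup>+t. \<integral>\<^sup>+x. indicator (sym_diff {x. t < u x} \<Omega>) x * indicator {0..1} t \<partial>lborel \<partial>lborel)"
      unfolding S_def by (intro nn_integral_cong, subst nn_integral_multc) auto
    also have "\<dots> = (\<integral>\<^sup>+x. \<integral>\<^sup>+t. indicator (sym_diff {x. t < u x} \<Omega>) x * indicator {0..1} t \<partial>lborel \<partial>lborel)"
      using sm by (intro lborel_pair.Fubini') measurable
    also have "\<dots> \<le> (\<integral>\<^sup>+x. ennreal \<bar>u x - indicator \<Omega> x\<bar> \<partial>lborel)"
      by (intro nn_integral_mono nn_integral_level_sym_diff_le)
    finally show ?thesis .
  qed
  also have "liminf (\<lambda>k. \<integral>\<^sup>+t. I k t * indicator {0..1} t \<partial>lborel) \<le> (\<integral>\<^sup>+x. ennreal (norm (g x)) \<partial>lborel)"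
  proof -
    have "(\<integral>\<^sup>+t. I k t * indicator {0..1} t \<partial>lborel) \<le> (\<integral>\<^sup>+x. ennreal (norm (g x)) \<partial>lborel)" for k
    proof -
      have "(\<integral>\<^sup>+t. I k t * indicator {0..1} t \<partial>lborel)
        = (\<integral>\<^sup>+t. \<integral>\<^sup>+x. f k x t * indicator {0..1} t \<partial>lborel \<partial>lborel)"
        unfolding I_def by (intro nn_integral_cong, subst nn_integral_multc) auto
      also have "\<dots> = (\<integral>\<^sup>+x. \<integral>\<^sup>+t. f k x t * indicator {0..1} t \<partial>lborel \<partial>lborel)"
        using fm[of k] by (intro lborel_pair.Fubini') measurable
      also have "\<dots> = (\<integral>\<^sup>+x. (\<integral>\<^sup>+t. ennreal (real (Suc k) * deriv smooth_step (real (Suc k) * (u x - t))) * indicator {0..1} t \<partial>lborel) * ennreal (norm (g x)) \<partial>lborel)"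
        unfolding f_def
        by (subst nn_integral_multc[symmetric])
           (auto intro!: nn_integral_cong simp: ennreal_mult smooth_step_deriv_nonneg mult_ac simp del: of_nat_Suc)
      also have "\<dots> \<le> (\<integral>\<^sup>+x. 1 * ennreal (norm (g x)) \<partial>lborel)"
        by (intro nn_integral_mono mult_right_mono nn_integral_smooth_step_deriv_le_1) auto
      finally show ?thesis by simp
    qed
    then have "liminf (\<lambda>k. \<integral>\<^sup>+t. I k t * indicator {0..1} t \<partial>lborel) \<le> liminf (\<lambda>k::nat. \<integral>\<^sup>+x. ennreal (norm (g x)) \<partial>lborel)"
      by (intro Liminf_mono) auto
    then show ?thesis by (simp add: Liminf_const)
  qed
  finally show ?thesis by (simp add: add_right_mono add_left_mono mult_left_mono)
qed

section \<open>Mollifiers and sums over grids\<close>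

text \<open>
  A difference of two steps: the translates by multiples of \<open>e\<close> telescope, hence add up to at most
  \<open>1/e\<close>. Together with the product structure this is why grid sums of the mollifier are bounded by the
  reciprocal of the volume of a grid cell, with no error term.
\<close>

definition step_bump :: "real \<Rightarrow> real \<Rightarrow> real" where
  "step_bump e t = (smooth_step (t / e) - smooth_step (t / e - 1)) / e"

definition mollifier :: "real \<Rightarrow> 'a::euclidean_space \<Rightarrow> real" where
  "mollifier e x = (\<Prod>b\<in>Basis. step_bump e (x \<bullet> b))"

definition grid_point :: "real \<Rightarrow> ('a \<Rightarrow> int) \<Rightarrow> 'a::euclidean_space" where
  "grid_point e k = (\<Sum>b\<in>Basis. (e * real_of_int (k b)) *\<^sub>R b)"

abbreviation grid_indices :: "nat \<Rightarrow> ('a::euclidean_space \<Rightarrow> int) set" where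
  "grid_indices n \<equiv> PiE Basis (\<lambda>_. {-int n..int n})"

lemma grid_point_inner: "b \<in> Basis \<Longrightarrow> grid_point e k \<bullet> b = e * real_of_int (k b)"
  by (simp add: grid_point_def inner_sum_left inner_Basis if_distrib cong: if_cong)

lemma finite_grid_indices: "finite (grid_indices n :: ('a::euclidean_space \<Rightarrow> int) set)"
  by (intro finite_PiE) auto

lemma step_bump_nonneg: "e > 0 \<Longrightarrow> step_bump e t \<ge> 0"
  using smooth_step_mono[of "t / e - 1" "t / e"] by (simp add: step_bump_def)

lemma step_bump_eq_0: "e > 0 \<Longrightarrow> t < 0 \<or> t > 2 * e \<Longrightarrow> step_bump e t = 0"
  by (auto simp: step_bump_def smooth_step_eq_0 smooth_step_eq_1 field_simps)

lemma smooth_step_bump: "smooth (step_bump e)"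
proof -
  have "smooth (\<lambda>t. smooth_step (a + inverse e * t))" for a
    by (rule smooth_compose_affine[OF bounded_linear_mult_right smooth_smooth_step])
  from smooth_mult[OF smooth_diff[OF this[of 0] this[of "-1"]] smooth_const[of "inverse e"]]
  show ?thesis by (simp add: step_bump_def[abs_def] divide_inverse mult.commute algebra_simps)
qed

lemma sum_step_bump_le:
  assumes "e > 0"
  shows "(\<Sum>j\<in>{-int n..int n}. step_bump e (t + e * real_of_int j)) \<le> 1 / e"
proof -
  have "(\<Sum>j\<in>{-int n..int n}. step_bump e (t + e * real_of_int j))
      = (smooth_step (t / e + real n) - smooth_step (t / e - real n - 1)) / e"
  proof (induction n)
    case 0
    then show ?case by (simp add: step_bump_def)
  next
    case (Suc n)
    have "{-int (Suc n)..int (Suc n)} = insert (int (Suc n)) (insert (- int (Suc n)) {-int n..int n})"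
      by auto
    moreover have "step_bump e (t + e * real_of_int j) =
        (smooth_step (t / e + real_of_int j) - smooth_step (t / e + real_of_int j - 1)) / e" for j
      using assms by (simp add: step_bump_def field_simps)
    ultimately show ?case using Suc
      by (simp add: add_divide_distrib[symmetric] diff_divide_distrib[symmetric] algebra_simps)
  qed
  also have "\<dots> \<le> 1 / e"
    using assms smooth_step_bounds(2)[of "t / e + real n"] smooth_step_bounds(1)[of "t / e - real n - 1"]
    by (intro divide_right_mono) linarith+
  finally show ?thesis .
qed

lemma mollifier_nonneg: "e > 0 \<Longrightarrow> mollifier e x \<ge> 0"
  unfolding mollifier_def by (intro prod_nonneg step_bump_nonneg)

lemma mollifier_eq_0:
  fixes x :: "'a::euclidean_space"
  assumes "e > 0" "x \<notin> cbox 0 ((2 * e) *\<^sub>R One)"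
  shows "mollifier e x = 0"
proof -
  obtain b where b: "b \<in> Basis" "x \<bullet> b < 0 \<or> x \<bullet> b > 2 * e"
    using assms(2) by (auto simp: mem_box not_le)
  then have "step_bump e (x \<bullet> b) = 0" using step_bump_eq_0 assms(1) by blast
  then show ?thesis unfolding mollifier_def using b(1) by (auto intro: prod_zero)
qed

lemma test_function_mollifier: "e > 0 \<Longrightarrow> test_function (mollifier e)"
proof -
  assume "e > 0"
  have "smooth (\<lambda>x::'a. step_bump e (x \<bullet> b))" for b
    using smooth_compose_affine[where a=0, OF bounded_linear_inner_left[of b] smooth_step_bump[of e]] by simp
  then have "smooth (mollifier e :: 'a \<Rightarrow> real)" unfolding mollifier_def[abs_def] by (rule smooth_prod)
  then show ?thesis
    using mollifier_eq_0[OF \<open>e > 0\<close>] compact_cbox unfolding test_function_def by blast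
qed

lemma sum_mollifier_grid_le:
  fixes x :: "'a::euclidean_space"
  assumes "e > 0"
  shows "(\<Sum>k\<in>grid_indices n. mollifier e (x + grid_point e k)) \<le> 1 / e ^ DIM('a)"
proof -
  have "(\<Sum>k\<in>grid_indices n. mollifier e (x + grid_point e k)) =
      (\<Sum>k\<in>grid_indices n. \<Prod>b\<in>Basis. step_bump e (x \<bullet> b + e * real_of_int (k b)))"
    by (simp add: mollifier_def inner_add_left grid_point_inner)
  also have "\<dots> = (\<Prod>b\<in>(Basis::'a set). \<Sum>j\<in>{-int n..int n}. step_bump e (x \<bullet> b + e * real_of_int j))"
    by (subst prod_sum_PiE) auto
  also have "\<dots> \<le> (\<Prod>b\<in>(Basis::'a set). 1 / e)"
    using assms by (intro prod_mono conjI sum_nonneg step_bump_nonneg sum_step_bump_le)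
  finally show ?thesis by (simp add: power_divide)
qed

lemma integrable_mollifier: "e > 0 \<Longrightarrow> integrable lborel (mollifier e :: 'a::euclidean_space \<Rightarrow> real)"
  using test_function_mollifier[of e, where 'a='a] unfolding test_function_def
  by (auto intro: integrable_continuous_compact_support smooth_continuous_on)

text \<open>
  The integral is a product of integrals over the line. There, the part of the step up to \<open>e\<close>
  reappears shifted by \<open>e\<close> with the opposite sign, which leaves a step equal to one over an interval of length \<open>e\<close>.
\<close>

lemma nn_integral_mollifier:
  assumes "e > 0"
  shows "(\<integral>\<^sup>+x. ennreal (mollifier e (x::'a::euclidean_space)) \<partial>lborel) = 1"
proof -
  have cont: "continuous_on S smooth_step" for S by (intro smooth_continuous_on smooth_smooth_step)
  have b: "continuous_on S (step_bump e)" for S by (intro smooth_continuous_on smooth_step_bump)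
  define G where "G t = integral {-5..t} smooth_step" for t
  have G: "(G has_real_derivative smooth_step t) (at t)" if "-5 < t" "t < 5" for t
    using integral_has_real_derivative[OF cont, of t "-5" 5] that unfolding G_def[abs_def]
    by (simp add: at_within_Icc_at)
  have G1: "G 2 - G 1 = 1" "G 0 - G (-1) = 0"
  proof -
    have i: "smooth_step integrable_on {a..b}" for a b
      using integrable_continuous_interval[OF cont] .
    have "integral {1..2} smooth_step = integral {1..2::real} (\<lambda>_. 1)"
      by (rule integral_cong) (auto simp: smooth_step_eq_1)
    then show "G 2 - G 1 = 1"
      using Henstock_Kurzweil_Integration.integral_combine[of "-5" 1 2 smooth_step] i by (simp add: G_def)
    have "integral {-1..0} smooth_step = integral {-1..0::real} (\<lambda>_. 0)"
      by (rule integral_cong) (auto simp: smooth_step_eq_0)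
    then show "G 0 - G (-1) = 0"
      using Henstock_Kurzweil_Integration.integral_combine[of "-5" "-1" 0 smooth_step] i by (simp add: G_def)
  qed
  have "(\<integral>\<^sup>+t. ennreal (step_bump e t) \<partial>lborel) = (\<integral>\<^sup>+t. ennreal (step_bump e t) * indicator {0..2 * e} t \<partial>lborel)"
    using step_bump_eq_0[OF assms] by (intro nn_integral_cong) (auto simp: indicator_def)
  also have "\<dots> = ennreal ((G (2 * e / e) - G (2 * e / e - 1)) - (G (0 / e) - G (0 / e - 1)))"
  proof (rule nn_integral_FTC_Icc)
    fix t assume "t \<in> {0..2 * e}"
    then have t: "0 \<le> t" "t \<le> 2 * e" by auto
    have "0 \<le> t / e" "t / e \<le> 2" using t assms by (auto simp: field_simps)
    then have "((\<lambda>t. G (t / e + c)) has_real_derivative smooth_step (t / e + c) * (1 / e)) (at t)"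
      if "\<bar>c\<bar> \<le> 1" for c
      using that assms by (intro DERIV_chain2[OF G]) (auto intro!: derivative_eq_intros)
    from DERIV_diff[OF this[of 0] this[of "-1"]]
    show "((\<lambda>t. G (t / e) - G (t / e - 1)) has_real_derivative step_bump e t) (at t)"
      by (simp add: step_bump_def diff_divide_distrib)
  qed (use assms step_bump_nonneg borel_measurable_continuous_onI[OF b] in auto)
  also have "\<dots> = 1" using G1 assms by simp
  finally have 1: "(\<integral>\<^sup>+t. ennreal (step_bump e t) \<partial>lborel) = 1" .
  have "(\<integral>\<^sup>+x. ennreal (mollifier e (x::'a)) \<partial>lborel) =
      (\<integral>\<^sup>+x. (\<Prod>b\<in>Basis. ennreal (step_bump e ((x::'a) \<bullet> b))) \<partial>lborel)"
    unfolding mollifier_def using assms by (intro nn_integral_cong) (simp add: prod_ennreal step_bump_nonneg)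
  also have "\<dots> = (\<Prod>b\<in>(Basis::'a set). (\<integral>\<^sup>+t. ennreal (step_bump e t) \<partial>lborel))"
    using borel_measurable_continuous_onI[OF b] by (intro nn_integral_lborel_prod) auto
  finally show ?thesis by (simp add: 1)
qed

text \<open>
  The integral of \<open>f\<close> is the integral over one cell of the sum of \<open>f\<close> over a translated grid. It reduces
  the \<open>L\<^sup>1\<close> bounds for mollified functionals below to finite linear combinations of test functions, for
  which linearity suffices, so that no measure has to be constructed to represent the functional.
\<close>

lemma nn_integral_le_grid_sums:
  fixes f :: "'a::euclidean_space \<Rightarrow> ennreal"
  assumes e: "e > 0" and [measurable]: "f \<in> borel_measurable borel"
    and M: "M \<ge> 0" "\<And>n x. (\<Sum>k\<in>grid_indices n. f (x + grid_point e k)) \<le> ennreal (M / e ^ DIM('a))"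
  shows "(\<integral>\<^sup>+x. f x \<partial>lborel) \<le> ennreal M"
proof -
  define Q where "Q = cbox (0::'a) (e *\<^sub>R One)"
  define B where "B n = cbox (- (real n * e) *\<^sub>R One) ((real n * e) *\<^sub>R One :: 'a)" for n
  have Q: "emeasure lborel Q = ennreal (e ^ DIM('a))"
    unfolding Q_def using e by (subst emeasure_lborel_cbox) (auto simp: ennreal_power)
  have cover: "indicator (B n) x \<le> (\<Sum>k\<in>grid_indices n. indicator Q (x - grid_point e k) :: ennreal)" for n x
  proof (cases "x \<in> B n")
    case True
    define k where "k = restrict (\<lambda>b. \<lfloor>x \<bullet> b / e\<rfloor>) Basis"
    have k: "k \<in> grid_indices n"
    proof -
      have "\<lfloor>x \<bullet> b / e\<rfloor> \<in> {-int n..int n}" if "b \<in> Basis" for b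
      proof -
        have "- real n \<le> x \<bullet> b / e" "x \<bullet> b / e \<le> real n"
          using True that e unfolding B_def by (auto simp: mem_box field_simps)
        then show ?thesis by (auto simp: le_floor_iff floor_le_iff)
      qed
      then show ?thesis by (auto simp: k_def)
    qed
    have "x - grid_point e k \<in> Q"
      unfolding Q_def mem_box
    proof (intro ballI conjI)
      fix b :: 'a assume b: "b \<in> Basis"
      have "real_of_int \<lfloor>x \<bullet> b / e\<rfloor> \<le> x \<bullet> b / e" "x \<bullet> b / e \<le> real_of_int \<lfloor>x \<bullet> b / e\<rfloor> + 1" by linarith+
      from this[THEN mult_left_mono, of e]
      have "e * real_of_int \<lfloor>x \<bullet> b / e\<rfloor> \<le> x \<bullet> b" "x \<bullet> b \<le> e * real_of_int \<lfloor>x \<bullet> b / e\<rfloor> + e"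
        using e by (auto simp: algebra_simps)
      then show "0 \<bullet> b \<le> (x - grid_point e k) \<bullet> b" "(x - grid_point e k) \<bullet> b \<le> (e *\<^sub>R One) \<bullet> b"
        using b by (auto simp: inner_diff_left grid_point_inner k_def)
    qed
    then have "1 \<le> (\<Sum>k\<in>{k}. indicator Q (x - grid_point e k) :: ennreal)" by simp
    also have "\<dots> \<le> (\<Sum>k\<in>grid_indices n. indicator Q (x - grid_point e k))"
      using k by (intro sum_mono2 finite_grid_indices) auto
    finally show ?thesis using True by simp
  qed simp
  have "(\<integral>\<^sup>+x. f x * indicator (B n) x \<partial>lborel) \<le> ennreal M" for n
  proof -
    have "(\<integral>\<^sup>+x. f x * indicator (B n) x \<partial>lborel) \<le>
        (\<integral>\<^sup>+x. (\<Sum>k\<in>grid_indices n. f x * indicator Q (x - grid_point e k)) \<partial>lborel)"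
      unfolding sum_distrib_left[symmetric] by (intro nn_integral_mono mult_left_mono cover) auto
    also have "\<dots> = (\<Sum>k\<in>grid_indices n. \<integral>\<^sup>+x. f x * indicator Q (x - grid_point e k) \<partial>lborel)"
      unfolding Q_def by (intro nn_integral_sum) measurable
    also have "\<dots> = (\<Sum>k\<in>grid_indices n. \<integral>\<^sup>+x. f (x + grid_point e k) * indicator Q x \<partial>lborel)"
    proof (intro sum.cong refl)
      fix k :: "'a \<Rightarrow> int"
      show "(\<integral>\<^sup>+x. f x * indicator Q (x - grid_point e k) \<partial>lborel) = (\<integral>\<^sup>+x. f (x + grid_point e k) * indicator Q x \<partial>lborel)"
        using nn_integral_lborel_translation[of "\<lambda>x. f x * indicator Q (x - grid_point e k)" "grid_point e k"]
        unfolding Q_def by (simp add: add.commute)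
    qed
    also have "\<dots> = (\<integral>\<^sup>+x. (\<Sum>k\<in>grid_indices n. f (x + grid_point e k)) * indicator Q x \<partial>lborel)"
      unfolding Q_def sum_distrib_right by (intro nn_integral_sum[symmetric]) measurable
    also have "\<dots> \<le> (\<integral>\<^sup>+x. ennreal (M / e ^ DIM('a)) * indicator Q x \<partial>lborel)"
      by (intro nn_integral_mono mult_right_mono M(2)) auto
    also have "\<dots> = ennreal (M / e ^ DIM('a)) * emeasure lborel Q"
      unfolding Q_def by (simp add: nn_integral_cmult)
    also have "\<dots> = ennreal M"
      unfolding Q using M(1) e by (subst ennreal_mult[symmetric]) auto
    finally show ?thesis .
  qed
  then have le: "liminf (\<lambda>n. \<integral>\<^sup>+x. f x * indicator (B n) x \<partial>lborel) \<le> ennreal M"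
    using Liminf_mono[of "\<lambda>n. \<integral>\<^sup>+x. f x * indicator (B n) x \<partial>lborel" "\<lambda>_. ennreal M" sequentially]
    by (simp add: Liminf_const)
  have "(\<integral>\<^sup>+x. f x \<partial>lborel) = (\<integral>\<^sup>+x. liminf (\<lambda>n. f x * indicator (B n) x) \<partial>lborel)"
  proof (intro nn_integral_cong)
    fix x :: 'a
    obtain n where n: "norm x / e \<le> real n" using real_arch_simple by blast
    have "x \<in> B m" if "m \<ge> n" for m
    proof -
      have "norm x \<le> real n * e" using n e by (simp add: field_simps)
      also have "\<dots> \<le> real m * e" using that e by (intro mult_right_mono) auto
      finally have "\<bar>x \<bullet> b\<bar> \<le> real m * e" if "b \<in> Basis" for b
        using Basis_le_norm[OF that, of x] by linarith
      then show ?thesis unfolding B_def mem_box by (auto simp: abs_le_iff minus_le_iff)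
    qed
    then have "\<forall>\<^sub>F m in sequentially. f x * indicator (B m) x = f x"
      by (intro eventually_sequentiallyI[of n]) auto
    then have "(\<lambda>m. f x * indicator (B m) x) \<longlonglongrightarrow> f x" by (rule tendsto_eventually)
    then show "f x = liminf (\<lambda>n. f x * indicator (B n) x)"
      by (simp add: lim_imp_Liminf)
  qed
  also have "\<dots> \<le> liminf (\<lambda>n. \<integral>\<^sup>+x. f x * indicator (B n) x \<partial>lborel)"
    unfolding B_def by (intro nn_integral_liminf) measurable
  finally show ?thesis using le by simp
qed

section \<open>Mollification of functionals\<close>

text \<open>
  Linear functionals that are locally bounded in the supremum norm, i.e. signed Radon measures in the
  guise of functionals: both \<open>m\<close>-currents of finite mass and integration over a set are of this kind.
\<close>

definition radon_functional :: "(('a::euclidean_space \<Rightarrow> real) \<Rightarrow> real) \<Rightarrow> bool" where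
  "radon_functional T \<longleftrightarrow>
     (\<forall>f g. test_function f \<longrightarrow> test_function g \<longrightarrow> T (\<lambda>x. f x + g x) = T f + T g) \<and>
     (\<forall>c f. test_function f \<longrightarrow> T (\<lambda>x. c * f x) = c * T f) \<and>
     (\<forall>K. compact K \<longrightarrow> (\<exists>C. \<forall>f B. test_function f \<longrightarrow> (\<forall>x. x \<notin> K \<longrightarrow> f x = 0) \<longrightarrow>
        (\<forall>x. \<bar>f x\<bar> \<le> B) \<longrightarrow> \<bar>T f\<bar> \<le> C * B))"

lemma test_function_add: "test_function f \<Longrightarrow> test_function g \<Longrightarrow> test_function (\<lambda>x. f x + g x)"
proof -
  assume "test_function f" "test_function g"
  then obtain K L where "smooth f" "smooth g" "compact K" "compact L"
    "\<And>x. x \<notin> K \<Longrightarrow> f x = 0" "\<And>x. x \<notin> L \<Longrightarrow> g x = 0"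
    unfolding test_function_def by metis
  then show ?thesis
    unfolding test_function_def by (intro conjI smooth_add exI[of _ "K \<union> L"]) auto
qed

lemma test_function_scaleR: "test_function f \<Longrightarrow> test_function (\<lambda>x. c *\<^sub>R f x)"
  unfolding test_function_def by (auto intro: smooth_scaleR)

lemma test_function_scaleR_vector:
  fixes f :: "'a::euclidean_space \<Rightarrow> real"
  shows "test_function f \<Longrightarrow> test_function (\<lambda>x. f x *\<^sub>R v)"
  unfolding test_function_def by (auto intro: smooth_scaleR)

lemma test_function_mult_left:
  fixes f :: "'a::euclidean_space \<Rightarrow> real"
  shows "test_function f \<Longrightarrow> test_function (\<lambda>x. c * f x)"
  using test_function_scaleR[of f c] by simp

lemma test_function_zero: "test_function (\<lambda>x. 0)"
  unfolding test_function_def by auto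

lemma test_function_sum:
  "(\<And>i. i \<in> I \<Longrightarrow> test_function (f i)) \<Longrightarrow> test_function (\<lambda>x. \<Sum>i\<in>I. f i x)"
  by (induction I rule: infinite_finite_induct) (auto intro: test_function_add test_function_zero)

lemma test_function_reflect:
  fixes f :: "'a::euclidean_space \<Rightarrow> 'b::real_normed_vector"
  assumes "test_function f"
  shows "test_function (\<lambda>y. f (x - y))"
proof -
  obtain K where K: "compact K" "\<And>x. x \<notin> K \<Longrightarrow> f x = 0" and sm: "smooth f"
    using assms unfolding test_function_def by metis
  have "smooth (\<lambda>y. f (x + - y))"
    by (rule smooth_compose_affine[OF _ sm]) (simp add: bounded_linear_minus bounded_linear_ident)
  moreover have "compact ((\<lambda>z. x - z) ` K)"
    by (intro compact_continuous_image K continuous_intros)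
  moreover have "f (x - y) = 0" if "y \<notin> (\<lambda>z. x - z) ` K" for y
    using that by (intro K(2)) (auto simp: image_iff)
  ultimately show ?thesis unfolding test_function_def by auto
qed

lemma test_function_frechet_derivative:
  assumes "test_function f"
  shows "test_function (\<lambda>x. frechet_derivative f (at x) v)"
proof -
  obtain K where K: "compact K" "\<And>x. x \<notin> K \<Longrightarrow> f x = 0" and sm: "smooth f"
    using assms unfolding test_function_def by metis
  then show ?thesis
    unfolding test_function_def
    using smooth_frechet_derivative[OF sm] frechet_derivative_zero_outside[OF K(2) compact_imp_closed[OF K(1)]]
    by (intro conjI exI[of _ K]) auto
qed

lemma test_function_bounded:
  assumes "test_function f"
  obtains C where "C > 0" "\<And>x. norm (f x) \<le> C"
  using assms bounded_continuous_compact_support[OF smooth_continuous_on] unfolding test_function_def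
  by metis

lemma radon_functional_add:
  "radon_functional T \<Longrightarrow> test_function f \<Longrightarrow> test_function g \<Longrightarrow> T (\<lambda>x. f x + g x) = T f + T g"
  unfolding radon_functional_def by blast

lemma radon_functional_mult:
  "radon_functional T \<Longrightarrow> test_function f \<Longrightarrow> T (\<lambda>x. c * f x) = c * T f"
  unfolding radon_functional_def by blast

lemma radon_functional_bound:
  assumes "radon_functional T" "compact K"
  obtains C where "\<And>f B. test_function f \<Longrightarrow> (\<And>x. x \<notin> K \<Longrightarrow> f x = 0) \<Longrightarrow>
     (\<And>x. \<bar>f x\<bar> \<le> B) \<Longrightarrow> \<bar>T f\<bar> \<le> C * B"
  using assms unfolding radon_functional_def by metis

lemma radon_functional_sum:
  assumes "radon_functional T" "\<And>i. i \<in> I \<Longrightarrow> test_function (f i)"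
  shows "T (\<lambda>x. \<Sum>i\<in>I. c i * f i x) = (\<Sum>i\<in>I. c i * T (f i))"
proof -
  have 0: "T (\<lambda>x. 0) = 0"
    using radon_functional_mult[OF assms(1) test_function_zero, of 0] by simp
  show ?thesis
    using assms(2)
  proof (induction I rule: infinite_finite_induct)
    case (insert i I)
    then show ?case
      using radon_functional_add[OF assms(1) test_function_mult_left test_function_sum[OF test_function_mult_left], of "f i" I f "c i" c]
        radon_functional_mult[OF assms(1)] by simp
  qed (auto simp: 0)
qed

lemma frechet_derivative_expand:
  assumes "smooth f"
  shows "frechet_derivative f (at x) h = (\<Sum>b\<in>Basis. (h \<bullet> b) *\<^sub>R frechet_derivative f (at x) b)"
proof -
  have "linear (frechet_derivative f (at x))"
    using smooth_has_derivative[OF assms] has_derivative_linear by blast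
  then have "frechet_derivative f (at x) (\<Sum>b\<in>Basis. (h \<bullet> b) *\<^sub>R b) = (\<Sum>b\<in>Basis. (h \<bullet> b) *\<^sub>R frechet_derivative f (at x) b)"
    by (simp add: linear_sum linear_cmul)
  then show ?thesis by (simp add: euclidean_representation)
qed

lemma test_function_derivative_bound:
  assumes "test_function f"
  obtains C where "C > 0" "\<And>x h. norm (frechet_derivative f (at x) h) \<le> C * norm h"
proof -
  have sm: "smooth f" using assms by (simp add: test_function_def)
  have "\<exists>C>0. \<forall>x. norm (frechet_derivative f (at x) b) \<le> C" for b
    using test_function_bounded[OF test_function_frechet_derivative[OF assms]] by metis
  then obtain C where C: "\<And>b. C b > 0" "\<And>b x. norm (frechet_derivative f (at x) b) \<le> C b" by metis
  show thesis
  proof (rule that[of "\<Sum>b\<in>Basis. C b"])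
    fix x h
    have "norm (frechet_derivative f (at x) h) \<le> (\<Sum>b\<in>Basis. norm ((h \<bullet> b) *\<^sub>R frechet_derivative f (at x) b))"
      unfolding frechet_derivative_expand[OF sm, of x h] by (rule norm_sum)
    also have "\<dots> \<le> (\<Sum>b\<in>Basis. norm h * C b)"
      using C Basis_le_norm by (auto intro!: sum_mono mult_mono)
    finally show "norm (frechet_derivative f (at x) h) \<le> (\<Sum>b\<in>Basis. C b) * norm h"
      by (simp add: sum_distrib_left mult.commute)
  qed (use C in \<open>auto intro!: sum_pos\<close>)
qed

text \<open>
  Second derivatives of a test function are bounded. The uniformity in \<open>x\<close> is what allows a
  functional to be applied to the remainder when a convolution is differentiated.
\<close>

lemma test_function_uniform_taylor:
  fixes f :: "'a::euclidean_space \<Rightarrow> real"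
  assumes "test_function f"
  obtains C where "C > 0" "\<And>x h. \<bar>f (x + h) - f x - frechet_derivative f (at x) h\<bar> \<le> C * norm h * norm h"
proof -
  have sm: "smooth f" using assms by (simp add: test_function_def)
  have "\<exists>C>0. \<forall>x h. norm (frechet_derivative (\<lambda>y. frechet_derivative f (at y) b) (at x) h) \<le> C * norm h" for b
    using test_function_derivative_bound[OF test_function_frechet_derivative[OF assms]] by metis
  then obtain C where C: "\<And>b. C b > 0"
    "\<And>b x h. norm (frechet_derivative (\<lambda>y. frechet_derivative f (at y) b) (at x) h) \<le> C b * norm h" by metis
  have lip: "norm (frechet_derivative f (at y) b - frechet_derivative f (at x) b) \<le> C b * norm (y - x)" for x y b
  proof (rule differentiable_bound[of UNIV "\<lambda>y. frechet_derivative f (at y) b"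
        "\<lambda>x. frechet_derivative (\<lambda>y. frechet_derivative f (at y) b) (at x)"])
    show "onorm (frechet_derivative (\<lambda>y. frechet_derivative f (at y) b) (at x)) \<le> C b" for x
      by (rule onorm_le) (rule C(2))
  qed (use smooth_has_derivative[OF smooth_frechet_derivative[OF sm]] in auto)
  define D where "D = (\<Sum>b\<in>(Basis::'a set). C b)"
  have D: "norm (frechet_derivative f (at y) h - frechet_derivative f (at x) h) \<le> (D * norm (y - x)) * norm h" for x y h
  proof -
    have "frechet_derivative f (at y) h - frechet_derivative f (at x) h
      = (\<Sum>b\<in>Basis. (h \<bullet> b) *\<^sub>R (frechet_derivative f (at y) b - frechet_derivative f (at x) b))"
      unfolding frechet_derivative_expand[OF sm, of _ h] by (simp add: sum_subtractf algebra_simps)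
    also have "norm \<dots> \<le> (\<Sum>b\<in>Basis. norm h * (C b * norm (y - x)))"
    proof (rule sum_norm_le)
      fix b :: 'a assume "b \<in> Basis"
      then show "norm ((h \<bullet> b) *\<^sub>R (frechet_derivative f (at y) b - frechet_derivative f (at x) b)) \<le> norm h * (C b * norm (y - x))"
        unfolding norm_scaleR using lip[of y b x] Basis_le_norm[of b h] by (intro mult_mono) auto
    qed
    finally show ?thesis by (simp add: D_def sum_distrib_left sum_distrib_right mult_ac)
  qed
  show thesis
  proof (rule that[of D])
    show "D > 0" unfolding D_def using C by (auto intro!: sum_pos)
    fix x h
    have "norm (f (x + h) - f x - frechet_derivative f (at x) ((x + h) - x)) \<le> norm ((x + h) - x) * (D * norm h)"
    proof (rule differentiable_bound_linearization[where S="cball x (norm h)"])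
      fix t :: real assume "t \<in> {0..1}"
      then show "x + t *\<^sub>R (x + h - x) \<in> cball x (norm h)"
        by (auto simp: dist_norm mult_left_le_one_le)
    next
      fix y assume y: "y \<in> cball x (norm h)"
      show "(f has_derivative frechet_derivative f (at y)) (at y within cball x (norm h))"
        using smooth_has_derivative[OF sm] has_derivative_at_withinI by blast
      show "onorm (frechet_derivative f (at y) - frechet_derivative f (at x)) \<le> D * norm h"
      proof (rule onorm_le)
        fix k
        have "norm ((frechet_derivative f (at y) - frechet_derivative f (at x)) k) \<le> D * norm (y - x) * norm k"
          using D[of y k x] by simp
        also have "\<dots> \<le> D * norm h * norm k"
          using y \<open>D > 0\<close> by (intro mult_right_mono mult_left_mono) (auto simp: dist_norm norm_minus_commute)
        finally show "norm ((frechet_derivative f (at y) - frechet_derivative f (at x)) k) \<le> D * norm h * norm k" .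
      qed
    qed simp
    then show "\<bar>f (x + h) - f x - frechet_derivative f (at x) h\<bar> \<le> D * norm h * norm h"
      by (simp add: mult_ac)
  qed
qed

definition conv :: "(('a::euclidean_space \<Rightarrow> real) \<Rightarrow> real) \<Rightarrow> ('a \<Rightarrow> real) \<Rightarrow> 'a \<Rightarrow> real" where
  "conv T f x = T (\<lambda>y. f (x - y))"

text \<open>
  The gradient of the convolution, with the derivative taken under the functional.
\<close>

definition conv_grad :: "(('a::euclidean_space \<Rightarrow> real) \<Rightarrow> real) \<Rightarrow> ('a \<Rightarrow> real) \<Rightarrow> 'a \<Rightarrow> 'a" where
  "conv_grad T f x = (\<Sum>b\<in>Basis. T (\<lambda>y. frechet_derivative f (at (x - y)) b) *\<^sub>R b)"

lemma conv_grad_inner: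
  assumes T: "radon_functional T" and f: "test_function f"
  shows "conv_grad T f x \<bullet> h = T (\<lambda>y. frechet_derivative f (at (x - y)) h)"
proof -
  have "T (\<lambda>y. frechet_derivative f (at (x - y)) h) =
      T (\<lambda>y. \<Sum>b\<in>Basis. (h \<bullet> b) * frechet_derivative f (at (x - y)) b)"
    using f frechet_derivative_expand[of f _ h] by (simp add: test_function_def)
  also have "\<dots> = (\<Sum>b\<in>Basis. (h \<bullet> b) * T (\<lambda>y. frechet_derivative f (at (x - y)) b))"
    by (rule radon_functional_sum[OF T test_function_reflect[OF test_function_frechet_derivative[OF f]]])
  finally show ?thesis by (simp add: conv_grad_def inner_sum_right inner_commute[of _ h] mult.commute)
qed

lemma conv_has_derivative:
  assumes T: "radon_functional T" and f: "test_function f"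
  shows "(conv T f has_derivative (\<lambda>h. conv_grad T f x \<bullet> h)) (at x)"
proof -
  obtain K where K: "compact K" "\<And>x. x \<notin> K \<Longrightarrow> f x = 0" and sm: "smooth f"
    using f unfolding test_function_def by metis
  define K1 where "K1 = (\<lambda>(h, z). x + h - z) ` (cball 0 1 \<times> K)"
  have K1: "compact K1"
    unfolding K1_def by (intro compact_continuous_image compact_Times K compact_cball)
      (auto intro!: continuous_intros simp: case_prod_beta)
  have K1I: "y \<in> K1" if "x + h - y \<in> K" "norm h \<le> 1" for y h
    unfolding K1_def using that by (intro image_eqI[of _ _ "(h, x + h - y)"]) auto
  obtain C where C: "\<And>f B. test_function f \<Longrightarrow> (\<And>x. x \<notin> K1 \<Longrightarrow> f x = 0) \<Longrightarrow>
     (\<And>x. \<bar>f x\<bar> \<le> B) \<Longrightarrow> \<bar>T f\<bar> \<le> C * B"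
    using radon_functional_bound[OF T K1] by blast
  obtain D where D: "D > 0" "\<And>x h. \<bar>f (x + h) - f x - frechet_derivative f (at x) h\<bar> \<le> D * norm h * norm h"
    using test_function_uniform_taylor[OF f] by blast
  \<comment> \<open>For \<open>\<bar>h\<bar> \<le> 1\<close> the remainders are supported in the one compact set \<open>K1\<close>, where \<open>T\<close> is bounded by \<open>C\<close>.\<close>
  have est: "\<bar>conv T f (x + h) - conv T f x - conv_grad T f x \<bullet> h\<bar> \<le> C * (D * norm h * norm h)"
    if h: "norm h \<le> 1" for h
  proof -
    define F where "F = (\<lambda>y. f (x + h - y) - f (x - y) - frechet_derivative f (at (x - y)) h)"
    have t: "test_function (\<lambda>y. f (x + h - y))" "test_function (\<lambda>y. (-1) * f (x - y))"
      "test_function (\<lambda>y. (-1) * frechet_derivative f (at (x - y)) h)"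
      by (rule test_function_reflect[OF f] test_function_mult_left[OF test_function_reflect[OF f]]
          test_function_mult_left[OF test_function_reflect[OF test_function_frechet_derivative[OF f]]])+
    have Feq: "F = (\<lambda>y. (f (x + h - y) + (-1) * f (x - y)) + (-1) * frechet_derivative f (at (x - y)) h)"
      by (simp add: F_def)
    have "T F = conv T f (x + h) + (-1) * conv T f x + (-1) * (conv_grad T f x \<bullet> h)"
      unfolding Feq conv_grad_inner[OF T f] conv_def
      by (simp only: radon_functional_add[OF T test_function_add[OF t(1,2)] t(3)] radon_functional_add[OF T t(1,2)]
          radon_functional_mult[OF T test_function_reflect[OF f]]
          radon_functional_mult[OF T test_function_reflect[OF test_function_frechet_derivative[OF f]]])
    moreover have "\<bar>T F\<bar> \<le> C * (D * norm h * norm h)"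
    proof (rule C)
      show "test_function F" unfolding Feq by (intro test_function_add t)
      show "F y = 0" if "y \<notin> K1" for y
      proof -
        have "x + h - y \<notin> K" "x - y \<notin> K" using K1I[of h y] K1I[of 0 y] h that by auto
        then show ?thesis
          by (simp add: F_def K frechet_derivative_zero_outside[OF K(2) compact_imp_closed[OF K(1)]])
      qed
      show "\<bar>F y\<bar> \<le> D * norm h * norm h" for y
        using D(2)[of "x - y" h] by (simp add: F_def algebra_simps)
    qed
    ultimately show ?thesis by simp
  qed
  show ?thesis
    unfolding has_derivative_at
  proof (intro conjI bounded_linear_inner_right)
    show "(\<lambda>h. norm (conv T f (x + h) - conv T f x - conv_grad T f x \<bullet> h) / norm h) \<midarrow>0\<rightarrow> 0"
    proof (rule Lim_null_comparison)
      show "\<forall>\<^sub>F h in at 0. norm (norm (conv T f (x + h) - conv T f x - conv_grad T f x \<bullet> h) / norm h) \<le> \<bar>C\<bar> * D * norm h"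
        unfolding eventually_at
      proof (intro exI[of _ 1] conjI ballI impI)
        fix h :: 'a assume h: "h \<noteq> 0 \<and> dist h 0 < 1"
        have "\<bar>conv T f (x + h) - conv T f x - conv_grad T f x \<bullet> h\<bar> \<le> C * (D * norm h * norm h)"
          using est[of h] h by simp
        also have "\<dots> \<le> \<bar>C\<bar> * (D * norm h * norm h)"
          using D(1) by (intro mult_right_mono) auto
        finally show "norm (norm (conv T f (x + h) - conv T f x - conv_grad T f x \<bullet> h) / norm h) \<le> \<bar>C\<bar> * D * norm h"
          using h by (simp add: divide_simps mult_ac)
      qed simp
      show "(\<lambda>h. \<bar>C\<bar> * D * norm h) \<midarrow>0\<rightarrow> 0"
        by (auto intro!: tendsto_eq_intros)
    qed
  qed
qed

lemma continuous_on_conv: "radon_functional T \<Longrightarrow> test_function f \<Longrightarrow> continuous_on S (conv T f)"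
  by (meson continuous_at_imp_continuous_on has_derivative_continuous conv_has_derivative)

lemma continuous_on_conv_grad:
  assumes T: "radon_functional T" and f: "test_function f"
  shows "continuous_on S (conv_grad T f)"
proof -
  have "continuous_on S (\<lambda>x. T (\<lambda>y. frechet_derivative f (at (x - y)) b))" for b
    using continuous_on_conv[OF T test_function_frechet_derivative[OF f, of b]] by (simp add: conv_def[abs_def])
  then show ?thesis unfolding conv_grad_def[abs_def] by (intro continuous_intros)
qed

text \<open>
  On a grid, the sum of \<open>\<bar>T * \<rho>\<bar>\<close> is \<open>T\<close> applied to a signed sum of translates of \<open>\<rho>\<close>, which is bounded by
  the reciprocal of the cell volume.
\<close>

lemma nn_integral_conv_mollifier_le:
  assumes T: "radon_functional T" and e: "e > 0" and M: "M \<ge> 0"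
    and bound: "\<And>f B. test_function f \<Longrightarrow> (\<And>x. \<bar>f x\<bar> \<le> B) \<Longrightarrow> \<bar>T f\<bar> \<le> M * B"
  shows "(\<integral>\<^sup>+x. ennreal \<bar>conv T (mollifier e) x\<bar> \<partial>lborel) \<le> ennreal M"
proof (rule nn_integral_le_grid_sums[OF e _ M])
  show "(\<lambda>x. ennreal \<bar>conv T (mollifier e) x\<bar>) \<in> borel_measurable borel"
    using borel_measurable_continuous_onI[OF continuous_on_conv[OF T test_function_mollifier[OF e]]] by simp
  fix n and x :: 'a
  let ?I = "grid_indices n :: ('a \<Rightarrow> int) set"
  let ?r = "\<lambda>k y. mollifier e (x + grid_point e k - y)"
  define c where "c = (\<lambda>k. sgn (conv T (mollifier e) (x + grid_point e k)))"
  have t: "test_function (?r k)" for k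
    by (rule test_function_reflect[OF test_function_mollifier[OF e]])
  have "(\<Sum>k\<in>?I. \<bar>conv T (mollifier e) (x + grid_point e k)\<bar>) = (\<Sum>k\<in>?I. c k * T (?r k))"
    unfolding c_def by (simp add: conv_def abs_sgn mult.commute)
  also have "\<dots> = T (\<lambda>y. \<Sum>k\<in>?I. c k * ?r k y)"
    by (rule radon_functional_sum[OF T t, symmetric])
  also have "\<dots> \<le> M * (1 / e ^ DIM('a))"
  proof (rule order_trans[OF abs_ge_self bound])
    show "test_function (\<lambda>y. \<Sum>k\<in>?I. c k * ?r k y)"
      by (intro test_function_sum test_function_mult_left t)
    fix y
    have "\<bar>\<Sum>k\<in>?I. c k * ?r k y\<bar> \<le> (\<Sum>k\<in>?I. \<bar>c k * ?r k y\<bar>)" by (rule sum_abs)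
    also have "\<dots> \<le> (\<Sum>k\<in>?I. mollifier e ((x - y) + grid_point e k))"
      using mollifier_nonneg[OF e]
      by (intro sum_mono) (auto simp: c_def abs_mult sgn_if algebra_simps)
    also have "\<dots> \<le> 1 / e ^ DIM('a)" by (rule sum_mollifier_grid_le[OF e])
    finally show "\<bar>\<Sum>k\<in>?I. c k * ?r k y\<bar> \<le> 1 / e ^ DIM('a)" .
  qed
  finally show "(\<Sum>k\<in>?I. ennreal \<bar>conv T (mollifier e) (x + grid_point e k)\<bar>) \<le> ennreal (M / e ^ DIM('a))"
    by (subst sum_ennreal) (auto intro: ennreal_leI)
qed

lemma divergence_reflected_sum:
  fixes f :: "'a::euclidean_space \<Rightarrow> real"
  assumes "smooth f"
  shows "divergence (\<lambda>y. \<Sum>i\<in>I. f (p i - y) *\<^sub>R v i) y = - (\<Sum>i\<in>I. frechet_derivative f (at (p i - y)) (v i))"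
proof -
  have D: "((\<lambda>y. \<Sum>i\<in>I. f (p i - y) *\<^sub>R v i) has_derivative
      (\<lambda>h. \<Sum>i\<in>I. frechet_derivative f (at (p i - y)) (- h) *\<^sub>R v i)) (at y)"
  proof (rule has_derivative_sum)
    fix i
    have "((\<lambda>y. p i - y) has_derivative (\<lambda>h. - h)) (at y)"
      by (auto intro!: derivative_eq_intros)
    from has_derivative_compose[OF this smooth_has_derivative[OF assms]]
    show "((\<lambda>y. f (p i - y) *\<^sub>R v i) has_derivative (\<lambda>h. frechet_derivative f (at (p i - y)) (- h) *\<^sub>R v i)) (at y)"
      by (rule has_derivative_scaleR_left)
  qed
  have l: "frechet_derivative f (at z) (- h) = - frechet_derivative f (at z) h" for z h
    using smooth_has_derivative[OF assms] has_derivative_linear linear_uminus by (metis linear_neg)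
  have "divergence (\<lambda>y. \<Sum>i\<in>I. f (p i - y) *\<^sub>R v i) y
    = (\<Sum>b\<in>Basis. (\<Sum>i\<in>I. - (frechet_derivative f (at (p i - y)) b * (v i \<bullet> b))))"
    unfolding divergence_def frechet_derivative_at[OF D, symmetric] by (simp add: inner_sum_left l)
  also have "\<dots> = (\<Sum>i\<in>I. - (\<Sum>b\<in>Basis. (v i \<bullet> b) *\<^sub>R frechet_derivative f (at (p i - y)) b))"
    by (subst sum.swap) (simp add: sum_negf mult.commute)
  also have "\<dots> = - (\<Sum>i\<in>I. frechet_derivative f (at (p i - y)) (v i))"
    by (simp add: frechet_derivative_expand[OF assms, of _ "v _"] sum_negf)
  finally show ?thesis .
qed

text \<open>
  The vectorial analogue: the signs become the directions \<open>v\<close> of the gradients at the grid points, and the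
  derivatives of \<open>\<rho>\<close> along them combine to the divergence of a vector field of controlled length. Hence
  the total variation does not increase under mollification.
\<close>

lemma nn_integral_conv_grad_mollifier_le:
  assumes T: "radon_functional T" and e: "e > 0" and M: "M \<ge> 0"
    and bound: "\<And>X B. test_function X \<Longrightarrow> (\<And>x. norm (X x) \<le> B) \<Longrightarrow> \<bar>T (divergence X)\<bar> \<le> M * B"
  shows "(\<integral>\<^sup>+x. ennreal (norm (conv_grad T (mollifier e) x)) \<partial>lborel) \<le> ennreal M"
proof (rule nn_integral_le_grid_sums[OF e _ M])
  let ?\<rho> = "mollifier e :: 'a \<Rightarrow> real"
  note t\<rho> = test_function_mollifier[OF e, where 'a='a]
  have sm: "smooth ?\<rho>" using t\<rho> by (simp add: test_function_def)
  show "(\<lambda>x. ennreal (norm (conv_grad T ?\<rho> x))) \<in> borel_measurable borel"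
    using borel_measurable_continuous_onI[OF continuous_on_conv_grad[OF T t\<rho>]] by simp
  fix n and x :: 'a
  let ?I = "grid_indices n :: ('a \<Rightarrow> int) set"
  let ?p = "\<lambda>k. x + grid_point e k"
  define v where "v = (\<lambda>k. sgn (conv_grad T ?\<rho> (?p k)))"
  define X where "X = (\<lambda>y. \<Sum>k\<in>?I. ?\<rho> (?p k - y) *\<^sub>R v k)"
  have t: "test_function (\<lambda>y. frechet_derivative ?\<rho> (at (?p k - y)) (v k))" for k
    by (rule test_function_reflect[OF test_function_frechet_derivative[OF t\<rho>]])
  have tX: "test_function X"
    unfolding X_def by (intro test_function_sum test_function_scaleR_vector test_function_reflect t\<rho>)
  have divX: "divergence X = (\<lambda>y. \<Sum>k\<in>?I. (-1) * frechet_derivative ?\<rho> (at (?p k - y)) (v k))"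
    unfolding X_def divergence_reflected_sum[OF sm] by (simp add: sum_negf)
  have "norm w = w \<bullet> sgn w" for w :: 'a
    by (cases "w = 0") (auto simp: sgn_div_norm dot_square_norm power2_eq_square)
  then have "(\<Sum>k\<in>?I. norm (conv_grad T ?\<rho> (?p k))) = (\<Sum>k\<in>?I. conv_grad T ?\<rho> (?p k) \<bullet> v k)"
    unfolding v_def by simp
  also have "\<dots> = - (\<Sum>k\<in>?I. (-1) * T (\<lambda>y. frechet_derivative ?\<rho> (at (?p k - y)) (v k)))"
    by (simp add: conv_grad_inner[OF T t\<rho>] sum_negf)
  also have "\<dots> = - T (divergence X)"
    unfolding divX by (subst radon_functional_sum[OF T t, symmetric]) (rule refl)
  also have "\<dots> \<le> M * (1 / e ^ DIM('a))"
  proof (rule order_trans[OF abs_ge_minus_self bound[OF tX]])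
    fix y
    have "norm (X y) \<le> (\<Sum>k\<in>?I. norm (?\<rho> (?p k - y) *\<^sub>R v k))"
      unfolding X_def by (rule norm_sum)
    also have "\<dots> \<le> (\<Sum>k\<in>?I. ?\<rho> ((x - y) + grid_point e k))"
      using mollifier_nonneg[OF e]
      by (intro sum_mono) (auto simp: v_def norm_sgn algebra_simps)
    also have "\<dots> \<le> 1 / e ^ DIM('a)" by (rule sum_mollifier_grid_le[OF e])
    finally show "norm (X y) \<le> 1 / e ^ DIM('a)" .
  qed
  finally show "(\<Sum>k\<in>?I. ennreal (norm (conv_grad T ?\<rho> (?p k)))) \<le> ennreal (M / e ^ DIM('a))"
    by (subst sum_ennreal) (auto intro: ennreal_leI)
qed

section \<open>Translates of sets of finite perimeter\<close>

definition shift_diff :: "'a::euclidean_space set \<Rightarrow> 'a \<Rightarrow> 'a set" where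
  "shift_diff A z = {x. (x \<in> A) \<noteq> (x - z \<in> A)}"

lemma borel_translate [measurable]:
  fixes A :: "'a::euclidean_space set"
  assumes "A \<in> sets borel"
  shows "{x. x - z \<in> A} \<in> sets borel"
  using measurable_sets_borel[of "\<lambda>x. x - z" borel A] assms by (simp add: vimage_def)

lemma borel_shift_diff [measurable]: "A \<in> sets borel \<Longrightarrow> shift_diff A z \<in> sets borel"
proof -
  assume A: "A \<in> sets borel"
  have "shift_diff A z = sym_diff A {x. x - z \<in> A}" by (auto simp: shift_diff_def)
  then show ?thesis using A borel_translate[OF A] by simp
qed

lemma emeasure_lborel_translate:
  fixes A :: "'a::euclidean_space set"
  assumes "A \<in> sets borel"
  shows "emeasure lborel {x. x - z \<in> A} = emeasure lborel A"
proof -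
  have "emeasure (distr lborel borel ((+) (- z))) A = emeasure lborel ((+) (- z) -` A \<inter> space lborel)"
    using assms by (intro emeasure_distr) auto
  then show ?thesis by (simp add: lborel_distr_plus vimage_def)
qed

lemma norm_le_of_mem_mollifier_support:
  fixes z :: "'a::euclidean_space"
  assumes "z \<in> cbox 0 ((2 * e) *\<^sub>R One)"
  shows "norm z \<le> 2 * e * real DIM('a)"
proof -
  have "norm z \<le> (\<Sum>b\<in>Basis. \<bar>z \<bullet> b\<bar>)" by (rule norm_le_l1)
  also have "\<dots> \<le> (\<Sum>b\<in>(Basis::'a set). 2 * e)"
    using assms by (intro sum_mono) (auto simp: mem_box)
  finally show ?thesis by (simp add: mult.commute)
qed

text \<open>
  Squeeze \<open>A\<close> between a compact and an open set of nearly the same measure. A small translation keeps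
  the compact set inside the open one.
\<close>

lemma shift_diff_small:
  fixes A :: "'a::euclidean_space set"
  assumes A: "A \<in> sets borel" and "bounded A" and e: "e > 0"
  obtains d where "d > 0" "\<And>z. norm z < d \<Longrightarrow> emeasure lborel (shift_diff A z) \<le> ennreal e"
proof -
  have Al: "A \<in> sets lebesgue" using A by simp
  obtain U where U: "open U" "A \<subseteq> U" "emeasure lebesgue (U - A) < ennreal (e / 4)"
    using sets_lebesgue_outer_open[OF Al, of "e / 4"] e by (metis divide_pos_pos zero_less_numeral)
  obtain C where C: "closed C" "C \<subseteq> A" "emeasure lebesgue (A - C) < ennreal (e / 4)"
    using sets_lebesgue_inner_closed[OF Al, of "e / 4"] e by (metis divide_pos_pos zero_less_numeral)
  have bU[measurable]: "U - A \<in> sets borel" and bC[measurable]: "A - C \<in> sets borel" using U C A by auto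
  have "compact C" using C(1,2) \<open>bounded A\<close> bounded_subset compact_eq_bounded_closed by blast
  then obtain d where d: "d > 0" "(\<Union>x\<in>C. cball x d) \<subseteq> U"
    using compact_subset_open_imp_cball_epsilon_subset[of C U] U C by auto
  show thesis
  proof (rule that[OF d(1)])
    fix z :: 'a assume z: "norm z < d"
    have CU: "x + y \<in> U" if "x \<in> C" "norm y = norm z" for x y
    proof -
      have "x + y \<in> cball x d" using that z by (simp add: dist_norm)
      then show ?thesis using d(2) that by blast
    qed
    have "shift_diff A z \<subseteq> ((A - C) \<union> {x. x - z \<in> A - C}) \<union> ((U - A) \<union> {x. x - z \<in> U - A})"
    proof
      fix x assume "x \<in> shift_diff A z"
      then consider "x \<in> A" "x - z \<notin> A" | "x \<notin> A" "x - z \<in> A" by (auto simp: shift_diff_def)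
      then show "x \<in> ((A - C) \<union> {x. x - z \<in> A - C}) \<union> ((U - A) \<union> {x. x - z \<in> U - A})"
        using CU[of x "- z"] CU[of "x - z" z] by cases auto
    qed
    then have "emeasure lborel (shift_diff A z) \<le>
        emeasure lborel (((A - C) \<union> {x. x - z \<in> A - C}) \<union> ((U - A) \<union> {x. x - z \<in> U - A}))"
      using borel_translate[OF bU] borel_translate[OF bC] bU bC by (intro emeasure_mono) auto
    also have "\<dots> \<le> (emeasure lborel (A - C) + emeasure lborel {x. x - z \<in> A - C}) +
        (emeasure lborel (U - A) + emeasure lborel {x. x - z \<in> U - A})"
      using borel_translate[OF bU] borel_translate[OF bC] bU bC
      by (intro order_trans[OF emeasure_subadditive] add_mono emeasure_subadditive) auto
    also have "\<dots> = (emeasure lborel (A - C) + emeasure lborel (A - C)) + (emeasure lborel (U - A) + emeasure lborel (U - A))"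
      by (simp only: emeasure_lborel_translate[OF bU] emeasure_lborel_translate[OF bC])
    also have "\<dots> \<le> (ennreal (e / 4) + ennreal (e / 4)) + (ennreal (e / 4) + ennreal (e / 4))"
      using U(3) C(3) bU bC by (intro add_mono) (auto intro: less_imp_le)
    also have "\<dots> = ennreal e"
      using e by (simp add: ennreal_plus[symmetric] del: ennreal_plus)
    finally show "emeasure lborel (shift_diff A z) \<le> ennreal e" .
  qed
qed

lemma shift_diff_locally_small:
  fixes \<Omega> :: "'a::euclidean_space set"
  assumes \<Omega>: "\<Omega> \<in> sets borel" and e: "e > 0"
  obtains d where "d > 0" "\<And>z. norm z < d \<Longrightarrow> emeasure lborel (cball 0 R \<inter> shift_diff \<Omega> z) \<le> ennreal e"
proof -
  have b: "\<Omega> \<inter> cball 0 (R + 1) \<in> sets borel" "bounded (\<Omega> \<inter> cball 0 (R + 1))"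
    using \<Omega> by (auto intro: bounded_Int)
  then obtain d where d: "d > 0" "\<And>z. norm z < d \<Longrightarrow> emeasure lborel (shift_diff (\<Omega> \<inter> cball 0 (R + 1)) z) \<le> ennreal e"
    using shift_diff_small[OF b e] by blast
  show thesis
  proof (rule that[of "min d 1"])
    fix z :: 'a assume z: "norm z < min d 1"
    have "cball 0 R \<inter> shift_diff \<Omega> z \<subseteq> shift_diff (\<Omega> \<inter> cball 0 (R + 1)) z"
    proof
      fix x assume x: "x \<in> cball 0 R \<inter> shift_diff \<Omega> z"
      then have "norm (x - z) \<le> R + 1" using z norm_triangle_ineq4[of x z] by auto
      then show "x \<in> shift_diff (\<Omega> \<inter> cball 0 (R + 1)) z" using x by (auto simp: shift_diff_def)
    qed
    then have "emeasure lborel (cball 0 R \<inter> shift_diff \<Omega> z) \<le> emeasure lborel (shift_diff (\<Omega> \<inter> cball 0 (R + 1)) z)"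
      using borel_shift_diff[OF b(1)] by (intro emeasure_mono) auto
    also have "\<dots> \<le> ennreal e" using d z by auto
    finally show "emeasure lborel (cball 0 R \<inter> shift_diff \<Omega> z) \<le> ennreal e" .
  qed (use d in auto)
qed

lemma set_integrable_test_function:
  fixes f :: "'a::euclidean_space \<Rightarrow> real"
  assumes "E \<in> sets lebesgue" "test_function f"
  shows "set_integrable lebesgue E f"
proof -
  have "integrable lborel f"
    using assms(2) unfolding test_function_def
    by (auto intro: integrable_continuous_compact_support smooth_continuous_on)
  then have "integrable lebesgue f" 
    using integrable_completion[of f lborel] borel_measurable_integrable by blast
  then show ?thesis unfolding set_integrable_def using assms(1) integrable_mult_indicator by blast
qed

lemma abs_set_integral_le:
  fixes f :: "'a::euclidean_space \<Rightarrow> real"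
  assumes E: "E \<in> sets lebesgue" and f: "test_function f" and K: "compact K" "\<And>x. x \<notin> K \<Longrightarrow> f x = 0"
    and B: "\<And>x. \<bar>f x\<bar> \<le> B"
  shows "\<bar>set_lebesgue_integral lebesgue E f\<bar> \<le> measure lborel K * B"
proof -
  have "\<bar>set_lebesgue_integral lebesgue E f\<bar> \<le> (LINT x|lebesgue. \<bar>indicator E x *\<^sub>R f x\<bar>)"
    unfolding set_lebesgue_integral_def by (rule integral_abs_bound)
  also have "\<dots> \<le> (LINT x|lebesgue. indicator K x * B)"
  proof (rule integral_mono)
    show "integrable lebesgue (\<lambda>x. \<bar>indicator E x *\<^sub>R f x\<bar>)"
      using set_integrable_test_function[OF E f] unfolding set_integrable_def by (rule integrable_abs)
    show "integrable lebesgue (\<lambda>x. indicator K x * B)"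
      using K emeasure_bounded_finite[OF compact_imp_bounded[OF K(1)]]
      by (intro integrable_mult_left integrable_real_indicator) (auto simp: compact_imp_closed)
    have "0 \<le> B" using B[of undefined] by linarith
    then show "\<bar>indicator E x *\<^sub>R f x\<bar> \<le> indicator K x * B" for x
      using K(2)[of x] B[of x] by (cases "x \<in> K") (auto simp: indicator_def)
  qed
  also have "\<dots> = measure lborel K * B" using K by (simp add: compact_imp_closed)
  finally show ?thesis .
qed

definition set_functional :: "'a::euclidean_space set \<Rightarrow> ('a \<Rightarrow> real) \<Rightarrow> real" where
  "set_functional \<Omega> f = (LINT y|lborel. indicator \<Omega> y * f y)"

lemma integrable_indicator_test_function:
  fixes f :: "'a::euclidean_space \<Rightarrow> real"
  assumes "\<Omega> \<in> sets borel" "test_function f"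
  shows "integrable lborel (\<lambda>y. indicator \<Omega> y * f y)"
proof -
  have "integrable lborel f"
    using assms(2) unfolding test_function_def
    by (auto intro: integrable_continuous_compact_support smooth_continuous_on)
  then show ?thesis using assms(1) integrable_real_mult_indicator[of \<Omega> lborel f] by (simp add: mult.commute)
qed

lemma radon_functional_set_functional:
  fixes \<Omega> :: "'a::euclidean_space set"
  assumes \<Omega>: "\<Omega> \<in> sets borel"
  shows "radon_functional (set_functional \<Omega>)"
  unfolding radon_functional_def
proof (intro conjI allI impI)
  fix f g :: "'a \<Rightarrow> real" assume "test_function f" "test_function g"
  then show "set_functional \<Omega> (\<lambda>x. f x + g x) = set_functional \<Omega> f + set_functional \<Omega> g"
    unfolding set_functional_def distrib_left
    by (intro Bochner_Integration.integral_add integrable_indicator_test_function \<Omega>)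
next
  fix c and f :: "'a \<Rightarrow> real"
  show "set_functional \<Omega> (\<lambda>x. c * f x) = c * set_functional \<Omega> f"
    unfolding set_functional_def by (simp add: mult.left_commute)
next
  fix K :: "'a set" assume K: "compact K"
  show "\<exists>C. \<forall>f B. test_function f \<longrightarrow> (\<forall>x. x \<notin> K \<longrightarrow> f x = 0) \<longrightarrow>
        (\<forall>x. \<bar>f x\<bar> \<le> B) \<longrightarrow> \<bar>set_functional \<Omega> f\<bar> \<le> C * B"
  proof (intro exI[of _ "measure lborel K"] allI impI)
    fix f :: "'a \<Rightarrow> real" and B
    assume f: "test_function f" "\<forall>x. x \<notin> K \<longrightarrow> f x = 0" "\<forall>x. \<bar>f x\<bar> \<le> B"
    then have "f \<in> borel_measurable borel"
      by (auto simp: test_function_def intro: borel_measurable_continuous_onI smooth_continuous_on)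
    then show "\<bar>set_functional \<Omega> f\<bar> \<le> measure lborel K * B"
      using abs_set_integral_le[OF _ f(1) K, where E=\<Omega> and B=B] f \<Omega> set_integral_lebesgue_eq[OF \<Omega>, of f]
      by (simp add: set_functional_def)
  qed
qed

lemma integral_lborel_reflect:
  fixes f :: "'a::euclidean_space \<Rightarrow> real"
  assumes "f \<in> borel_measurable borel"
  shows "(LINT y|lborel. f (x - y)) = (LINT y|lborel. f y)"
proof -
  have "lborel = distr lborel borel (\<lambda>y. x - y)"
    using lborel_affine[of "-1" x] by (simp add: density_1)
  then have "(LINT y|lborel. f y) = (LINT y|distr lborel borel (\<lambda>y. x - y). f y)" by simp
  also have "\<dots> = (LINT y|lborel. f (x - y))" using assms by (intro integral_distr) auto
  finally show ?thesis by simp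
qed

text \<open>
  The mollified indicator at \<open>x\<close> averages the indicator at the points \<open>x - z\<close>, so it misses the indicator
  at \<open>x\<close> by at most the average of the indicators of \<open>shift_diff \<Omega> z\<close>.
\<close>

lemma nn_integral_mollified_set_diff_le:
  fixes \<Omega> K :: "'a::euclidean_space set"
  assumes \<Omega>[measurable]: "\<Omega> \<in> sets borel" and K[measurable]: "K \<in> sets borel" and e: "e > 0"
    and B: "\<And>z. z \<in> cbox 0 ((2 * e) *\<^sub>R One) \<Longrightarrow> emeasure lborel (K \<inter> shift_diff \<Omega> z) \<le> B"
  shows "(\<integral>\<^sup>+x. ennreal \<bar>conv (set_functional \<Omega>) (mollifier e) x - indicator \<Omega> x\<bar> * indicator K x \<partial>lborel) \<le> B"
proof -
  let ?\<rho> = "mollifier e :: 'a \<Rightarrow> real"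
  let ?w = "conv (set_functional \<Omega>) ?\<rho>"
  note t = test_function_mollifier[OF e, where 'a='a]
  have [measurable]: "?\<rho> \<in> borel_measurable borel"
    using t by (auto simp: test_function_def intro!: borel_measurable_continuous_onI smooth_continuous_on)
  have pt: "ennreal \<bar>?w x - indicator \<Omega> x\<bar> \<le> (\<integral>\<^sup>+z. ennreal (?\<rho> z) * indicator (shift_diff \<Omega> z) x \<partial>lborel)" for x
  proof -
    have "?w x = (LINT z|lborel. indicator \<Omega> (x - z) * ?\<rho> z)"
      unfolding conv_def set_functional_def
      using integral_lborel_reflect[of "\<lambda>z. indicator \<Omega> (x - z) * ?\<rho> z" x] by simp
    moreover have "indicator \<Omega> x = (LINT z|lborel. indicator \<Omega> x * ?\<rho> z)"
    proof -
      have "(LINT z|lborel. ?\<rho> z) = 1"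
        using nn_integral_mollifier[OF e, where 'a='a] mollifier_nonneg[OF e, where 'a='a]
        by (subst integral_eq_nn_integral) auto
      then show ?thesis by simp
    qed
    moreover have i: "integrable lborel (\<lambda>z. indicator \<Omega> (x - z) * ?\<rho> z)"
      using integrable_real_mult_indicator[of "{z. x - z \<in> \<Omega>}" lborel ?\<rho>] integrable_mollifier[OF e, where 'a='a]
        measurable_sets_borel[of "\<lambda>z. x - z" borel \<Omega>]
      by (simp add: vimage_def indicator_def mult.commute)
    ultimately have "?w x - indicator \<Omega> x = (LINT z|lborel. indicator \<Omega> (x - z) * ?\<rho> z - indicator \<Omega> x * ?\<rho> z)"
      using integrable_mollifier[OF e, where 'a='a] by simp
    then have "ennreal \<bar>?w x - indicator \<Omega> x\<bar> \<le> (\<integral>\<^sup>+z. ennreal (norm (indicator \<Omega> (x - z) * ?\<rho> z - indicator \<Omega> x * ?\<rho> z)) \<partial>lborel)"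
      using integral_norm_bound_ennreal[of lborel "\<lambda>z. indicator \<Omega> (x - z) * ?\<rho> z - indicator \<Omega> x * ?\<rho> z"]
        i integrable_mollifier[OF e, where 'a='a] by simp
    also have "\<dots> = (\<integral>\<^sup>+z. ennreal (?\<rho> z) * indicator (shift_diff \<Omega> z) x \<partial>lborel)"
      using mollifier_nonneg[OF e, where 'a='a]
      by (intro nn_integral_cong) (auto simp: indicator_def shift_diff_def)
    finally show ?thesis .
  qed
  have m: "(\<lambda>(z, x). ennreal (?\<rho> z) * (indicator (shift_diff \<Omega> z) x * indicator K x)) \<in> borel_measurable (lborel \<Otimes>\<^sub>M lborel)"
  proof -
    have "(\<lambda>(z, x). ennreal (?\<rho> z) * (indicator (shift_diff \<Omega> z) x * indicator K x)) =
       (\<lambda>(z, x). ennreal (?\<rho> z) * ((indicator \<Omega> x * (1 - indicator \<Omega> (x - z)) + (1 - indicator \<Omega> x) * indicator \<Omega> (x - z)) * indicator K x))"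
      by (auto simp: fun_eq_iff indicator_def shift_diff_def)
    also have "\<dots> \<in> borel_measurable (lborel \<Otimes>\<^sub>M lborel)" by measurable
    finally show ?thesis .
  qed
  have "(\<integral>\<^sup>+x. ennreal \<bar>?w x - indicator \<Omega> x\<bar> * indicator K x \<partial>lborel)
      \<le> (\<integral>\<^sup>+x. (\<integral>\<^sup>+z. ennreal (?\<rho> z) * indicator (shift_diff \<Omega> z) x \<partial>lborel) * indicator K x \<partial>lborel)"
    by (intro nn_integral_mono mult_right_mono pt) auto
  also have "\<dots> \<le> (\<integral>\<^sup>+x. (\<integral>\<^sup>+z. ennreal (?\<rho> z) * (indicator (shift_diff \<Omega> z) x * indicator K x) \<partial>lborel) \<partial>lborel)"
    by (intro nn_integral_mono) (auto simp: indicator_def)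
  also have "\<dots> = (\<integral>\<^sup>+z. (\<integral>\<^sup>+x. ennreal (?\<rho> z) * (indicator (shift_diff \<Omega> z) x * indicator K x) \<partial>lborel) \<partial>lborel)"
    by (rule lborel_pair.Fubini'[OF m])
  also have "\<dots> = (\<integral>\<^sup>+z. ennreal (?\<rho> z) * emeasure lborel (K \<inter> shift_diff \<Omega> z) \<partial>lborel)"
  proof (intro nn_integral_cong)
    fix z
    have "(\<integral>\<^sup>+x. ennreal (?\<rho> z) * (indicator (shift_diff \<Omega> z) x * indicator K x) \<partial>lborel)
      = (\<integral>\<^sup>+x. ennreal (?\<rho> z) * indicator (K \<inter> shift_diff \<Omega> z) x \<partial>lborel)"
      by (intro nn_integral_cong) (auto simp: indicator_def)
    then show "(\<integral>\<^sup>+x. ennreal (?\<rho> z) * (indicator (shift_diff \<Omega> z) x * indicator K x) \<partial>lborel)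
      = ennreal (?\<rho> z) * emeasure lborel (K \<inter> shift_diff \<Omega> z)"
      using borel_shift_diff[OF \<Omega>, of z] K by (simp add: nn_integral_cmult_indicator)
  qed
  also have "\<dots> \<le> (\<integral>\<^sup>+z. ennreal (?\<rho> z) * B \<partial>lborel)"
  proof (intro nn_integral_mono)
    fix z
    show "ennreal (?\<rho> z) * emeasure lborel (K \<inter> shift_diff \<Omega> z) \<le> ennreal (?\<rho> z) * B"
      using mollifier_eq_0[OF e, of z] B[of z] by (cases "z \<in> cbox 0 ((2 * e) *\<^sub>R One)") (auto intro: mult_left_mono)
  qed
  also have "\<dots> = B" using nn_integral_mollifier[OF e, where 'a='a] by (simp add: nn_integral_multc)
  finally show ?thesis .
qed

lemma nn_integral_shift_le_gradient:
  fixes w :: "'a::euclidean_space \<Rightarrow> real"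
  assumes D: "\<And>x. (w has_derivative (\<lambda>h. g x \<bullet> h)) (at x)" and cont: "continuous_on UNIV g"
  shows "(\<integral>\<^sup>+x. ennreal \<bar>w x - w (x - h)\<bar> \<partial>lborel) \<le> ennreal (norm h) * (\<integral>\<^sup>+x. ennreal (norm (g x)) \<partial>lborel)"
proof -
  have gm[measurable]: "g \<in> borel_measurable borel" using cont by (simp add: borel_measurable_continuous_onI)
  have pt: "ennreal \<bar>w x - w (x - h)\<bar> \<le> (\<integral>\<^sup>+t. ennreal (norm h * norm (g (x - h + t *\<^sub>R h))) * indicator {0..1} t \<partial>lborel)" for x
  proof -
    have dw: "((\<lambda>t. w (x - h + t *\<^sub>R h)) has_real_derivative g (x - h + t *\<^sub>R h) \<bullet> h) (at t)" for t
    proof -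
      have "((\<lambda>t. x - h + t *\<^sub>R h) has_derivative (\<lambda>s. s *\<^sub>R h)) (at t)"
        by (auto intro!: derivative_eq_intros)
      from has_derivative_compose[OF this D] show ?thesis
        unfolding has_field_derivative_def by (rule has_derivative_eq_rhs) (simp add: fun_eq_iff)
    qed
    have c: "continuous_on S (\<lambda>t. g (x - h + t *\<^sub>R h) \<bullet> h)" for S
      by (intro continuous_intros continuous_on_compose2[OF cont]) auto
    have "(LINT t|lborel. (g (x - h + t *\<^sub>R h) \<bullet> h) * indicator {0..1} t) = w (x - h + 1 *\<^sub>R h) - w (x - h + 0 *\<^sub>R h)"
      by (rule integral_FTC_Icc_real) (use dw c[of UNIV] in \<open>auto simp: continuous_on_eq_continuous_at\<close>)
    moreover have "integrable lborel (\<lambda>t. (g (x - h + t *\<^sub>R h) \<bullet> h) * indicator {0..1} t)"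
      using borel_integrable_compact[OF compact_Icc c[of "{0..1}"]] by (simp add: mult.commute)
    ultimately have "ennreal \<bar>w x - w (x - h)\<bar> \<le> (\<integral>\<^sup>+t. ennreal (norm ((g (x - h + t *\<^sub>R h) \<bullet> h) * indicator {0..1} t)) \<partial>lborel)"
      using integral_norm_bound_ennreal[of lborel "\<lambda>t. (g (x - h + t *\<^sub>R h) \<bullet> h) * indicator {0..1} t"] by simp
    also have "\<dots> \<le> (\<integral>\<^sup>+t. ennreal (norm h * norm (g (x - h + t *\<^sub>R h))) * indicator {0..1} t \<partial>lborel)"
    proof (intro nn_integral_mono)
      fix t :: real
      show "ennreal (norm ((g (x - h + t *\<^sub>R h) \<bullet> h) * indicator {0..1} t))
          \<le> ennreal (norm h * norm (g (x - h + t *\<^sub>R h))) * indicator {0..1} t"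
        using Cauchy_Schwarz_ineq2[of "g (x - h + t *\<^sub>R h)" h]
        by (auto simp: indicator_def mult.commute[of "norm h"] intro!: ennreal_leI)
    qed
    finally show ?thesis .
  qed
  have "(\<integral>\<^sup>+x. ennreal \<bar>w x - w (x - h)\<bar> \<partial>lborel)
      \<le> (\<integral>\<^sup>+x. (\<integral>\<^sup>+t. ennreal (norm h * norm (g (x - h + t *\<^sub>R h))) * indicator {0..1} t \<partial>lborel) \<partial>lborel)"
    by (intro nn_integral_mono pt)
  also have "\<dots> = (\<integral>\<^sup>+t. (\<integral>\<^sup>+x. ennreal (norm h * norm (g (x - h + t *\<^sub>R h))) * indicator {0..1} t \<partial>lborel) \<partial>lborel)"
    by (intro lborel_pair.Fubini') measurable
  also have "\<dots> = (\<integral>\<^sup>+t. ennreal (norm h) * (\<integral>\<^sup>+x. ennreal (norm (g x)) \<partial>lborel) * indicator {0..1::real} t \<partial>lborel)"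
  proof (intro nn_integral_cong)
    fix t :: real
    have "(\<integral>\<^sup>+x. ennreal (norm (g (x - h + t *\<^sub>R h))) \<partial>lborel) = (\<integral>\<^sup>+x. ennreal (norm (g x)) \<partial>lborel)"
      using nn_integral_lborel_translation[of "\<lambda>x. ennreal (norm (g x))" "t *\<^sub>R h - h"] by (simp add: algebra_simps)
    then show "(\<integral>\<^sup>+x. ennreal (norm h * norm (g (x - h + t *\<^sub>R h))) * indicator {0..1} t \<partial>lborel)
      = ennreal (norm h) * (\<integral>\<^sup>+x. ennreal (norm (g x)) \<partial>lborel) * indicator {0..1::real} t"
      by (simp add: nn_integral_multc nn_integral_cmult ennreal_mult)
  qed
  also have "\<dots> = ennreal (norm h) * (\<integral>\<^sup>+x. ennreal (norm (g x)) \<partial>lborel)"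
    by (simp add: nn_integral_cmult)
  finally show ?thesis .
qed

text \<open>
  For a smooth function in place of the indicator this is the fundamental theorem of calculus on
  segments. The mollified indicators satisfy it with the constant \<open>P\<close>, and they converge in \<open>L\<^sup>1\<close> on
  bounded sets, which gives the bound on balls and then everywhere. Working on balls first takes care
  of sets like a half-line, where neither the set nor its complement has finite measure.
\<close>

lemma emeasure_shift_diff_le:
  fixes \<Omega> :: "'a::euclidean_space set"
  assumes \<Omega>[measurable]: "\<Omega> \<in> sets borel" and P: "P \<ge> 0"
    and per: "\<And>X B. test_function X \<Longrightarrow> (\<And>x. norm (X x) \<le> B) \<Longrightarrow> \<bar>set_functional \<Omega> (divergence X)\<bar> \<le> P * B"
  shows "emeasure lborel (shift_diff \<Omega> h) \<le> ennreal (norm h * P)"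
proof -
  note T = radon_functional_set_functional[OF \<Omega>]
  have loc: "emeasure lborel (cball 0 R \<inter> shift_diff \<Omega> h) \<le> ennreal (norm h * P)" for R
  proof (rule ennreal_le_epsilon)
    fix \<eta> :: real assume \<eta>: "\<eta> > 0"
    define R' where "R' = R + norm h"
    have [measurable]: "cball (0::'a) R' \<in> sets borel" by simp
    obtain d where d: "d > 0" "\<And>z. norm z < d \<Longrightarrow> emeasure lborel (cball 0 R' \<inter> shift_diff \<Omega> z) \<le> ennreal (\<eta> / 2)"
      using shift_diff_locally_small[OF \<Omega>, of "\<eta> / 2" R'] \<eta> by auto
    \<comment> \<open>Small enough for the support of the mollifier to lie in the ball of radius \<open>d\<close>.\<close>
    define e where "e = d / (4 * real DIM('a))"
    have e: "e > 0" using d by (simp add: e_def)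
    have small: "norm z < d" if "z \<in> cbox 0 ((2 * e) *\<^sub>R One)" for z :: 'a
    proof -
      have "norm z \<le> 2 * e * real DIM('a)" by (rule norm_le_of_mem_mollifier_support[OF that])
      also have "\<dots> < d" using d by (simp add: e_def)
      finally show ?thesis .
    qed
    let ?\<rho> = "mollifier e :: 'a \<Rightarrow> real"
    define w where "w = conv (set_functional \<Omega>) ?\<rho>"
    note t = test_function_mollifier[OF e, where 'a='a]
    have wm[measurable]: "w \<in> borel_measurable borel"
      unfolding w_def using continuous_on_conv[OF T t] by (rule borel_measurable_continuous_onI)
    define F where "F = (\<lambda>x. ennreal \<bar>w x - indicator \<Omega> x\<bar> * indicator (cball 0 R') x)"
    define D where "D = (\<lambda>x. ennreal \<bar>w x - w (x - h)\<bar>)"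
    have Fm[measurable]: "F \<in> borel_measurable borel" and Dm[measurable]: "D \<in> borel_measurable borel"
      unfolding F_def D_def by measurable
    have 1: "(\<integral>\<^sup>+x. F x \<partial>lborel) \<le> ennreal (\<eta> / 2)"
      unfolding F_def w_def by (rule nn_integral_mollified_set_diff_le[OF \<Omega> _ e]) (use d(2) small in auto)
    have 2: "(\<integral>\<^sup>+x. D x \<partial>lborel) \<le> ennreal (norm h) * ennreal P"
      using nn_integral_shift_le_gradient[OF conv_has_derivative[OF T t] continuous_on_conv_grad[OF T t], of h]
        nn_integral_conv_grad_mollifier_le[OF T e P per]
      unfolding D_def w_def by (meson mult_left_mono order_trans zero_le)
    have 3: "(\<integral>\<^sup>+x. F (x - h) \<partial>lborel) \<le> ennreal (\<eta> / 2)"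
      using nn_integral_lborel_translation[OF Fm, of "- h"] 1 by simp
    have "emeasure lborel (cball 0 R \<inter> shift_diff \<Omega> h) = (\<integral>\<^sup>+x. indicator (cball 0 R \<inter> shift_diff \<Omega> h) x \<partial>lborel)"
      using borel_shift_diff[OF \<Omega>] by simp
    also have "\<dots> \<le> (\<integral>\<^sup>+x. (F x + D x) + F (x - h) \<partial>lborel)"
    proof (intro nn_integral_mono)
      fix x
      show "indicator (cball 0 R \<inter> shift_diff \<Omega> h) x \<le> (F x + D x) + F (x - h)"
      proof (cases "x \<in> cball 0 R \<inter> shift_diff \<Omega> h")
        case True
        then have K: "x \<in> cball 0 R'" "x - h \<in> cball 0 R'"
          using norm_triangle_ineq4[of x h] norm_ge_zero[of h] unfolding R'_def by (auto simp del: norm_ge_zero)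
        have "1 = \<bar>indicator \<Omega> x - indicator \<Omega> (x - h) :: real\<bar>"
          using True by (auto simp: shift_diff_def indicator_def)
        then have "1 \<le> \<bar>w x - indicator \<Omega> x\<bar> + \<bar>w x - w (x - h)\<bar> + \<bar>w (x - h) - indicator \<Omega> (x - h)\<bar>"
          by linarith
        from ennreal_leI[OF this] show ?thesis using True K by (simp add: F_def D_def)
      qed simp
    qed
    also have "\<dots> = (\<integral>\<^sup>+x. F x \<partial>lborel) + (\<integral>\<^sup>+x. D x \<partial>lborel) + (\<integral>\<^sup>+x. F (x - h) \<partial>lborel)"
      by (subst nn_integral_add, simp, simp)+ (rule refl)
    also have "\<dots> \<le> ennreal (\<eta> / 2) + ennreal (norm h) * ennreal P + ennreal (\<eta> / 2)"
      by (intro add_mono 1 2 3)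
    also have "\<dots> = ennreal (norm h * P) + ennreal \<eta>"
      using \<eta> P by (simp add: ennreal_mult[symmetric] ennreal_plus[symmetric] del: ennreal_plus)
    finally show "emeasure lborel (cball 0 R \<inter> shift_diff \<Omega> h) \<le> ennreal (norm h * P) + ennreal \<eta>" .
  qed
  have "shift_diff \<Omega> h = (\<Union>n. cball 0 (real n) \<inter> shift_diff \<Omega> h)"
  proof (intro equalityI subsetI)
    fix x assume "x \<in> shift_diff \<Omega> h"
    moreover obtain n where "norm x \<le> real n" using real_arch_simple by blast
    ultimately show "x \<in> (\<Union>n. cball 0 (real n) \<inter> shift_diff \<Omega> h)" by auto
  qed simp
  then have "emeasure lborel (shift_diff \<Omega> h) = (SUP n. emeasure lborel (cball 0 (real n) \<inter> shift_diff \<Omega> h))"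
    using borel_shift_diff[OF \<Omega>]
    by (subst SUP_emeasure_incseq) (auto simp: incseq_def)
  also have "\<dots> \<le> ennreal (norm h * P)" by (intro SUP_least loc)
  finally show ?thesis .
qed

section \<open>The lower bound for functionals of order zero\<close>

text \<open>
  The analytic core. Read \<open>S\<close> as an \<open>m\<close>-current and \<open>U\<close> as \<open>[\<Omega>] - S\<close>, so that \<open>M1\<close> and \<open>M2\<close> bound the
  masses of \<open>S\<close> and of \<open>\<partial>[\<Omega>] - \<partial>S\<close>. Convolution turns \<open>U\<close> into a smooth function whose gradient has \<open>L\<^sup>1\<close>
  norm at most \<open>M2\<close>. Its distance to the indicator of \<open>\<Omega>\<close> is at most \<open>M1\<close> plus the distance between
  that indicator and its mollification, which is of order \<open>e P\<close> by \<open>emeasure_shift_diff_le\<close>. The coarea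
  inequality applies to this function, and then \<open>e\<close> tends to zero.
\<close>

theorem mollified_lower_bound:
  fixes \<Omega> :: "'a::euclidean_space set"
  assumes \<Omega>[measurable]: "\<Omega> \<in> sets borel" and P: "P \<ge> 0"
    and per: "\<And>X B. test_function X \<Longrightarrow> (\<And>x. norm (X x) \<le> B) \<Longrightarrow> \<bar>set_functional \<Omega> (divergence X)\<bar> \<le> P * B"
    and S: "radon_functional S" and M1: "M1 \<ge> 0"
      "\<And>f B. test_function f \<Longrightarrow> (\<And>x. \<bar>f x\<bar> \<le> B) \<Longrightarrow> \<bar>S f\<bar> \<le> M1 * B"
    and M2: "M2 \<ge> 0" "\<And>X B. test_function X \<Longrightarrow> (\<And>x. norm (X x) \<le> B) \<Longrightarrow>
      \<bar>set_functional \<Omega> (divergence X) - S (divergence X)\<bar> \<le> M2 * B"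
    and l: "l \<ge> 0" and c: "\<And>E. E \<in> sets borel \<Longrightarrow> c \<le> F_CE l \<Omega> E"
  shows "c \<le> ennreal l * ennreal M1 + ennreal M2"
proof -
  let ?I = "set_functional \<Omega>"
  note I = radon_functional_set_functional[OF \<Omega>]
  define U where "U = (\<lambda>f. ?I f - S f)"
  have U: "radon_functional U"
    unfolding radon_functional_def
  proof (intro conjI allI impI)
    fix f g :: "'a \<Rightarrow> real" assume "test_function f" "test_function g"
    then show "U (\<lambda>x. f x + g x) = U f + U g"
      by (simp add: U_def radon_functional_add[OF I] radon_functional_add[OF S])
  next
    fix c and f :: "'a \<Rightarrow> real" assume "test_function f"
    then show "U (\<lambda>x. c * f x) = c * U f"
      by (simp add: U_def radon_functional_mult[OF I] radon_functional_mult[OF S] algebra_simps)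
  next
    fix K :: "'a set" assume "compact K"
    then obtain C where C: "\<And>f B. test_function f \<Longrightarrow> (\<And>x. x \<notin> K \<Longrightarrow> f x = 0) \<Longrightarrow>
       (\<And>x. \<bar>f x\<bar> \<le> B) \<Longrightarrow> \<bar>?I f\<bar> \<le> C * B"
      using radon_functional_bound[OF I] by blast
    show "\<exists>C. \<forall>f B. test_function f \<longrightarrow> (\<forall>x. x \<notin> K \<longrightarrow> f x = 0) \<longrightarrow> (\<forall>x. \<bar>f x\<bar> \<le> B) \<longrightarrow> \<bar>U f\<bar> \<le> C * B"
    proof (intro exI[of _ "C + M1"] allI impI)
      fix f :: "'a \<Rightarrow> real" and B
      assume f: "test_function f" "\<forall>x. x \<notin> K \<longrightarrow> f x = 0" "\<forall>x. \<bar>f x\<bar> \<le> B"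
      have "\<bar>?I f\<bar> \<le> C * B" "\<bar>S f\<bar> \<le> M1 * B" using C M1(2) f by auto
      then show "\<bar>U f\<bar> \<le> (C + M1) * B" by (simp add: U_def algebra_simps)
    qed
  qed
  have main: "c \<le> ennreal (l * M1 + M2 + l * (2 * e * real DIM('a) * P))" if e: "e > 0" for e
  proof -
    let ?\<rho> = "mollifier e :: 'a \<Rightarrow> real"
    note t = test_function_mollifier[OF e, where 'a='a]
    have [measurable]: "conv ?I ?\<rho> \<in> borel_measurable borel" "conv S ?\<rho> \<in> borel_measurable borel"
      using continuous_on_conv[OF I t] continuous_on_conv[OF S t] by (auto intro: borel_measurable_continuous_onI)
    have w: "(\<integral>\<^sup>+x. ennreal \<bar>conv ?I ?\<rho> x - indicator \<Omega> x\<bar> \<partial>lborel) \<le> ennreal (2 * e * real DIM('a) * P)"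
    proof -
      have "(\<integral>\<^sup>+x. ennreal \<bar>conv ?I ?\<rho> x - indicator \<Omega> x\<bar> * indicator UNIV x \<partial>lborel) \<le> ennreal (2 * e * real DIM('a) * P)"
      proof (rule nn_integral_mollified_set_diff_le[OF \<Omega> _ e])
        fix z :: 'a assume z: "z \<in> cbox 0 ((2 * e) *\<^sub>R One)"
        have "norm z * P \<le> (2 * e * real DIM('a)) * P"
          using norm_le_of_mem_mollifier_support[OF z] P by (rule mult_right_mono)
        then show "emeasure lborel (UNIV \<inter> shift_diff \<Omega> z) \<le> ennreal (2 * e * real DIM('a) * P)"
          using emeasure_shift_diff_le[OF \<Omega> P per, of z] by (auto intro: order_trans ennreal_leI)
      qed simp
      then show ?thesis by simp
    qed
    have u: "conv U ?\<rho> x = conv ?I ?\<rho> x - conv S ?\<rho> x" for x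
      by (simp add: conv_def U_def)
    have "c \<le> (\<integral>\<^sup>+x. ennreal (norm (conv_grad U ?\<rho> x)) \<partial>lborel) +
        ennreal l * (\<integral>\<^sup>+x. ennreal \<bar>conv U ?\<rho> x - indicator \<Omega> x\<bar> \<partial>lborel)"
      by (rule coarea_lower_bound[OF conv_has_derivative[OF U t] continuous_on_conv_grad[OF U t] \<Omega> c])
    also have "\<dots> \<le> ennreal M2 + ennreal l * (ennreal (2 * e * real DIM('a) * P) + ennreal M1)"
    proof (intro add_mono mult_left_mono)
      show "(\<integral>\<^sup>+x. ennreal (norm (conv_grad U ?\<rho> x)) \<partial>lborel) \<le> ennreal M2"
        by (rule nn_integral_conv_grad_mollifier_le[OF U e M2(1)]) (use M2(2) in \<open>auto simp: U_def\<close>)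
      have "(\<integral>\<^sup>+x. ennreal \<bar>conv U ?\<rho> x - indicator \<Omega> x\<bar> \<partial>lborel) \<le>
        (\<integral>\<^sup>+x. ennreal \<bar>conv ?I ?\<rho> x - indicator \<Omega> x\<bar> + ennreal \<bar>conv S ?\<rho> x\<bar> \<partial>lborel)"
        by (intro nn_integral_mono) (auto simp: u ennreal_plus[symmetric] simp del: ennreal_plus intro!: ennreal_leI)
      also have "\<dots> = (\<integral>\<^sup>+x. ennreal \<bar>conv ?I ?\<rho> x - indicator \<Omega> x\<bar> \<partial>lborel) + (\<integral>\<^sup>+x. ennreal \<bar>conv S ?\<rho> x\<bar> \<partial>lborel)"
        by (rule nn_integral_add) auto
      also have "\<dots> \<le> ennreal (2 * e * real DIM('a) * P) + ennreal M1"
        by (intro add_mono w nn_integral_conv_mollifier_le[OF S e M1])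
      finally show "(\<integral>\<^sup>+x. ennreal \<bar>conv U ?\<rho> x - indicator \<Omega> x\<bar> \<partial>lborel) \<le> ennreal (2 * e * real DIM('a) * P) + ennreal M1" .
    qed simp
    also have "\<dots> = ennreal (l * M1 + M2 + l * (2 * e * real DIM('a) * P))"
    proof -
      define a where "a = 2 * e * real DIM('a) * P"
      have "0 \<le> a" using e P by (simp add: a_def)
      then have "ennreal (M2 + l * (a + M1)) = ennreal M2 + ennreal l * (ennreal a + ennreal M1)"
        using l M1(1) M2(1) by (simp add: ennreal_mult)
      then show ?thesis unfolding a_def[symmetric] by (simp add: algebra_simps)
    qed
    finally show ?thesis .
  qed
  have "c \<le> ennreal (l * M1 + M2)"
  proof (rule ennreal_le_epsilon)
    fix \<eta> :: real assume \<eta>: "\<eta> > 0"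
    define q where "q = l * (2 * real DIM('a) * P)"
    have q: "q \<ge> 0" using l P by (simp add: q_def)
    have "c \<le> ennreal (l * M1 + M2 + l * (2 * (\<eta> / (q + 1)) * real DIM('a) * P))"
      by (rule main) (use \<eta> q in auto)
    also have "l * (2 * (\<eta> / (q + 1)) * real DIM('a) * P) = \<eta> * (q / (q + 1))"
      by (simp add: q_def)
    also have "ennreal (l * M1 + M2 + \<eta> * (q / (q + 1))) \<le> ennreal (l * M1 + M2 + \<eta> * 1)"
      using \<eta> q by (intro ennreal_leI add_left_mono mult_left_mono) auto
    also have "\<dots> = ennreal (l * M1 + M2) + ennreal \<eta>"
      using \<eta> l M1(1) M2(1) by (simp add: ennreal_plus[symmetric] del: ennreal_plus)
    finally show "c \<le> ennreal (l * M1 + M2) + ennreal \<eta>" .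
  qed
  then show ?thesis using l M1(1) M2(1) by (simp add: ennreal_mult[symmetric] ennreal_plus[symmetric] del: ennreal_plus)
qed

section \<open>Covectors\<close>

definition skip :: "nat \<Rightarrow> (nat \<Rightarrow> 'a) \<Rightarrow> nat \<Rightarrow> 'a" where
  "skip i v = (\<lambda>j. if j < i then v j else v (Suc j))"

lemma covector_cong: "covector k \<omega> \<Longrightarrow> (\<And>i. i < k \<Longrightarrow> v i = w i) \<Longrightarrow> \<omega> v = \<omega> w"
  unfolding covector_def by blast

lemma covector_linear: "covector k \<omega> \<Longrightarrow> i < k \<Longrightarrow> linear (\<lambda>u. \<omega> (v(i := u)))"
  unfolding covector_def by blast

lemma covector_repeated:
  "covector k \<omega> \<Longrightarrow> i < k \<Longrightarrow> j < k \<Longrightarrow> i \<noteq> j \<Longrightarrow> v i = v j \<Longrightarrow> \<omega> v = 0"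
  unfolding covector_def by blast

lemma covector_transpose:
  assumes c: "covector k \<omega>" and ab: "a < k" "b < k" "a \<noteq> b"
  shows "\<omega> (v \<circ> Transposition.transpose a b) = - \<omega> v"
proof -
  define s where "s = v a + v b"
  let ?z = "\<lambda>x y. v(a := x, b := y)"
  have add1: "\<omega> (?z (x + x') y) = \<omega> (?z x y) + \<omega> (?z x' y)" for x x' y
    using linear_add[OF covector_linear[OF c ab(1), of "v(b := y)"]] ab(3)
    by (simp add: fun_upd_twist)
  have add2: "\<omega> (?z x (y + y')) = \<omega> (?z x y) + \<omega> (?z x y')" for x y y'
    using linear_add[OF covector_linear[OF c ab(2), of "v(a := x)"]] by simp
  have 0: "\<omega> (?z x x) = 0" for x
    by (rule covector_repeated[OF c ab]) (use ab in auto)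
  have "\<omega> (?z s s) = (\<omega> (?z (v a) (v a)) + \<omega> (?z (v a) (v b))) + (\<omega> (?z (v b) (v a)) + \<omega> (?z (v b) (v b)))"
    by (simp only: s_def add1 add2)
  then have "\<omega> (?z (v b) (v a)) = - \<omega> (?z (v a) (v b))" unfolding 0 by linarith
  moreover have "?z (v b) (v a) = v \<circ> Transposition.transpose a b"
    by (auto simp: fun_eq_iff Transposition.transpose_def)
  moreover have "?z (v a) (v b) = v" by simp
  ultimately show ?thesis by simp
qed

lemma covector_permute:
  assumes c: "covector k \<omega>" and "p permutes {..<k}"
  shows "\<omega> (v \<circ> p) = of_int (sign p) * \<omega> v"
  using assms(2) finite_lessThan
proof (induction arbitrary: v rule: permutes_induct)
  case id
  then show ?case by (simp add: sign_id)
next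
  case (swap a b p)
  have "permutation p" using swap by (auto intro: permutes_imp_permutation)
  then have sgn: "sign (Transposition.transpose a b \<circ> p) = - sign p"
    using swap by (simp add: sign_compose permutation_swap_id sign_swap_id)
  have "\<omega> (v \<circ> (Transposition.transpose a b \<circ> p)) = of_int (sign p) * \<omega> (v \<circ> Transposition.transpose a b)"
    using swap.IH[of "v \<circ> Transposition.transpose a b"] by (simp only: comp_assoc)
  also have "\<omega> (v \<circ> Transposition.transpose a b) = - \<omega> v"
    by (rule covector_transpose[OF c]) (use swap in auto)
  also have "of_int (sign p) * - \<omega> v = of_int (sign (Transposition.transpose a b \<circ> p)) * \<omega> v"
    unfolding sgn by simp
  finally show ?case .
qed

text \<open>
  Two frames with the same entries differ by a permutation, and both covectors pick up its sign.
\<close>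

lemma covector_eq_of_image_eq:
  assumes c: "covector k \<omega>" "covector k \<omega>'" and eq: "\<omega> s = \<omega>' s"
    and inj: "inj_on s {..<k}" "inj_on v {..<k}" and im: "v ` {..<k} = s ` {..<k}"
  shows "\<omega> v = \<omega>' v"
proof -
  define p where "p = (\<lambda>i. if i < k then the_inv_into {..<k} s (v i) else i)"
  have sp: "s (p i) = v i" if "i < k" for i
  proof -
    have "v i \<in> s ` {..<k}" using that im by blast
    then show ?thesis using that by (simp add: p_def f_the_inv_into_f[OF inj(1)])
  qed
  have "bij_betw (the_inv_into {..<k} s \<circ> v) {..<k} {..<k}"
    by (rule bij_betw_trans[of v _ "s ` {..<k}"])
       (use inj im in \<open>auto simp: bij_betw_def inj_on_the_inv_into the_inv_into_onto\<close>)
  then have "bij_betw p {..<k} {..<k}"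
    by (rule bij_betw_cong[THEN iffD1, rotated]) (auto simp: p_def)
  then have p: "p permutes {..<k}" by (rule bij_imp_permutes) (auto simp: p_def)
  have "\<omega> v = \<omega> (s \<circ> p)" "\<omega>' v = \<omega>' (s \<circ> p)"
    using sp by (auto intro!: covector_cong[OF c(1)] covector_cong[OF c(2)])
  then show ?thesis using covector_permute[OF _ p] c eq by metis
qed

text \<open>
  Covectors are determined by injective frames of basis vectors: expand one slot after the other in the
  basis; frames with a repeated entry contribute nothing.
\<close>

lemma covector_ext:
  fixes \<omega> \<omega>' :: "(nat \<Rightarrow> 'a::euclidean_space) \<Rightarrow> real"
  assumes c: "covector k \<omega>" "covector k \<omega>'"
    and eq: "\<And>v. inj_on v {..<k} \<Longrightarrow> v ` {..<k} \<subseteq> Basis \<Longrightarrow> \<omega> v = \<omega>' v"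
  shows "\<omega> = \<omega>'"
proof -
  \<comment> \<open>Induction on the number \<open>r\<close> of leading slots that are allowed to be arbitrary.\<close>
  have "\<omega> v = \<omega>' v" if "r \<le> k" "\<And>i. r \<le> i \<Longrightarrow> i < k \<Longrightarrow> v i \<in> Basis" for r v
    using that
  proof (induction r arbitrary: v)
    case 0
    show ?case
    proof (cases "inj_on v {..<k}")
      case True
      then show ?thesis using 0 by (intro eq) auto
    next
      case False
      then obtain i j where "i < k" "j < k" "i \<noteq> j" "v i = v j" by (auto simp: inj_on_def)
      then show ?thesis using covector_repeated[OF c(1)] covector_repeated[OF c(2)] by metis
    qed
  next
    case (Suc r)
    have expand: "\<eta> v = (\<Sum>b\<in>Basis. (v r \<bullet> b) *\<^sub>R \<eta> (v(r := b)))" if "covector k \<eta>" for \<eta> :: "(nat \<Rightarrow> 'a) \<Rightarrow> real"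
    proof -
      have lin: "linear (\<lambda>u. \<eta> (v(r := u)))" using covector_linear[OF that] Suc by simp
      have "\<eta> v = \<eta> (v(r := (\<Sum>b\<in>Basis. (v r \<bullet> b) *\<^sub>R b)))" by (simp add: euclidean_representation)
      also have "\<dots> = (\<Sum>b\<in>Basis. \<eta> (v(r := (v r \<bullet> b) *\<^sub>R b)))"
        by (rule linear_sum[OF lin])
      also have "\<dots> = (\<Sum>b\<in>Basis. (v r \<bullet> b) *\<^sub>R \<eta> (v(r := b)))"
        by (intro sum.cong refl linear_cmul[OF lin])
      finally show ?thesis .
    qed
    have "\<omega> (v(r := b)) = \<omega>' (v(r := b))" if "b \<in> Basis" for b
      using Suc that by (intro Suc.IH) auto
    then show ?case unfolding expand[OF c(1)] expand[OF c(2)] by simp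
  qed
  from this[of k] show ?thesis by auto
qed

text \<open>
  Moving the entry \<open>i\<close> to the front takes \<open>i\<close> transpositions; passing from \<open>i\<close> to \<open>Suc i\<close> amounts to
  exchanging the positions \<open>0\<close> and \<open>Suc i\<close>.
\<close>

lemma covector_rotate:
  assumes c: "covector k \<omega>" and "i < k"
  shows "\<omega> (case_nat (v i) (skip i v)) = (-1) ^ i * \<omega> v"
  using assms(2)
proof (induction i)
  case 0
  have "case_nat (v 0) (skip 0 v) = v" by (auto simp: skip_def fun_eq_iff split: nat.split)
  then show ?case by simp
next
  case (Suc i)
  have eq: "case_nat (v (Suc i)) (skip (Suc i) v) = case_nat (v i) (skip i v) \<circ> Transposition.transpose 0 (Suc i)"
    by (auto simp: skip_def fun_eq_iff Transposition.transpose_def split: nat.split)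
  have "\<omega> (case_nat (v (Suc i)) (skip (Suc i) v)) = - \<omega> (case_nat (v i) (skip i v))"
    unfolding eq by (rule covector_transpose[OF c]) (use Suc in auto)
  then show ?case using Suc by simp
qed

lemma covector_scale:
  assumes "covector k \<omega>"
  shows "covector k (\<lambda>v. c * \<omega> v)"
  unfolding covector_def
proof (intro conjI allI impI)
  show "linear (\<lambda>u. c * \<omega> (v(i := u)))" if "i < k" for i v
    using linear_compose_scale_right[OF covector_linear[OF assms that], of c] by simp
  show "c * \<omega> v = 0" if "i < k" "j < k" "i \<noteq> j" "v i = v j" for i j v
    using covector_repeated[OF assms that] by simp
  show "c * \<omega> v = c * \<omega> w" if "\<forall>i<k. v i = w i" for v w
    using covector_cong[OF assms, of v w] that by simp
qed

section \<open>The volume form\<close>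

abbreviation frame_rank :: "'n::{finite,linorder} \<Rightarrow> nat" where
  "frame_rank \<equiv> inv_into {..<CARD('n)} ((!) (sorted_list_of_set (UNIV :: 'n set)))"

lemma bij_betw_enumeration:
  "bij_betw ((!) (sorted_list_of_set (UNIV :: 'n::{finite,linorder} set))) {..<CARD('n)} UNIV"
  by (rule bij_betw_nth) auto

lemma frame_rank_less: "frame_rank (i :: 'n::{finite,linorder}) < CARD('n)"
  using inv_into_into[of i "(!) (sorted_list_of_set (UNIV :: 'n set))" "{..<CARD('n)}"] bij_betw_enumeration[where 'n='n]
  by (auto simp: bij_betw_def)

lemma std_frame_rank: "std_frame (frame_rank i) = axis (i :: 'n::{finite,linorder}) 1"
  unfolding std_frame_def using bij_betw_enumeration[where 'n='n] by (simp add: bij_betw_inv_into_right)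

lemma frame_rank_nth:
  "i < CARD('n) \<Longrightarrow> frame_rank (sorted_list_of_set (UNIV :: 'n::{finite,linorder} set) ! i) = i"
  using bij_betw_inv_into_left[OF bij_betw_enumeration[where 'n='n]] by simp

lemma frame_rank_eq_iff: "frame_rank i = frame_rank j \<longleftrightarrow> i = (j :: 'n::{finite,linorder})"
  using bij_betw_enumeration[where 'n='n] by (metis UNIV_I bij_betw_inv_into_right)

text \<open>
  Frames are indexed by numbers but the rows of a matrix by \<open>'n\<close>; \<open>frame_rank\<close> translates between them in
  agreement with \<open>std_frame\<close>, so that the standard orientation is positive.
\<close>

definition vol :: "(nat \<Rightarrow> real ^ 'n::{finite,linorder}) \<Rightarrow> real" where
  "vol v = det (\<chi> i. v (frame_rank i))"

lemma vol_std_frame: "vol (std_frame :: nat \<Rightarrow> real ^ 'n::{finite,linorder}) = 1"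
proof -
  have "(\<chi> i. std_frame (frame_rank i)) = (mat 1 :: ((real, 'n) vec, 'n) vec)"
    unfolding std_frame_rank by (simp add: vec_eq_iff mat_def axis_def)
  then show ?thesis by (simp add: vol_def)
qed

lemma covector_vol: "covector CARD('n) (vol :: (nat \<Rightarrow> real ^ 'n::{finite,linorder}) \<Rightarrow> real)"
  unfolding covector_def
proof (intro conjI allI impI)
  fix v w :: "nat \<Rightarrow> (real, 'n) vec"
  assume "\<forall>i<CARD('n). v i = w i"
  then show "vol v = vol w" unfolding vol_def using frame_rank_less by metis
next
  fix r and v :: "nat \<Rightarrow> (real, 'n) vec"
  assume r: "r < CARD('n)"
  then obtain k :: 'n where k: "r = frame_rank k" using frame_rank_nth by metis
  have eq: "(\<chi> i. (v(r := u)) (frame_rank i)) = (\<chi> i. if i = k then u else v (frame_rank i))" for u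
    by (auto simp: vec_eq_iff k frame_rank_eq_iff)
  show "linear (\<lambda>u. vol (v(r := u)))"
    unfolding vol_def eq
    using det_row_add[of k "\<lambda>_. _" "\<lambda>_. _" "\<lambda>i. v (frame_rank i)"]
      det_row_mul[of k _ "\<lambda>_. _" "\<lambda>i. v (frame_rank i)"]
    unfolding scalar_mult_eq_scaleR
    by (intro linearI) simp_all
next
  fix r s and v :: "nat \<Rightarrow> (real, 'n) vec"
  assume "r < CARD('n)" "s < CARD('n)" "r \<noteq> s" "v r = v s"
  moreover from this obtain k l :: 'n where "r = frame_rank k" "s = frame_rank l" using frame_rank_nth by metis
  ultimately show "vol v = 0"
    unfolding vol_def by (intro det_identical_rows[of k l]) (auto simp: row_def vec_eq_iff)
qed

lemma bij_betw_std_frame: "bij_betw std_frame {..<CARD('n)} (Basis :: (real ^ 'n::{finite,linorder}) set)"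
proof -
  have "bij_betw (\<lambda>i::'n. axis i (1::real)) UNIV Basis"
    by (auto simp: bij_betw_def inj_on_def axis_eq_axis Basis_vec_def)
  from bij_betw_trans[OF bij_betw_enumeration this] show ?thesis
    by (simp add: std_frame_def[abs_def] comp_def)
qed

lemma top_covector_eq:
  fixes \<omega> :: "(nat \<Rightarrow> real ^ 'n::{finite,linorder}) \<Rightarrow> real"
  assumes "covector CARD('n) \<omega>"
  shows "\<omega> v = \<omega> std_frame * vol v"
proof -
  have "\<omega> = (\<lambda>v. \<omega> std_frame * vol v)"
  proof (rule covector_ext[OF assms covector_scale[OF covector_vol]])
    fix v :: "nat \<Rightarrow> (real, 'n) vec" assume v: "inj_on v {..<CARD('n)}" "v ` {..<CARD('n)} \<subseteq> Basis"
    have im: "v ` {..<CARD('n)} = std_frame ` {..<CARD('n)}"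
      using v card_subset_eq[OF finite_Basis v(2)] bij_betw_std_frame[where 'n='n]
      by (simp add: card_image bij_betw_def)
    have inj: "inj_on (std_frame :: nat \<Rightarrow> (real, 'n) vec) {..<CARD('n)}"
      using bij_betw_std_frame[where 'n='n] by (simp add: bij_betw_def)
    show "\<omega> v = \<omega> std_frame * vol v"
      by (rule covector_eq_of_image_eq[where s=std_frame and \<omega>=\<omega> and \<omega>'="\<lambda>v. \<omega> std_frame * vol v",
          OF assms covector_scale[OF covector_vol] _ inj v(1) im]) (simp add: vol_std_frame)
  qed
  from fun_cong[OF this, of v] show ?thesis .
qed

lemma linear_vol_case_nat: "linear (\<lambda>X. vol (case_nat X v))"
proof -
  have "(case_nat undefined v)(0 := X) = case_nat X v" for X
    by (auto simp: fun_eq_iff split: nat.split)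
  then show ?thesis using covector_linear[OF covector_vol, of 0 "case_nat undefined v"] by simp
qed

lemma covector_contract_vol:
  fixes X :: "real ^ 'n::{finite,linorder}"
  assumes n: "Suc n = CARD('n)"
  shows "covector n (\<lambda>v. vol (case_nat X v))"
  unfolding covector_def
proof (intro conjI allI impI)
  fix v w :: "nat \<Rightarrow> (real, 'n) vec" assume "\<forall>i<n. v i = w i"
  then show "vol (case_nat X v) = vol (case_nat X w)"
    by (intro covector_cong[OF covector_vol]) (auto split: nat.split simp: n[symmetric])
next
  fix i and v :: "nat \<Rightarrow> (real, 'n) vec" assume i: "i < n"
  have "case_nat X (v(i := u)) = (case_nat X v)(Suc i := u)" for u
    by (auto simp: fun_eq_iff split: nat.split)
  then show "linear (\<lambda>u. vol (case_nat X (v(i := u))))"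
    using covector_linear[OF covector_vol, of "Suc i" "case_nat X v"] i n by simp
next
  fix i j and v :: "nat \<Rightarrow> (real, 'n) vec" assume "i < n" "j < n" "i \<noteq> j" "v i = v j"
  then show "vol (case_nat X v) = 0"
    using n by (intro covector_repeated[OF covector_vol, of "Suc i" "Suc j"]) auto
qed

text \<open>
  The vector dual to an \<open>(m-1)\<close>-covector under the volume form: contracting the volume form with it gives
  back the covector.
\<close>

definition dual_vector :: "((nat \<Rightarrow> real ^ 'n::{finite,linorder}) \<Rightarrow> real) \<Rightarrow> real ^ 'n::{finite,linorder}" where
  "dual_vector \<omega> = (\<Sum>i<CARD('n). ((-1) ^ i * \<omega> (skip i std_frame)) *\<^sub>R std_frame i)"

lemma std_frame_inner:
  "i < CARD('n) \<Longrightarrow> j < CARD('n) \<Longrightarrow>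
    std_frame i \<bullet> (std_frame j :: real ^ 'n::{finite,linorder}) = (if i = j then 1 else 0)"
proof -
  assume ij: "i < CARD('n)" "j < CARD('n)"
  have "std_frame i \<in> (Basis :: ((real, 'n) vec) set)" "std_frame j \<in> (Basis :: ((real, 'n) vec) set)"
    "std_frame i = (std_frame j :: (real, 'n) vec) \<longleftrightarrow> i = j"
    using ij bij_betw_std_frame[where 'n='n] by (auto simp: bij_betw_def inj_on_eq_iff)
  then show ?thesis by (auto simp: inner_Basis)
qed

lemma std_frame_representation:
  fixes X :: "real ^ 'n::{finite,linorder}"
  shows "X = (\<Sum>j<CARD('n). (X \<bullet> std_frame j) *\<^sub>R std_frame j)"
  by (subst sum.reindex_bij_betw[OF bij_betw_std_frame, of "\<lambda>b. (X \<bullet> b) *\<^sub>R b"]) (simp add: euclidean_representation)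

lemma vol_case_nat_skip:
  assumes "i < CARD('n)" "j < CARD('n)"
  shows "vol (case_nat (std_frame j) (skip i std_frame :: nat \<Rightarrow> real ^ 'n::{finite,linorder})) = (if i = j then (-1) ^ i else 0)"
proof (cases "i = j")
  case True
  then show ?thesis using covector_rotate[OF covector_vol, of i std_frame] assms by (simp add: vol_std_frame)
next
  case False
  define r where "r = (if j < i then Suc j else j)"
  have "vol (case_nat (std_frame j) (skip i std_frame :: nat \<Rightarrow> (real, 'n) vec)) = 0"
    by (rule covector_repeated[OF covector_vol, of 0 r])
       (use False assms in \<open>auto simp: r_def skip_def split: nat.split\<close>)
  then show ?thesis using False by simp
qed

lemma vol_case_nat_skip_std_frame:
  assumes i: "i < CARD('n)"
  shows "vol (case_nat X (skip i std_frame :: nat \<Rightarrow> real ^ 'n::{finite,linorder})) = (-1) ^ i * (X \<bullet> std_frame i)"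
proof -
  let ?e = "std_frame :: nat \<Rightarrow> (real, 'n) vec"
  have "vol (case_nat (\<Sum>j<CARD('n). (X \<bullet> ?e j) *\<^sub>R ?e j) (skip i ?e)) =
      (\<Sum>j<CARD('n). (X \<bullet> ?e j) * vol (case_nat (?e j) (skip i ?e)))"
    by (simp add: linear_sum[OF linear_vol_case_nat] linear_cmul[OF linear_vol_case_nat])
  also have "\<dots> = (\<Sum>j<CARD('n). if j = i then (X \<bullet> ?e j) * (-1) ^ i else 0)"
    by (intro sum.cong refl) (auto simp: vol_case_nat_skip i)
  also have "\<dots> = (-1) ^ i * (X \<bullet> ?e i)" using i by simp
  finally show ?thesis unfolding std_frame_representation[symmetric] .
qed

lemma dual_vector_inner:
  assumes "i < CARD('n)"
  shows "dual_vector \<omega> \<bullet> (std_frame i :: real ^ 'n::{finite,linorder}) = (-1) ^ i * \<omega> (skip i std_frame)"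
proof -
  have "dual_vector \<omega> \<bullet> (std_frame i :: real ^ 'n::{finite,linorder}) =
      (\<Sum>j<CARD('n). if j = i then (-1) ^ j * \<omega> (skip j std_frame) else 0)"
    unfolding dual_vector_def inner_sum_left inner_scaleR_left
    by (intro sum.cong refl) (simp add: std_frame_inner assms)
  then show ?thesis using assms by simp
qed

text \<open>
  By \<open>covector_ext\<close> it is enough to look at injective frames of \<open>m - 1\<close> basis vectors. Such a frame
  omits exactly one \<open>std_frame i\<close>, so it is a rearrangement of \<open>skip i std_frame\<close>.
\<close>

lemma codim1_covector_eq:
  fixes \<omega> :: "(nat \<Rightarrow> real ^ 'n::{finite,linorder}) \<Rightarrow> real"
  assumes n: "Suc n = CARD('n)" and c: "covector n \<omega>"
  shows "\<omega> v = vol (case_nat (dual_vector \<omega>) v)"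
proof -
  let ?m = "CARD('n)"
  let ?e = "std_frame :: nat \<Rightarrow> (real, 'n) vec"
  note c' = covector_contract_vol[OF n, of "dual_vector \<omega>"]
  have inje: "inj_on ?e {..<?m}" and ime: "?e ` {..<?m} = Basis"
    using bij_betw_std_frame[where 'n='n] by (auto simp: bij_betw_def)
  have base: "\<omega> (skip i ?e) = vol (case_nat (dual_vector \<omega>) (skip i ?e))" if i: "i < ?m" for i
    unfolding vol_case_nat_skip_std_frame[OF i] dual_vector_inner[OF i]
    by (simp add: mult.assoc[symmetric] power_add[symmetric] flip: mult_2)
  have "\<omega> = (\<lambda>v. vol (case_nat (dual_vector \<omega>) v))"
  proof (rule covector_ext[OF c c'])
    fix v :: "nat \<Rightarrow> (real, 'n) vec" assume v: "inj_on v {..<n}" "v ` {..<n} \<subseteq> Basis"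
    have "card (v ` {..<n}) = n" using v by (simp add: card_image)
    then have "v ` {..<n} \<noteq> Basis" using n by (metis DIM_cart DIM_real mult.right_neutral n_not_Suc_n)
    then obtain b where b: "b \<in> Basis" "b \<notin> v ` {..<n}" using v(2) by blast
    then obtain i where i: "i < ?m" "?e i \<notin> v ` {..<n}" unfolding ime[symmetric] by auto
    have im: "skip i ?e ` {..<n} = Basis - {?e i}"
    proof -
      have "skip i ?e ` {..<n} = ?e ` ({..<?m} - {i})"
      proof -
        have "(\<lambda>j. if j < i then j else Suc j) ` {..<n} = {..<?m} - {i}"
        proof (intro equalityI subsetI)
          fix j assume j: "j \<in> {..<?m} - {i}"
          show "j \<in> (\<lambda>j. if j < i then j else Suc j) ` {..<n}"
          proof (cases "j < i")
            case True
            then show ?thesis using i n by (intro image_eqI[of _ _ j]) auto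
          next
            case False
            then show ?thesis using j i n by (intro image_eqI[of _ _ "j - 1"]) auto
          qed
        qed (use i n in auto)
        moreover have "skip i ?e = ?e \<circ> (\<lambda>j. if j < i then j else Suc j)" by (auto simp: skip_def)
        ultimately show ?thesis 
          using image_comp[of ?e "\<lambda>j. if j < i then j else Suc j" "{..<n}", symmetric] by (simp only:)
      qed
      also have "\<dots> = Basis - {?e i}"
        using inj_on_image_set_diff[OF inje, of "{..<?m}" "{i}"] i ime by auto
      finally show ?thesis .
    qed
    have "?e i \<in> Basis" using ime i by blast
    then have card: "card (skip i ?e ` {..<n}) = n" unfolding im using n by (simp add: card_Diff_singleton)
    have im_v: "v ` {..<n} = skip i ?e ` {..<n}"
    proof (rule card_subset_eq)
      show "v ` {..<n} \<subseteq> skip i ?e ` {..<n}" unfolding im using v(2) i(2) by blast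
      show "card (v ` {..<n}) = card (skip i ?e ` {..<n})" using card v by (simp add: card_image)
    qed simp
    have inj: "inj_on (skip i ?e) {..<n}"
      by (rule eq_card_imp_inj_on) (simp_all add: card)
    show "\<omega> v = vol (case_nat (dual_vector \<omega>) v)"
      by (rule covector_eq_of_image_eq[where s="skip i ?e" and \<omega>=\<omega> and
          \<omega>'="\<lambda>v. vol (case_nat (dual_vector \<omega>) v)", OF c c' base[OF i(1)] inj v(1) im_v])
  qed
  from fun_cong[OF this, of v] show ?thesis .
qed

section \<open>Comass\<close>

abbreviation orthonormal_frame :: "nat \<Rightarrow> (nat \<Rightarrow> 'a::real_inner) \<Rightarrow> bool" where
  "orthonormal_frame k v \<equiv> \<forall>i<k. \<forall>j<k. v i \<bullet> v j = (if i = j then 1 else 0)"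

lemma comass_le:
  assumes "0 \<le> B" "\<And>v. orthonormal_frame k v \<Longrightarrow> \<bar>\<omega> v\<bar> \<le> B"
  shows "comass k \<omega> \<le> B"
  unfolding comass_def using assms by (intro cSup_least) auto

text \<open>
  The bound \<open>B\<close> only ensures that the supremum is one of a bounded set of reals.
\<close>

lemma le_comass:
  assumes "\<And>v. orthonormal_frame k v \<Longrightarrow> \<bar>\<omega> v\<bar> \<le> B" "orthonormal_frame k v"
  shows "\<bar>\<omega> v\<bar> \<le> comass k \<omega>"
  unfolding comass_def
proof (rule cSup_upper)
  show "bdd_above (insert 0 {\<bar>\<omega> v\<bar> | v. orthonormal_frame k v})"
    using assms(1) by (intro bdd_aboveI[of _ "max 0 B"]) (auto simp: le_max_iff_disj)
qed (use assms(2) in blast)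

lemma abs_vol_orthonormal:
  fixes v :: "nat \<Rightarrow> real ^ 'n::{finite,linorder}"
  assumes "orthonormal_frame CARD('n) v"
  shows "\<bar>vol v\<bar> = 1"
proof -
  have "row i (\<chi> i. v (frame_rank i)) = v (frame_rank i)" for i :: 'n by (simp add: row_def)
  then have "orthogonal_matrix (\<chi> i. v (frame_rank i))"
    unfolding orthogonal_matrix_orthonormal_rows
    using assms frame_rank_less[where 'n='n] frame_rank_eq_iff[where 'n='n]
    by (auto simp: norm_eq_1 orthogonal_def)
  then show ?thesis unfolding vol_def using det_orthogonal_matrix by fastforce
qed

text \<open>
  As a linear function of \<open>X\<close> the left-hand side is the inner product with a vector \<open>Y\<close> that is orthogonal
  to the frame. Completing the frame by the direction of \<open>Y\<close> gives an orthonormal basis, of volume \<open>\<plusminus>1\<close>,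
  and shows \<open>\<bar>Y\<bar> \<le> 1\<close>.
\<close>

lemma abs_contract_vol_le:
  fixes X :: "real ^ 'n::{finite,linorder}"
  assumes n: "Suc n = CARD('n)" and v: "orthonormal_frame n v"
  shows "\<bar>vol (case_nat X v)\<bar> \<le> norm X"
proof -
  define Y where "Y = (\<Sum>b\<in>Basis. vol (case_nat b v) *\<^sub>R b)"
  have Y: "vol (case_nat Z v) = Y \<bullet> Z" for Z
  proof -
    have "vol (case_nat (\<Sum>b\<in>Basis. (Z \<bullet> b) *\<^sub>R b) v) = (\<Sum>b\<in>Basis. (Z \<bullet> b) * vol (case_nat b v))"
      by (simp add: linear_sum[OF linear_vol_case_nat] linear_cmul[OF linear_vol_case_nat])
    also have "\<dots> = Y \<bullet> Z"
      by (simp add: Y_def inner_sum_left inner_sum_right inner_commute[of _ Z] mult.commute)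
    finally show ?thesis by (simp only: euclidean_representation)
  qed
  have "norm Y \<le> 1"
  proof (cases "Y = 0")
    case False
    define \<nu> where "\<nu> = Y /\<^sub>R norm Y"
    have \<nu>1: "\<nu> \<bullet> \<nu> = 1" using False by (simp add: \<nu>_def dot_square_norm power2_eq_square)
    have orth: "\<nu> \<bullet> v i = 0" if "i < n" for i
    proof -
      have "vol (case_nat (v i) v) = 0"
        by (rule covector_repeated[OF covector_vol, of 0 "Suc i"]) (use that n in auto)
      then show ?thesis by (simp add: \<nu>_def Y)
    qed
    have "orthonormal_frame CARD('n) (case_nat \<nu> v)"
      using v \<nu>1 orth by (auto simp: n[symmetric] inner_commute split: nat.split)
    from abs_vol_orthonormal[OF this] have "\<bar>Y \<bullet> \<nu>\<bar> = 1" unfolding Y .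
    moreover have "Y \<bullet> \<nu> = norm Y" using False by (simp add: \<nu>_def dot_square_norm power2_eq_square)
    ultimately show ?thesis by simp
  qed simp
  then show ?thesis
    unfolding Y using Cauchy_Schwarz_ineq2[of Y X] mult_right_mono[of "norm Y" 1 "norm X"] by simp
qed

text \<open>
  Identifying \<open>(m-1)\<close>-forms with vector fields turns the comass into the Euclidean norm. It is attained
  at an orthonormal basis of the complement of \<open>X\<close>, read off an orthogonal matrix with a column in
  the direction of \<open>X\<close>.
\<close>

lemma comass_contract_vol:
  fixes X :: "real ^ 'n::{finite,linorder}"
  assumes n: "Suc n = CARD('n)"
  shows "comass n (\<lambda>v. vol (case_nat X v)) = norm X"
proof (rule antisym)
  show "comass n (\<lambda>v. vol (case_nat X v)) \<le> norm X"
    by (rule comass_le) (auto intro: abs_contract_vol_le[OF n])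
  show "norm X \<le> comass n (\<lambda>v. vol (case_nat X v))"
  proof (cases "X = 0")
    case False
    let ?enum = "(!) (sorted_list_of_set (UNIV :: 'n set))"
    define \<nu> where "\<nu> = X /\<^sub>R norm X"
    have "norm \<nu> = 1" using False by (simp add: \<nu>_def)
    then obtain A where A: "orthogonal_matrix A" "A *v axis (?enum 0) 1 = \<nu>"
      using orthogonal_matrix_exists_basis[of \<nu> "?enum 0"] by blast
    define w where "w = (\<lambda>j. column (?enum j) A)"
    have w0: "w 0 = \<nu>" using A(2) by (simp add: w_def matrix_vector_mult_basis)
    have w: "orthonormal_frame CARD('n) w"
    proof (intro allI impI)
      fix i j assume ij: "i < CARD('n)" "j < CARD('n)"
      then have "?enum i = ?enum j \<longleftrightarrow> i = j" using frame_rank_nth by metis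
      moreover have "norm (column k A) = 1" "k \<noteq> l \<Longrightarrow> column k A \<bullet> column l A = 0" for k l
        using A(1) unfolding orthogonal_matrix_orthonormal_columns orthogonal_def by auto
      ultimately show "w i \<bullet> w j = (if i = j then 1 else 0)"
        by (auto simp: w_def norm_eq_1)
    qed
    let ?v = "\<lambda>j. w (Suc j)"
    have v: "orthonormal_frame n ?v" using w n by auto
    have "X = norm X *\<^sub>R \<nu>" using False by (simp add: \<nu>_def)
    then have "vol (case_nat X ?v) = norm X * vol (case_nat \<nu> ?v)"
      using linear_cmul[OF linear_vol_case_nat, of "norm X" \<nu> ?v] by simp
    also have "case_nat \<nu> ?v = w" using w0 by (auto simp: fun_eq_iff split: nat.split)
    finally have "norm X = \<bar>vol (case_nat X ?v)\<bar>" using abs_vol_orthonormal[OF w] by (simp add: abs_mult)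
    also have "\<dots> \<le> comass n (\<lambda>v. vol (case_nat X v))"
      by (rule le_comass[of n "\<lambda>v. vol (case_nat X v)" "norm X", OF abs_contract_vol_le[OF n] v])
    finally show ?thesis .
  next
    case True
    have "vol (case_nat X v) = 0" for v using linear_0[OF linear_vol_case_nat, of v] True by simp
    then have eq: "insert 0 {\<bar>vol (case_nat X v)\<bar> | v. orthonormal_frame n v} = {0}" by auto
    show ?thesis unfolding comass_def eq using True by simp
  qed
qed

section \<open>Forms of top degree and of codimension one\<close>

text \<open>
  The interior product of a vector field with the volume form.
\<close>

definition contract_vol :: "(real ^ 'n::{finite,linorder} \<Rightarrow> real ^ 'n::{finite,linorder}) \<Rightarrow> (real ^ 'n::{finite,linorder}) form" where
  "contract_vol X = (\<lambda>x v. vol (case_nat (X x) v))"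

definition vol_form :: "(real ^ 'n::{finite,linorder} \<Rightarrow> real) \<Rightarrow> (real ^ 'n::{finite,linorder}) form" where
  "vol_form f = (\<lambda>x v. f x * vol v)"

lemma mem_test_forms_iff:
  "\<phi> \<in> test_forms k \<longleftrightarrow> (\<forall>x. covector k (\<phi> x)) \<and> (\<forall>v. smooth (\<lambda>x. \<phi> x v)) \<and>
     (\<exists>K. compact K \<and> (\<forall>x v. x \<notin> K \<longrightarrow> \<phi> x v = 0))"
  unfolding test_forms_def test_forms_in_def by auto

lemma test_form_coefficient: "\<phi> \<in> test_forms k \<Longrightarrow> test_function (\<lambda>x. \<phi> x v)"
  unfolding mem_test_forms_iff test_function_def by blast

lemma contract_vol_test_form:
  fixes X :: "real ^ 'n::{finite,linorder} \<Rightarrow> real ^ 'n::{finite,linorder}"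
  assumes n: "Suc n = CARD('n)" and X: "test_function X"
  shows "contract_vol X \<in> test_forms n"
proof -
  obtain K where "compact K" "\<And>x. x \<notin> K \<Longrightarrow> X x = 0" "smooth X"
    using X unfolding test_function_def by metis
  then show ?thesis
    unfolding mem_test_forms_iff contract_vol_def
    using covector_contract_vol[OF n] smooth_linear_compose[OF linear_vol_case_nat] linear_0[OF linear_vol_case_nat]
    by (intro conjI exI[of _ K]) auto
qed

lemma vol_form_test_form:
  fixes f :: "real ^ 'n::{finite,linorder} \<Rightarrow> real"
  assumes f: "test_function f"
  shows "vol_form f \<in> test_forms CARD('n)"
proof -
  obtain K where "compact K" "\<And>x. x \<notin> K \<Longrightarrow> f x = 0" "smooth f"
    using f unfolding test_function_def by metis
  then show ?thesis
    unfolding mem_test_forms_iff vol_form_def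
    using covector_scale[OF covector_vol] smooth_mult[OF _ smooth_const]
    by (intro conjI exI[of _ K]) auto
qed

lemma dual_vector_test_field:
  fixes \<phi> :: "(real ^ 'n::{finite,linorder}) form"
  assumes \<phi>: "\<phi> \<in> test_forms n"
  shows "test_function (\<lambda>x. dual_vector (\<phi> x))"
  unfolding dual_vector_def
  by (intro test_function_sum test_function_scaleR_vector test_function_mult_left test_form_coefficient[OF \<phi>])

text \<open>
  Omitting one or the other of two equal entries gives frames that differ by \<open>b - a - 1\<close>
  transpositions of neighbours. This is the cancellation behind the antisymmetry of the exterior derivative.
\<close>

lemma covector_exchange_repeated:
  assumes c: "covector k \<omega>" and ab: "a < b" "b \<le> k" and v: "v a = v b"
  shows "(-1) ^ a * \<omega> (skip a v) + (-1) ^ b * \<omega> (skip b v) = 0"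
proof -
  define e where "e = skip a (skip b v)"
  \<comment> \<open>\<open>ins j\<close> inserts the repeated entry at position \<open>j\<close> into the frame \<open>e\<close> from which both copies have been removed.\<close>
  define ins where "ins = (\<lambda>j i. if i < j then e i else if i = j then v a else e (i - 1))"
  have step: "\<omega> (ins (a + d)) = (-1) ^ d * \<omega> (ins a)" if "a + d < k" for d
    using that
  proof (induction d)
    case (Suc d)
    have eq: "ins (a + Suc d) = ins (a + d) \<circ> Transposition.transpose (a + d) (Suc (a + d))"
      by (auto simp: ins_def fun_eq_iff Transposition.transpose_def)
    have "\<omega> (ins (a + Suc d)) = - \<omega> (ins (a + d))"
      unfolding eq by (rule covector_transpose[OF c]) (use Suc in auto)
    then show ?case using Suc by simp
  qed simp
  have b: "skip b v = ins a"
    using ab by (auto simp: ins_def e_def skip_def fun_eq_iff)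
  have a: "skip a v = ins (a + (b - 1 - a))"
    using ab v by (auto simp: ins_def e_def skip_def fun_eq_iff not_less less_Suc_eq_le le_less_Suc_eq le_antisym)
  obtain d where d: "b = Suc (a + d)" using ab(1) less_imp_Suc_add by blast
  have "skip a v = ins (a + d)" using a d by simp
  then have "\<omega> (skip a v) = (-1) ^ d * \<omega> (skip b v)"
    using step[of d] ab(2) b d by simp
  then show ?thesis by (simp add: d power_add mult.assoc[symmetric])
qed

lemma covector_ext_deriv:
  fixes \<phi> :: "'a::euclidean_space form"
  assumes \<phi>: "\<phi> \<in> test_forms n"
  shows "covector (Suc n) (ext_deriv n \<phi> x)"
proof -
  let ?D = "\<lambda>w. frechet_derivative (\<lambda>y. \<phi> y w) (at x)"
  have c: "covector n (\<phi> y)" for y using \<phi> by (simp add: mem_test_forms_iff)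
  have sm: "smooth (\<lambda>y. \<phi> y w)" for w using \<phi> by (simp add: mem_test_forms_iff)
  have lin: "linear (?D w)" for w using smooth_has_derivative[OF sm] has_derivative_linear by blast
  have Dcong: "?D w = ?D w'" if "\<And>i. i < n \<Longrightarrow> w i = w' i" for w w'
  proof -
    have "(\<lambda>y. \<phi> y w) = (\<lambda>y. \<phi> y w')" using covector_cong[OF c that] by auto
    then show ?thesis by simp
  qed
  have Dlin: "linear (\<lambda>u. ?D (w(i := u)) h)" if i: "i < n" for w i h
  proof (rule linearI)
    fix u u'
    have eq: "(\<lambda>y. \<phi> y (w(i := u + u'))) = (\<lambda>y. \<phi> y (w(i := u)) + \<phi> y (w(i := u')))"
      using linear_add[OF covector_linear[OF c i]] by auto
    have D: "((\<lambda>y. \<phi> y (w(i := u)) + \<phi> y (w(i := u'))) has_derivative (\<lambda>h. ?D (w(i := u)) h + ?D (w(i := u')) h)) (at x)"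
      by (intro has_derivative_add smooth_has_derivative sm)
    show "?D (w(i := u + u')) h = ?D (w(i := u)) h + ?D (w(i := u')) h"
      unfolding eq frechet_derivative_at[OF D, symmetric] by (rule refl)
  next
    fix r u
    have eq: "(\<lambda>y. \<phi> y (w(i := r *\<^sub>R u))) = (\<lambda>y. r *\<^sub>R \<phi> y (w(i := u)))"
      using linear_cmul[OF covector_linear[OF c i]] by auto
    have D: "((\<lambda>y. r *\<^sub>R \<phi> y (w(i := u))) has_derivative (\<lambda>h. r *\<^sub>R ?D (w(i := u)) h)) (at x)"
      by (intro has_derivative_scaleR_right smooth_has_derivative sm)
    show "?D (w(i := r *\<^sub>R u)) h = r *\<^sub>R ?D (w(i := u)) h"
      unfolding eq frechet_derivative_at[OF D, symmetric] by (rule refl)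
  qed
  have ext: "ext_deriv n \<phi> x v = (\<Sum>i\<le>n. (-1) ^ i * ?D (skip i v) (v i))" for v
    by (simp add: ext_deriv_def skip_def)
  show ?thesis
    unfolding covector_def
  proof (intro conjI allI impI)
    fix v w :: "nat \<Rightarrow> 'a" assume vw: "\<forall>i<Suc n. v i = w i"
    have "?D (skip i v) = ?D (skip i w)" if "i \<le> n" for i
      by (rule Dcong) (use vw in \<open>auto simp: skip_def\<close>)
    then show "ext_deriv n \<phi> x v = ext_deriv n \<phi> x w"
      unfolding ext using vw by (intro sum.cong) auto
  next
    fix j and v :: "nat \<Rightarrow> 'a" assume j: "j < Suc n"
    show "linear (\<lambda>u. ext_deriv n \<phi> x (v(j := u)))"
      unfolding ext
    proof (rule linear_compose_sum, intro ballI)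
      fix i assume i: "i \<in> {..n}"
      consider "i = j" | "i < j" | "j < i" by linarith
      then have "linear (\<lambda>u. ?D (skip i (v(j := u))) ((v(j := u)) i))"
      proof cases
        case 1
        have "skip i (v(j := u)) = skip i v" for u using 1 by (auto simp: skip_def)
        then show ?thesis using 1 lin by simp
      next
        case 2
        have "skip i (v(j := u)) = (skip i v)(j - 1 := u)" for u using 2 by (auto simp: skip_def fun_eq_iff)
        then show ?thesis using Dlin[of "j - 1"] 2 j by simp
      next
        case 3
        have "skip i (v(j := u)) = (skip i v)(j := u)" for u using 3 by (auto simp: skip_def fun_eq_iff)
        then show ?thesis using Dlin[of j] 3 i by simp
      qed
      then show "linear (\<lambda>u. (-1) ^ i * ?D (skip i (v(j := u))) ((v(j := u)) i))"
        using linear_compose_scale_right[of _ "(-1) ^ i"] by fastforce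
    qed
  next
    have *: "ext_deriv n \<phi> x v = 0" if ab: "a < b" "b < Suc n" and v: "v a = v b" for a b v
    proof -
      have 0: "?D (skip i v) = (\<lambda>h. 0)" if i: "i \<le> n" "i \<noteq> a" "i \<noteq> b" for i
      proof -
        define a' where "a' = (if a < i then a else a - 1)"
        define b' where "b' = (if b < i then b else b - 1)"
        have "\<phi> y (skip i v) = 0" for y
          by (rule covector_repeated[OF c, of a' b'])
             (use i ab v in \<open>auto simp: a'_def b'_def skip_def\<close>)
        then show ?thesis by (simp add: frechet_derivative_const)
      qed
      have "ext_deriv n \<phi> x v = (\<Sum>i\<in>{a, b}. (-1) ^ i * ?D (skip i v) (v i))"
        unfolding ext using ab 0 by (intro sum.mono_neutral_right) auto
      also have "\<dots> = (-1) ^ a * ?D (skip a v) (v b) + (-1) ^ b * ?D (skip b v) (v b)"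
        using ab v by simp
      also have "\<dots> = 0"
      proof -
        have D: "((\<lambda>y. (-1) ^ a * \<phi> y (skip a v) + (-1) ^ b * \<phi> y (skip b v)) has_derivative
            (\<lambda>h. (-1) ^ a * ?D (skip a v) h + (-1) ^ b * ?D (skip b v) h)) (at x)"
          by (intro has_derivative_add has_derivative_mult_right smooth_has_derivative sm)
        have "(-1) ^ a * \<phi> y (skip a v) + (-1) ^ b * \<phi> y (skip b v) = 0" for y
          using covector_exchange_repeated[of n "\<phi> y" a b v, OF c] ab v by simp
        with D have "((\<lambda>y. 0) has_derivative
            (\<lambda>h. (-1) ^ a * ?D (skip a v) h + (-1) ^ b * ?D (skip b v) h)) (at x)" by simp
        from has_derivative_unique[OF this has_derivative_const]
        show ?thesis by (rule fun_cong)
      qed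
      finally show ?thesis .
    qed
    fix i j and v :: "nat \<Rightarrow> 'a" assume "i < Suc n" "j < Suc n" "i \<noteq> j" "v i = v j"
    then show "ext_deriv n \<phi> x v = 0"
      using *[of i j v] *[of j i v] by (cases "i < j") auto
  qed
qed

text \<open>
  Both sides are covectors of top degree, so it suffices to compare them on the standard frame, where the
  alternating signs of the exterior derivative are absorbed by those of \<open>dual_vector\<close>.
\<close>

lemma ext_deriv_eq_divergence:
  fixes \<phi> :: "(real ^ 'n::{finite,linorder}) form"
  assumes n: "Suc n = CARD('n)" and \<phi>: "\<phi> \<in> test_forms n"
  shows "ext_deriv n \<phi> = vol_form (divergence (\<lambda>x. dual_vector (\<phi> x)))"
proof -
  let ?e = "std_frame :: nat \<Rightarrow> (real, 'n) vec"
  have sm: "smooth (\<lambda>y. \<phi> y w)" for w using \<phi> by (simp add: mem_test_forms_iff)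
  have div: "divergence (\<lambda>x. dual_vector (\<phi> x)) x = ext_deriv n \<phi> x ?e" for x
  proof -
    let ?D = "\<lambda>w. frechet_derivative (\<lambda>y. \<phi> y w) (at x)"
    have D: "((\<lambda>x. dual_vector (\<phi> x)) has_derivative
      (\<lambda>h. \<Sum>i<CARD('n). ((-1) ^ i * ?D (skip i ?e) h) *\<^sub>R ?e i)) (at x)"
      unfolding dual_vector_def
      by (intro has_derivative_sum has_derivative_scaleR_left has_derivative_mult_right smooth_has_derivative sm)
    have "divergence (\<lambda>x. dual_vector (\<phi> x)) x =
        (\<Sum>b\<in>Basis. (\<Sum>i<CARD('n). ((-1) ^ i * ?D (skip i ?e) b) *\<^sub>R ?e i) \<bullet> b)"
      unfolding divergence_def frechet_derivative_at[OF D, symmetric] by (rule refl)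
    also have "\<dots> = (\<Sum>j<CARD('n). (\<Sum>i<CARD('n). ((-1) ^ i * ?D (skip i ?e) (?e j)) *\<^sub>R ?e i) \<bullet> ?e j)"
      by (rule sum.reindex_bij_betw[OF bij_betw_std_frame, symmetric])
    also have "\<dots> = (\<Sum>j<CARD('n). (\<Sum>i<CARD('n). if i = j then (-1) ^ i * ?D (skip i ?e) (?e j) else 0))"
      unfolding inner_sum_left inner_scaleR_left
      by (intro sum.cong refl) (simp_all add: std_frame_inner)
    also have "\<dots> = ext_deriv n \<phi> x ?e"
      by (simp add: ext_deriv_def skip_def n[symmetric] lessThan_Suc_atMost)
    finally show ?thesis .
  qed
  show ?thesis
  proof (intro ext)
    fix x v
    have "covector CARD('n) (ext_deriv n \<phi> x)" using covector_ext_deriv[OF \<phi>] n by simp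
    then show "ext_deriv n \<phi> x v = vol_form (divergence (\<lambda>x. dual_vector (\<phi> x))) x v"
      unfolding vol_form_def div by (rule top_covector_eq)
  qed
qed

lemma dual_vector_contract_vol:
  fixes X :: "real ^ 'n::{finite,linorder}"
  shows "dual_vector (\<lambda>v. vol (case_nat X v)) = X"
proof -
  have "dual_vector (\<lambda>v. vol (case_nat X v)) = (\<Sum>i<CARD('n). (X \<bullet> std_frame i) *\<^sub>R std_frame i)"
    unfolding dual_vector_def
    by (intro sum.cong refl)
      (simp add: vol_case_nat_skip_std_frame mult.assoc[symmetric] power_add[symmetric] flip: mult_2)
  then show ?thesis unfolding std_frame_representation[symmetric] .
qed

lemma ext_deriv_contract_vol:
  fixes X :: "real ^ 'n::{finite,linorder} \<Rightarrow> real ^ 'n::{finite,linorder}"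
  assumes n: "Suc n = CARD('n)" and X: "test_function X"
  shows "ext_deriv n (contract_vol X) = vol_form (divergence X)"
  using ext_deriv_eq_divergence[OF n contract_vol_test_form[OF n X]]
  by (simp add: contract_vol_def dual_vector_contract_vol)

lemma orthonormal_std_frame:
  "orthonormal_frame CARD('n) (std_frame :: nat \<Rightarrow> real ^ 'n::{finite,linorder})"
  by (simp add: std_frame_inner)

lemma comass_vol_scale_le: "comass CARD('n) (\<lambda>v. c * vol (v :: nat \<Rightarrow> real ^ 'n::{finite,linorder})) \<le> \<bar>c\<bar>"
  by (rule comass_le) (simp_all add: abs_mult abs_vol_orthonormal)

section \<open>Currents carried by sets\<close>

lemma abs_std_frame_le_comass:
  fixes \<omega> :: "(nat \<Rightarrow> real ^ 'n::{finite,linorder}) \<Rightarrow> real"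
  assumes "covector CARD('n) \<omega>"
  shows "\<bar>\<omega> std_frame\<bar> \<le> comass CARD('n) \<omega>"
proof (rule le_comass[OF _ orthonormal_std_frame])
  fix v :: "nat \<Rightarrow> (real, 'n) vec" assume "orthonormal_frame CARD('n) v"
  then show "\<bar>\<omega> v\<bar> \<le> \<bar>\<omega> std_frame\<bar>"
    using top_covector_eq[OF assms, of v] abs_vol_orthonormal[of v] by (simp add: abs_mult)
qed

lemma topspace_form_topology: "topspace (form_topology k) = (test_forms k :: 'a::euclidean_space form set)"
proof -
  have "open_forms k (test_forms k :: 'a form set)"
    unfolding open_forms_def
  proof (intro conjI allI impI ballI)
    fix K :: "'a set" and \<phi> assume "compact K"
    then have "form_nbhd K k \<phi> 0 1 \<subseteq> test_forms k"
      unfolding form_nbhd_def test_forms_def by blast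
    then show "\<exists>N. \<exists>\<epsilon>>0. form_nbhd K k \<phi> N \<epsilon> \<subseteq> test_forms k" using zero_less_one by blast
  qed simp
  moreover have "open_forms k U \<Longrightarrow> U \<subseteq> test_forms k" for U :: "'a form set" by (simp add: open_forms_def)
  ultimately show ?thesis unfolding topspace_def openin_form_topology by blast
qed

text \<open>
  On forms supported in a compact set the functional is controlled by the supremum of one coefficient,
  so neighbourhoods of order zero suffice for its continuity.
\<close>

lemma current_set_current:
  fixes E :: "(real ^ 'n::{finite,linorder}) set"
  assumes E: "E \<in> sets lebesgue"
  shows "current CARD('n) (set_current E)"
  unfolding current_def
proof (intro conjI ballI allI)
  fix \<phi> \<psi> :: "(real, 'n) vec form"
  assume "\<phi> \<in> test_forms CARD('n)" "\<psi> \<in> test_forms CARD('n)"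
  then show "set_current E (\<lambda>x v. \<phi> x v + \<psi> x v) = set_current E \<phi> + set_current E \<psi>"
    unfolding set_current_def
    by (intro set_integral_add set_integrable_test_function E test_form_coefficient)
next
  fix c and \<phi> :: "(real ^ 'n::{finite,linorder}) form"
  show "set_current E (\<lambda>x v. c * \<phi> x v) = c * set_current E \<phi>"
    unfolding set_current_def by simp
next
  show "continuous_map (form_topology CARD('n)) euclideanreal (set_current E)"
    unfolding continuous_map_def topspace_form_topology openin_form_topology
  proof (intro conjI allI impI)
    fix U :: "real set" assume "openin euclideanreal U"
    then have U: "open U" by simp
    show "open_forms CARD('n) {\<phi> \<in> test_forms CARD('n). set_current E \<phi> \<in> U}"
      unfolding open_forms_def
    proof (intro conjI allI impI ballI)
      fix K :: "(real ^ 'n::{finite,linorder}) set" and \<phi>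
      assume K: "compact K" and "\<phi> \<in> {\<phi> \<in> test_forms CARD('n). set_current E \<phi> \<in> U} \<inter> test_forms_in K CARD('n)"
      then have \<phi>: "\<phi> \<in> test_forms CARD('n)" "set_current E \<phi> \<in> U" "\<phi> \<in> test_forms_in K CARD('n)" by auto
      obtain e where e: "e > 0" "\<And>y. dist y (set_current E \<phi>) < e \<Longrightarrow> y \<in> U"
        using U \<phi>(2) unfolding open_dist by blast
      define d where "d = e / (measure lborel K + 1)"
      have d: "d > 0" using e by (simp add: d_def add_nonneg_pos)
      have "form_nbhd K CARD('n) \<phi> 0 d \<subseteq> {\<phi> \<in> test_forms CARD('n). set_current E \<phi> \<in> U}"
      proof
        fix \<psi> assume \<psi>: "\<psi> \<in> form_nbhd K CARD('n) \<phi> 0 d"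
        then have \<psi>K: "\<psi> \<in> test_forms_in K CARD('n)" by (simp add: form_nbhd_def)
        then have \<psi>t: "\<psi> \<in> test_forms CARD('n)" using K unfolding test_forms_def by blast
        have "range (std_frame :: nat \<Rightarrow> (real, 'n) vec) \<subseteq> Basis" by (auto simp: std_frame_def)
        then have lt: "\<bar>\<psi> x std_frame - \<phi> x std_frame\<bar> < d" for x
          using \<psi> unfolding form_nbhd_def by (auto dest!: spec[of _ "[]"])
        define h where "h = (\<lambda>x. \<psi> x std_frame + (-1) * \<phi> x std_frame)"
        have "set_current E \<psi> - set_current E \<phi> = set_lebesgue_integral lebesgue E h"
          unfolding set_current_def h_def
          using set_integral_diff(2)[OF set_integrable_test_function[OF E test_form_coefficient[OF \<psi>t, of std_frame]]
              set_integrable_test_function[OF E test_form_coefficient[OF \<phi>(1), of std_frame]]] by simp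
        moreover have "\<bar>set_lebesgue_integral lebesgue E h\<bar> \<le> measure lborel K * d"
        proof (rule abs_set_integral_le[OF E _ K])
          show "test_function h" unfolding h_def
            by (rule test_function_add[OF test_form_coefficient[OF \<psi>t]
                  test_function_mult_left[OF test_form_coefficient[OF \<phi>(1)]]])
          show "h x = 0" if "x \<notin> K" for x
            using \<psi>K \<phi>(3) that by (simp add: test_forms_in_def h_def)
          show "\<bar>h x\<bar> \<le> d" for x using lt[of x] by (simp add: h_def)
        qed
        moreover have "measure lborel K * d < e"
        proof -
          have "0 < measure lborel K + 1" by (simp add: add_nonneg_pos)
          then show ?thesis unfolding d_def using e(1) by (simp add: pos_divide_less_eq algebra_simps)
        qed
        ultimately have "dist (set_current E \<psi>) (set_current E \<phi>) < e" by (simp add: dist_real_def)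
        then show "\<psi> \<in> {\<phi> \<in> test_forms CARD('n). set_current E \<phi> \<in> U}" using e(2) \<psi>t by blast
      qed
      then show "\<exists>N. \<exists>\<epsilon>>0. form_nbhd K CARD('n) \<phi> N \<epsilon> \<subseteq> {\<phi> \<in> test_forms CARD('n). set_current E \<phi> \<in> U}"
        using d by blast
    qed auto
  qed simp
qed

lemma current_symdiff_current:
  fixes \<Omega> \<Sigma> :: "(real ^ 'n::{finite,linorder}) set"
  assumes "\<Omega> \<in> sets lebesgue" "\<Sigma> \<in> sets lebesgue"
  shows "current CARD('n) (symdiff_current \<Sigma> \<Omega>)"
  using current_set_current[OF assms(1)] current_set_current[OF assms(2)]
  unfolding current_def symdiff_current_def
  by (auto simp: right_diff_distrib intro: continuous_map_diff)

lemma mass_symdiff_current_le: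
  fixes \<Omega> \<Sigma> :: "(real ^ 'n::{finite,linorder}) set"
  assumes \<Omega>: "\<Omega> \<in> sets lebesgue" and \<Sigma>: "\<Sigma> \<in> sets lebesgue"
  shows "mass CARD('n) (symdiff_current \<Sigma> \<Omega>) \<le> emeasure lebesgue (sym_diff \<Sigma> \<Omega>)"
  unfolding mass_def
proof (rule SUP_least)
  fix \<phi> :: "(real, 'n) vec form"
  assume "\<phi> \<in> {\<phi> \<in> test_forms CARD('n). \<forall>x. comass CARD('n) (\<phi> x) \<le> 1}"
  then have \<phi>: "\<phi> \<in> test_forms CARD('n)" "\<And>x. comass CARD('n) (\<phi> x) \<le> 1" by auto
  let ?f = "\<lambda>x. \<phi> x std_frame"
  have f1: "\<bar>?f x\<bar> \<le> 1" for x
    using abs_std_frame_le_comass[of "\<phi> x"] \<phi>(1) \<phi>(2)[of x] by (simp add: mem_test_forms_iff)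
  note i\<Omega> = set_integrable_test_function[OF \<Omega> test_form_coefficient[OF \<phi>(1)], of std_frame, unfolded set_integrable_def]
  note i\<Sigma> = set_integrable_test_function[OF \<Sigma> test_form_coefficient[OF \<phi>(1)], of std_frame, unfolded set_integrable_def]
  have "symdiff_current \<Sigma> \<Omega> \<phi> = (LINT x|lebesgue. indicator \<Omega> x *\<^sub>R ?f x - indicator \<Sigma> x *\<^sub>R ?f x)"
    unfolding symdiff_current_def set_current_def set_lebesgue_integral_def using i\<Omega> i\<Sigma> by simp
  also have "ennreal \<dots> \<le> (\<integral>\<^sup>+x. ennreal (indicator (sym_diff \<Sigma> \<Omega>) x) \<partial>lebesgue)"
    by (rule ennreal_integral_le_nn_integral) (use i\<Omega> i\<Sigma> f1 in \<open>auto simp: indicator_def\<close>)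
  also have "\<dots> = emeasure lebesgue (sym_diff \<Sigma> \<Omega>)"
    using \<Omega> \<Sigma> by (simp add: ennreal_indicator)
  finally show "ennreal (symdiff_current \<Sigma> \<Omega> \<phi>) \<le> emeasure lebesgue (sym_diff \<Sigma> \<Omega>)" .
qed

lemma divergence_scaleR:
  assumes "smooth X"
  shows "divergence (\<lambda>x. c *\<^sub>R X x) = (\<lambda>x. c * divergence X x)"
proof
  fix x
  have D: "((\<lambda>x. c *\<^sub>R X x) has_derivative (\<lambda>h. c *\<^sub>R frechet_derivative X (at x) h)) (at x)"
    by (intro has_derivative_scaleR_right smooth_has_derivative assms)
  show "divergence (\<lambda>x. c *\<^sub>R X x) x = c * divergence X x"
    unfolding divergence_def frechet_derivative_at[OF D, symmetric] by (simp add: sum_distrib_left)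
qed

lemma set_current_vol_form: "set_current E (vol_form f) = set_lebesgue_integral lebesgue E f"
  by (simp add: set_current_def vol_form_def vol_std_frame)

text \<open>
  Under the identification of forms with vector fields, \<open>\<phi>\<close> becomes a competitor in the definition of
  the perimeter, up to the sign in \<open>grad_indicator\<close>.
\<close>

lemma mass_boundary_set_current_le:
  fixes E :: "(real ^ 'n::{finite,linorder}) set"
  assumes n: "Suc n = CARD('n)"
  shows "mass n (boundary n (set_current E)) \<le> perimeter E"
  unfolding mass_def
proof (rule SUP_least)
  fix \<phi> :: "(real, 'n) vec form"
  assume "\<phi> \<in> {\<phi> \<in> test_forms n. \<forall>x. comass n (\<phi> x) \<le> 1}"
  then have \<phi>: "\<phi> \<in> test_forms n" "\<And>x. comass n (\<phi> x) \<le> 1" by auto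
  let ?X = "\<lambda>x. dual_vector (\<phi> x)"
  define Y where "Y = (\<lambda>x. (-1) *\<^sub>R ?X x)"
  have tX: "test_function ?X" by (rule dual_vector_test_field[OF \<phi>(1)])
  have "norm (?X x) = comass n (\<phi> x)" for x
  proof -
    have "\<phi> x = (\<lambda>v. vol (case_nat (?X x) v))"
      using codim1_covector_eq[OF n] \<phi>(1) by (auto simp: mem_test_forms_iff)
    then have "comass n (\<phi> x) = comass n (\<lambda>v. vol (case_nat (?X x) v))" by (rule arg_cong)
    also have "\<dots> = norm (?X x)" by (rule comass_contract_vol[OF n])
    finally show ?thesis by simp
  qed
  then have "Y \<in> {X \<in> test_fields. \<forall>x. norm (X x) \<le> 1}"
    using \<phi>(2) test_function_scaleR[OF tX, of "-1"] by (simp add: Y_def test_fields_eq)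
  moreover have "boundary n (set_current E) \<phi> = grad_indicator E Y"
  proof -
    have "smooth ?X" using tX by (simp add: test_function_def)
    then show ?thesis
      unfolding boundary_def ext_deriv_eq_divergence[OF n \<phi>(1)] set_current_vol_form
        grad_indicator_def Y_def divergence_scaleR[OF \<open>smooth ?X\<close>]
      by (simp add: set_lebesgue_integral_def)
  qed
  ultimately show "ennreal (boundary n (set_current E) \<phi>) \<le> perimeter E"
    unfolding perimeter_def by (metis (no_types, lifting) SUP_upper)
qed

section \<open>The flat norm of the boundary of a set\<close>

text \<open>
  Masses and perimeters are one-sided suprema over arguments of norm at most one. Rescaling, also by negative
  factors, turns them into two-sided bounds.
\<close>

lemma homogeneous_bound:
  fixes f :: "'a \<Rightarrow> 'b::real_normed_vector"
  assumes hom: "\<And>c. T (\<lambda>x. c *\<^sub>R f x) = c * T f"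
    and m: "\<And>c. (\<And>x. norm (c *\<^sub>R f x) \<le> 1) \<Longrightarrow> ennreal (T (\<lambda>x. c *\<^sub>R f x)) \<le> m" "m < \<infinity>"
    and B: "\<And>x. norm (f x) \<le> B"
  shows "\<bar>T f\<bar> \<le> enn2real m * B"
proof (cases "B = 0")
  case True
  then have "(\<lambda>x. 0 *\<^sub>R f x) = f" using B by (auto simp: fun_eq_iff)
  then show ?thesis using hom[of 0] True by simp
next
  case False
  then have B0: "B > 0" using B[of undefined] norm_ge_zero[of "f undefined"] by linarith
  have "c * T f \<le> enn2real m" if "\<bar>c\<bar> = 1 / B" for c
  proof -
    have "norm (c *\<^sub>R f x) \<le> 1" for x
      using mult_left_mono[OF B[of x], of "\<bar>c\<bar>"] B0 that by simp
    then have "ennreal (T (\<lambda>x. c *\<^sub>R f x)) \<le> m" by (rule m(1))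
    then have "ennreal (c * T f) \<le> ennreal (enn2real m)" using m(2) hom[of c] by simp
    then show ?thesis by (subst (asm) ennreal_le_iff) auto
  qed
  from this[of "1 / B"] this[of "- (1 / B)"] show ?thesis
    using B0 by (simp add: field_simps abs_le_iff)
qed

text \<open>
  The indicator of a Borel set is measurable for products of Borel measures, as the uses of Fubini's
  theorem demand; energies and currents only see a set up to null sets.
\<close>

lemma borel_representative:
  fixes \<Omega> :: "'a::euclidean_space set"
  assumes "\<Omega> \<in> sets lebesgue"
  obtains \<Omega>' where "\<Omega>' \<in> sets borel" "AE x in lebesgue. x \<in> \<Omega> \<longleftrightarrow> x \<in> \<Omega>'"
proof -
  obtain C T where C: "fsigma C" "T \<in> null_sets lebesgue" "C \<union> T = \<Omega>" "disjnt C T"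
    using lebesgue_set_almost_fsigma[OF assms] by blast
  have "C \<in> sets borel" using C(1) by (auto elim!: fsigma.cases)
  moreover have "AE x in lebesgue. x \<in> \<Omega> \<longleftrightarrow> x \<in> C"
    using AE_not_in[OF C(2)] by eventually_elim (use C(3) in auto)
  ultimately show thesis by (rule that)
qed

text \<open>
  An \<open>m\<close>-current of finite mass acts on \<open>f vol\<close> as a functional \<open>S'\<close> of order zero. For \<open>\<phi>\<close> obtained by contracting
  the volume form with \<open>X\<close>, the current \<open>R = \<partial>[\<Omega>] - \<partial>S\<close> is the divergence of \<open>X\<close> evaluated by \<open>[\<Omega>] - S\<close>. These are the
  hypotheses of \<open>mollified_lower_bound\<close>. If one of the two masses is infinite, so is the right-hand side.
\<close>

lemma flat_norm_competitor_lower_bound: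
  fixes \<Omega> :: "(real ^ 'n::{finite,linorder}) set"
  assumes n: "Suc n = CARD('n)" and l: "l > 0"
    and \<Omega>: "\<Omega> \<in> sets lebesgue" and per: "perimeter \<Omega> < \<infinity>"
    and c: "\<And>E. E \<in> sets lebesgue \<Longrightarrow> c \<le> F_CE l \<Omega> E"
    and S: "current (Suc n) S"
  shows "c \<le> ennreal l * mass (Suc n) S + mass n (\<lambda>\<phi>. bdry_current \<Omega> \<phi> - boundary n S \<phi>)"
proof -
  define R where "R = (\<lambda>\<phi>. bdry_current \<Omega> \<phi> - boundary n S \<phi>)"
  show ?thesis
  proof (cases "mass (Suc n) S = \<infinity> \<or> mass n R = \<infinity>")
    case True
    then have "ennreal l * mass (Suc n) S + mass n R = \<infinity>"
      using l by (auto simp: ennreal_mult_top)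
    then show ?thesis unfolding R_def by (metis infinity_ennreal_def top_greatest)
  next
    case False
    then have fin: "mass (Suc n) S < \<infinity>" "mass n R < \<infinity>" by (auto simp: less_top)
    obtain \<Omega>' where \<Omega>': "\<Omega>' \<in> sets borel" "AE x in lebesgue. x \<in> \<Omega> \<longleftrightarrow> x \<in> \<Omega>'"
      using borel_representative[OF \<Omega>] by blast
    have \<Omega>'l: "\<Omega>' \<in> sets lebesgue" using \<Omega>'(1) by simp
    have F: "F_CE l \<Omega> E = F_CE l \<Omega>' E" if "E \<in> sets borel" for E
    proof -
      have "emeasure lebesgue (sym_diff E \<Omega>) = emeasure lebesgue (sym_diff E \<Omega>')"
      proof (rule emeasure_eq_AE)
        show "AE x in lebesgue. x \<in> sym_diff E \<Omega> \<longleftrightarrow> x \<in> sym_diff E \<Omega>'"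
          using \<Omega>'(2) by eventually_elim auto
        have "E \<in> sets lebesgue" using that by simp
        then show "sym_diff E \<Omega> \<in> sets lebesgue" "sym_diff E \<Omega>' \<in> sets lebesgue"
          using \<Omega> \<Omega>'l by blast+
      qed
      then show ?thesis by (simp add: F_CE_def)
    qed
    have int: "set_lebesgue_integral lebesgue \<Omega> f = set_functional \<Omega>' f" if "test_function f" for f
    proof -
      have "continuous_on UNIV f" using that smooth_continuous_on by (auto simp: test_function_def)
      then have fm: "f \<in> borel_measurable borel" by (rule borel_measurable_continuous_onI)
      have "set_lebesgue_integral lebesgue \<Omega> f = set_lebesgue_integral lebesgue \<Omega>' f"
        unfolding set_lebesgue_integral_def
      proof (rule integral_cong_AE)
        show "AE x in lebesgue. indicator \<Omega> x *\<^sub>R f x = indicator \<Omega>' x *\<^sub>R f x"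
          using \<Omega>'(2) by eventually_elim (auto simp: indicator_def)
      qed (use set_integrable_test_function[OF \<Omega> that] set_integrable_test_function[OF \<Omega>'l that]
            in \<open>auto simp: set_integrable_def\<close>)
      then show ?thesis using set_integral_lebesgue_eq[OF \<Omega>'(1) fm] by (simp add: set_functional_def)
    qed
    have tdiv: "test_function (divergence X)" if X: "test_function X" for X :: "real ^ 'n::{finite,linorder} \<Rightarrow> real ^ 'n::{finite,linorder}"
    proof -
      have "test_function (\<lambda>x. \<Sum>b\<in>Basis. frechet_derivative X (at x) b \<bullet> b)"
      proof (rule test_function_sum)
        fix b :: "real ^ 'n::{finite,linorder}"
        have "test_function (\<lambda>x. frechet_derivative X (at x) b)" by (rule test_function_frechet_derivative[OF X])
        then show "test_function (\<lambda>x. frechet_derivative X (at x) b \<bullet> b)"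
          unfolding test_function_def
          using smooth_linear_compose[of "\<lambda>y. y \<bullet> b"] bounded_linear_inner_left[of b]
          by (auto simp: bounded_linear.linear)
      qed
      then show ?thesis by (simp add: divergence_def[abs_def])
    qed
    have scale: "divergence (\<lambda>x. c *\<^sub>R X x) = (\<lambda>x. c * divergence X x)" if "test_function X" for X :: "real ^ 'n::{finite,linorder} \<Rightarrow> real ^ 'n::{finite,linorder}" and c
      using that divergence_scaleR by (auto simp: test_function_def)
    define S' where "S' = (\<lambda>f. S (vol_form f))"
    have S'mult: "S' (\<lambda>x. c * f x) = c * S' f" if "test_function f" for c f
    proof -
      have "vol_form (\<lambda>x. c * f x) = (\<lambda>x v. c * vol_form f x v)" by (simp add: vol_form_def mult.assoc)
      then show ?thesis using S vol_form_test_form[OF that] n by (simp add: current_def S'_def)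
    qed
    have M1: "\<bar>S' f\<bar> \<le> enn2real (mass (Suc n) S) * B" if f: "test_function f" and B: "\<And>x. \<bar>f x\<bar> \<le> B" for f B
    proof (rule homogeneous_bound[where f=f and T=S', OF _ _ fin(1)])
      show "S' (\<lambda>x. c *\<^sub>R f x) = c * S' f" for c using S'mult[OF f] by simp
      fix c :: real assume 1: "\<And>x. norm (c *\<^sub>R f x) \<le> 1"
      have "vol_form (\<lambda>x. c *\<^sub>R f x) \<in> test_forms (Suc n)"
        unfolding n by (intro vol_form_test_form test_function_scaleR f)
      moreover have "comass (Suc n) (vol_form (\<lambda>x. c *\<^sub>R f x) x) \<le> 1" for x
        unfolding n vol_form_def using comass_vol_scale_le[of "c *\<^sub>R f x", where 'n='n] 1[of x] by simp
      ultimately show "ennreal (S' (\<lambda>x. c *\<^sub>R f x)) \<le> mass (Suc n) S"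
        unfolding mass_def S'_def by (intro SUP_upper) simp
    qed (use B in simp)
    have S'dist: "radon_functional S'"
      unfolding radon_functional_def
    proof (intro conjI allI impI)
      fix f g :: "real ^ 'n::{finite,linorder} \<Rightarrow> real" assume fg: "test_function f" "test_function g"
      have "vol_form (\<lambda>x. f x + g x) = (\<lambda>x v. vol_form f x v + vol_form g x v)" by (simp add: vol_form_def distrib_right)
      then show "S' (\<lambda>x. f x + g x) = S' f + S' g"
        using S vol_form_test_form[OF fg(1)] vol_form_test_form[OF fg(2)] n by (simp add: current_def S'_def)
    next
      fix K :: "(real ^ 'n::{finite,linorder}) set"
      show "\<exists>C. \<forall>f B. test_function f \<longrightarrow> (\<forall>x. x \<notin> K \<longrightarrow> f x = 0) \<longrightarrow> (\<forall>x. \<bar>f x\<bar> \<le> B) \<longrightarrow> \<bar>S' f\<bar> \<le> C * B"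
        using M1 by blast
    qed (rule S'mult)
    have R: "R (contract_vol X) = set_functional \<Omega>' (divergence X) - S' (divergence X)" if X: "test_function X" for X
    proof -
      have "CARD('n) - 1 = n" using n by simp
      then show ?thesis
        unfolding R_def bdry_current_def boundary_def S'_def
        by (simp add: ext_deriv_contract_vol[OF n X] set_current_vol_form int[OF tdiv[OF X]])
    qed
    have M2: "\<bar>set_functional \<Omega>' (divergence X) - S' (divergence X)\<bar> \<le> enn2real (mass n R) * B"
      if X: "test_function X" and B: "\<And>x. norm (X x) \<le> B" for X B
    proof (rule homogeneous_bound[where f=X and T="\<lambda>X. set_functional \<Omega>' (divergence X) - S' (divergence X)", OF _ _ fin(2) B])
      show "set_functional \<Omega>' (divergence (\<lambda>x. c *\<^sub>R X x)) - S' (divergence (\<lambda>x. c *\<^sub>R X x)) =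
         c * (set_functional \<Omega>' (divergence X) - S' (divergence X))" for c
        unfolding scale[OF X] S'mult[OF tdiv[OF X]] radon_functional_mult[OF radon_functional_set_functional[OF \<Omega>'(1)] tdiv[OF X]]
        by (simp add: algebra_simps)
      fix c :: real assume 1: "\<And>x. norm (c *\<^sub>R X x) \<le> 1"
      have t: "test_function (\<lambda>x. c *\<^sub>R X x)" by (rule test_function_scaleR[OF X])
      have "comass n (contract_vol (\<lambda>x. c *\<^sub>R X x) x) \<le> 1" for x
        unfolding contract_vol_def comass_contract_vol[OF n] by (rule 1)
      then have "ennreal (R (contract_vol (\<lambda>x. c *\<^sub>R X x))) \<le> mass n R"
        unfolding mass_def by (intro SUP_upper) (simp add: contract_vol_test_form[OF n t])
      then show "ennreal (set_functional \<Omega>' (divergence (\<lambda>x. c *\<^sub>R X x)) - S' (divergence (\<lambda>x. c *\<^sub>R X x))) \<le> mass n R"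
        unfolding R[OF t] .
    qed
    have P: "\<bar>set_functional \<Omega>' (divergence X)\<bar> \<le> enn2real (perimeter \<Omega>) * B"
      if X: "test_function X" and B: "\<And>x. norm (X x) \<le> B" for X B
    proof (rule homogeneous_bound[where f=X and T="\<lambda>X. set_functional \<Omega>' (divergence X)", OF _ _ per B])
      show hom: "set_functional \<Omega>' (divergence (\<lambda>x. c *\<^sub>R X x)) = c * set_functional \<Omega>' (divergence X)" for c
        unfolding scale[OF X] radon_functional_mult[OF radon_functional_set_functional[OF \<Omega>'(1)] tdiv[OF X]] ..
      fix c :: real assume 1: "\<And>x. norm (c *\<^sub>R X x) \<le> 1"
      have "ennreal (grad_indicator \<Omega> (\<lambda>x. (- c) *\<^sub>R X x)) \<le> perimeter \<Omega>"
        unfolding perimeter_def using test_function_scaleR[OF X, of "- c"] 1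
        by (intro SUP_upper) (simp add: test_fields_eq)
      moreover have "grad_indicator \<Omega> (\<lambda>x. (- c) *\<^sub>R X x) = set_functional \<Omega>' (divergence (\<lambda>x. c *\<^sub>R X x))"
        unfolding grad_indicator_def int[OF tdiv[OF test_function_scaleR[OF X]]] hom by simp
      ultimately show "ennreal (set_functional \<Omega>' (divergence (\<lambda>x. c *\<^sub>R X x))) \<le> perimeter \<Omega>" by simp
    qed
    have cE: "c \<le> F_CE l \<Omega>' E" if "E \<in> sets borel" for E
      using c[of E] F[OF that] that by simp
    have "c \<le> ennreal l * ennreal (enn2real (mass (Suc n) S)) + ennreal (enn2real (mass n R))"
      by (rule mollified_lower_bound[OF \<Omega>'(1) _ P S'dist _ M1 _ M2 _ cE])
         (use l in auto)
    then show ?thesis using fin by (simp add: R_def)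
  qed
qed

theorem theorem2p3:
  fixes l :: real and \<Omega> \<Sigma> :: "(real ^ 'n::{finite,linorder}) set" and n :: nat
  assumes "l > 0"
    and "\<Omega> \<in> sets lebesgue" and "perimeter \<Omega> < \<infinity>"
    and "n = CARD('n) - 1"
    and "is_arg_min (F_CE l \<Omega>) (\<lambda>E. E \<in> sets lebesgue) \<Sigma>"
  shows "flat_norm l n (bdry_current \<Omega>) = F_CE l \<Omega> \<Sigma> \<and>
    optimal_decomposition l n (bdry_current \<Omega>) (symdiff_current \<Sigma> \<Omega>)"
proof -
  have n: "Suc n = CARD('n)" using assms(4) zero_less_card_finite[where 'a='n] by simp
  have \<Sigma>: "\<Sigma> \<in> sets lebesgue" and min: "\<And>E. E \<in> sets lebesgue \<Longrightarrow> F_CE l \<Omega> \<Sigma> \<le> F_CE l \<Omega> E"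
    using assms(5) by (auto simp: is_arg_min_def not_less)
  let ?S = "symdiff_current \<Sigma> \<Omega>"
  let ?value = "\<lambda>S. ennreal l * mass (Suc n) S + mass n (\<lambda>\<phi>. bdry_current \<Omega> \<phi> - boundary n S \<phi>)"
  have S: "current (Suc n) ?S" unfolding n by (rule current_symdiff_current[OF assms(2) \<Sigma>])
  have "(\<lambda>\<phi>. bdry_current \<Omega> \<phi> - boundary n ?S \<phi>) = boundary n (set_current \<Sigma>)"
    using assms(4) by (simp add: bdry_current_def boundary_def symdiff_current_def)
  then have "?value ?S \<le> ennreal l * emeasure lebesgue (sym_diff \<Sigma> \<Omega>) + perimeter \<Sigma>"
    using mass_symdiff_current_le[OF assms(2) \<Sigma>] mass_boundary_set_current_le[OF n] n
    by (intro add_mono mult_left_mono) auto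
  then have upper: "?value ?S \<le> F_CE l \<Omega> \<Sigma>" by (simp add: F_CE_def add.commute)
  have lower: "F_CE l \<Omega> \<Sigma> \<le> flat_norm l n (bdry_current \<Omega>)"
    unfolding flat_norm_def
    by (intro INF_greatest flat_norm_competitor_lower_bound[OF n assms(1-3) min]) auto
  have "flat_norm l n (bdry_current \<Omega>) \<le> ?value ?S"
    unfolding flat_norm_def using S by (intro INF_lower) simp
  with upper lower have "flat_norm l n (bdry_current \<Omega>) = F_CE l \<Omega> \<Sigma>" "flat_norm l n (bdry_current \<Omega>) = ?value ?S"
    by auto
  then show ?thesis using S by (simp add: optimal_decomposition_def)
qed

end
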